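(* Let $n\ge 1$ and $0\le k\le n$. The vector space ${}'\mathcal B_k(\mathbb R^n)$ of differential $k$-chains is a proper subspace of the vector space $\mathcal B_k'(\mathbb R^n)$, the continuous dual of the Fréchet space $\mathcal B_k(\mathbb R^n)$; i.e. the canonical evaluation map $u:{}'\mathcal B_k(\mathbb R^n)\to\mathcal B_k'(\mathbb R^n)$ is injective and not surjective.
   Context: Work on $U=\mathbb R^n$. $\mathcal P_k$ is the real vector space of finite formal sums $A=\sum_{i=1}^s (p_i;\alpha_i)$ with $p_i\in \mathbb R^n$, $\alpha_i\in\Lambda_k(\mathbb R^n)$ (finitely supported sections of $\Lambda_k(T\mathbb R^n)$), with $(p;\cdot)$ linear. For a $k$-form $\omega$ put $\int_A\omega:=\sum_{i=1}^s\omega(p_i;\alpha_i)$. $\mathcal B_k^r$ ($r\ge 0$) is the space of $C^r$ $k$-forms on $\mathbb R^n$ whose Lie derivatives $L_{v_1}\cdots L_{v_j}\omega$, $0\le j\le r$, along constant unit vector fields are bounded, with the supremum norm of these derivatives denoted $\|\omega\|_{C^r}$. $\mathcal B_k=\varprojlim_r\mathcal B_k^r$ is the Fréchet space of smooth $k$-forms with all derivatives bounded, with the topology given by the norms $\|\cdot\|_{C^r}$, $r\ge 0$. On $\mathcal P_k$ define $\|A\|_{B^r}=\sup_{0\neq\omega\in\mathcal B_k^r}\frac{\int_A\omega}{\|\omega\|_{C^r}}$, decreasing in $r$. Let $\hat{\mathcal B}_k^r$ be the Banach space completion of $(\mathcal P_k,\|\cdot\|_{B^r})$, and $\hat{\mathcal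 B}_k=\varinjlim_r\hat{\mathcal B}_k^r$ along the canonical maps, with the locally convex inductive limit topology. ${}'\mathcal B_k$ is the completion of $\hat{\mathcal B}_k$. Each $\omega\in\mathcal B_k$ extends uniquely from $\mathcal P_k$ to a continuous linear functional on ${}'\mathcal B_k$, and in this way $({}'\mathcal B_k)'=\mathcal B_k$. The map $u$ sends $J\in{}'\mathcal B_k$ to the functional $\omega\mapsto\omega(J)$ on $\mathcal B_k$. *)

theory Defs
  imports "HOL-Analysis.Analysis"
begin

section \<open>Locally convex spaces on explicit carriers\<close>

text \<open>
  The spaces below depend on natural numbers (degree, order of differentiability), hence are
  structures with explicit carriers. A locally convex space is a real vector space with a family
  of seminorms; only the values of the operations and seminorms on the carrier matter.
\<close>

record 'a vspace =
  vcarrier :: "'a set"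
  vzero :: 'a
  vadd :: "'a \<Rightarrow> 'a \<Rightarrow> 'a"
  vscale :: "real \<Rightarrow> 'a \<Rightarrow> 'a"

record 'a lcs = "'a vspace" +
  seminorms :: "('a \<Rightarrow> real) set"

definition vdiff :: "('a, 'm) vspace_scheme \<Rightarrow> 'a \<Rightarrow> 'a \<Rightarrow> 'a" where
  "vdiff E x y = vadd E x (vscale E (-1) y)"

definition vlinear :: "('a, 'm) vspace_scheme \<Rightarrow> ('b, 'l) vspace_scheme \<Rightarrow> ('a \<Rightarrow> 'b) \<Rightarrow> bool" where
  "vlinear E G f \<longleftrightarrow> f ` vcarrier E \<subseteq> vcarrier G \<and>
     (\<forall>x\<in>vcarrier E. \<forall>y\<in>vcarrier E. f (vadd E x y) = vadd G (f x) (f y)) \<and>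
     (\<forall>c. \<forall>x\<in>vcarrier E. f (vscale E c x) = vscale G c (f x))"

definition is_seminorm :: "('a, 'm) vspace_scheme \<Rightarrow> ('a \<Rightarrow> real) \<Rightarrow> bool" where
  "is_seminorm E q \<longleftrightarrow>
     (\<forall>x\<in>vcarrier E. 0 \<le> q x) \<and>
     (\<forall>x\<in>vcarrier E. \<forall>y\<in>vcarrier E. q (vadd E x y) \<le> q x + q y) \<and>
     (\<forall>c. \<forall>x\<in>vcarrier E. q (vscale E c x) = \<bar>c\<bar> * q x)"

definition lc_topology :: "('a, 'm) lcs_scheme \<Rightarrow> 'a topology" where
  "lc_topology E = topology_generated_by (insert (vcarrier E)
     {{y \<in> vcarrier E. q (vdiff E y x) < e} | q x e. q \<in> seminorms E \<and> x \<in> vcarrier E \<and> e > 0})"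

definition real_vspace :: "real vspace" where
  "real_vspace = \<lparr>vcarrier = UNIV, vzero = 0, vadd = (+), vscale = (*)\<rparr>"

text \<open>Functionals are made extensional so that equality of functionals is equality on the carrier.\<close>

definition cont_dual :: "('a, 'm) lcs_scheme \<Rightarrow> ('a \<Rightarrow> real) vspace" where
  "cont_dual E =
     \<lparr>vcarrier = {f \<in> extensional (vcarrier E). vlinear E real_vspace f \<and>
                    continuous_map (lc_topology E) euclideanreal f},
      vzero = (\<lambda>x\<in>vcarrier E. 0),
      vadd = (\<lambda>f g. \<lambda>x\<in>vcarrier E. f x + g x),
      vscale = (\<lambda>c f. \<lambda>x\<in>vcarrier E. c * f x)\<rparr>"


section \<open>Completion\<close>

text \<open>
  The Hausdorff completion: its points are the minimal Cauchy filters. In the order on filters,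
  a larger filter contains fewer sets, so set-theoretic minimality is maximality for \<open>\<le>\<close>. Every Cauchy
  filter contains a unique minimal one, which is the point it converges to.
\<close>

definition lc_cauchy :: "('a, 'm) lcs_scheme \<Rightarrow> 'a filter \<Rightarrow> bool" where
  "lc_cauchy E F \<longleftrightarrow> F \<noteq> bot \<and> F \<le> principal (vcarrier E) \<and>
     (\<forall>q\<in>seminorms E. \<forall>e>0. \<forall>\<^sub>F (x, y) in F \<times>\<^sub>F F. q (vdiff E x y) < e)"

definition min_cauchy :: "('a, 'm) lcs_scheme \<Rightarrow> 'a filter \<Rightarrow> bool" where
  "min_cauchy E F \<longleftrightarrow> lc_cauchy E F \<and> (\<forall>G. lc_cauchy E G \<and> F \<le> G \<longrightarrow> G = F)"

definition compl_point :: "('a, 'm) lcs_scheme \<Rightarrow> 'a filter \<Rightarrow> 'a filter" where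
  "compl_point E F = (THE G. min_cauchy E G \<and> F \<le> G)"

definition completion :: "('a, 'm) lcs_scheme \<Rightarrow> 'a filter lcs" where
  "completion E =
     \<lparr>vcarrier = {F. min_cauchy E F},
      vzero = compl_point E (principal {vzero E}),
      vadd = (\<lambda>F G. compl_point E (filtermap (\<lambda>(x, y). vadd E x y) (F \<times>\<^sub>F G))),
      vscale = (\<lambda>c F. compl_point E (filtermap (vscale E c) F)),
      seminorms = {(\<lambda>F. Lim F q) | q. q \<in> seminorms E}\<rparr>"


section \<open>Countable inductive limits\<close>

text \<open>
  \<open>E r\<close> are the steps and \<open>c r s\<close> (for \<open>r \<le> s\<close>) the connecting maps. The limit is the disjoint union
  of the steps modulo eventual equality, with the finest locally convex topology for which
  all maps \<open>ind_inj E c r\<close> are continuous.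
\<close>

definition ind_rel ::
  "(nat \<Rightarrow> 'a lcs) \<Rightarrow> (nat \<Rightarrow> nat \<Rightarrow> 'a \<Rightarrow> 'a) \<Rightarrow> ((nat \<times> 'a) \<times> (nat \<times> 'a)) set" where
  "ind_rel E c = {((r, x), (s, y)). x \<in> vcarrier (E r) \<and> y \<in> vcarrier (E s) \<and>
                    (\<exists>t. r \<le> t \<and> s \<le> t \<and> c r t x = c s t y)}"

definition ind_inj ::
  "(nat \<Rightarrow> 'a lcs) \<Rightarrow> (nat \<Rightarrow> nat \<Rightarrow> 'a \<Rightarrow> 'a) \<Rightarrow> nat \<Rightarrow> 'a \<Rightarrow> (nat \<times> 'a) set" where
  "ind_inj E c r x = ind_rel E c `` {(r, x)}"

definition ind_vspace ::
  "(nat \<Rightarrow> 'a lcs) \<Rightarrow> (nat \<Rightarrow> nat \<Rightarrow> 'a \<Rightarrow> 'a) \<Rightarrow> (nat \<times> 'a) set vspace" where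
  "ind_vspace E c =
     \<lparr>vcarrier = (SIGMA r:UNIV. vcarrier (E r)) // ind_rel E c,
      vzero = ind_inj E c 0 (vzero (E 0)),
      vadd = (\<lambda>X Y. the_elem {ind_inj E c r (vadd (E r) x y) | r x y. (r, x) \<in> X \<and> (r, y) \<in> Y}),
      vscale = (\<lambda>a X. the_elem {ind_inj E c r (vscale (E r) a x) | r x. (r, x) \<in> X})\<rparr>"

definition ind_limit ::
  "(nat \<Rightarrow> 'a lcs) \<Rightarrow> (nat \<Rightarrow> nat \<Rightarrow> 'a \<Rightarrow> 'a) \<Rightarrow> (nat \<times> 'a) set lcs" where
  "ind_limit E c = vspace.extend (ind_vspace E c) (lcs.fields
     {q. is_seminorm (ind_vspace E c) q \<and>
         (\<forall>r. continuous_map (lc_topology (E r)) euclideanreal (q \<circ> ind_inj E c r))})"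


section \<open>Differential forms\<close>

text \<open>
  The exterior algebra of \<open>real ^ 'n\<close> in coordinates: the component with index \<open>I :: 'n set\<close> is the
  coefficient of the basis element \<open>e\<^sub>I\<close>, the wedge product of the standard basis vectors with index in \<open>I\<close>
  (in a fixed order). The Euclidean inner product makes these orthonormal, which is the
  usual inner product on multivectors. Covectors are written in the dual basis, so
  the value of a covector on a multivector is their inner product.
\<close>

type_synonym 'n multivec = "real ^ ('n set)"

definition Lam :: "nat \<Rightarrow> ('n::finite) multivec set" where
  "Lam k = {a. \<forall>I. card I \<noteq> k \<longrightarrow> a $ I = 0}"

type_synonym 'n form = "real ^ 'n \<Rightarrow> 'n multivec"

text \<open>The flow of a constant vector field consists of translations, which act trivially on covectors.\<close>

definition lie :: "'a::real_normed_vector \<Rightarrow> ('a \<Rightarrow> 'b::real_normed_vector) \<Rightarrow> 'a \<Rightarrow> 'b" where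
  "lie v \<omega> p = vector_derivative (\<lambda>t. \<omega> (p + t *\<^sub>R v)) (at 0)"

primrec C_class :: "nat \<Rightarrow> ('a::real_normed_vector \<Rightarrow> 'b::real_normed_vector) \<Rightarrow> bool" where
  "C_class 0 \<omega> \<longleftrightarrow> continuous_on UNIV \<omega>"
| "C_class (Suc r) \<omega> \<longleftrightarrow> (\<forall>p. \<omega> differentiable (at p)) \<and> (\<forall>v. C_class r (lie v \<omega>))"

definition lie_values :: "nat \<Rightarrow> ('n::finite) form \<Rightarrow> 'n multivec set" where
  "lie_values r \<omega> = {foldr lie vs \<omega> p | vs p. length vs \<le> r \<and> (\<forall>v\<in>set vs. norm v = 1)}"

definition C_norm :: "nat \<Rightarrow> ('n::finite) form \<Rightarrow> real" where
  "C_norm r \<omega> = (SUP a\<in>lie_values r \<omega>. norm a)"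

definition B_forms_r :: "nat \<Rightarrow> nat \<Rightarrow> ('n::finite) form set" where
  "B_forms_r k r = {\<omega>. range \<omega> \<subseteq> Lam k \<and> C_class r \<omega> \<and> bounded (lie_values r \<omega>)}"

definition B_forms :: "nat \<Rightarrow> ('n::finite) form lcs" where
  "B_forms k =
     \<lparr>vcarrier = (\<Inter>r. B_forms_r k r),
      vzero = (\<lambda>p. 0),
      vadd = (\<lambda>\<omega> \<eta> p. \<omega> p + \<eta> p),
      vscale = (\<lambda>c \<omega> p. c *\<^sub>R \<omega> p),
      seminorms = range C_norm\<rparr>"


section \<open>Differential chains\<close>

text \<open>A finite formal sum is the finitely supported section sending each point to its multivector.\<close>

type_synonym 'n dirac = "real ^ 'n \<Rightarrow> 'n multivec"

definition dirac_chains :: "nat \<Rightarrow> ('n::finite) dirac set" where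
  "dirac_chains k = {A. range A \<subseteq> Lam k \<and> finite {p. A p \<noteq> 0}}"

definition dirac_integral :: "('n::finite) form \<Rightarrow> 'n dirac \<Rightarrow> real" where
  "dirac_integral \<omega> A = (\<Sum>p | A p \<noteq> 0. \<omega> p \<bullet> A p)"

definition B_norm :: "nat \<Rightarrow> nat \<Rightarrow> ('n::finite) dirac \<Rightarrow> real" where
  "B_norm k r A = (SUP \<omega>\<in>B_forms_r k r - {\<lambda>p. 0}. dirac_integral \<omega> A / C_norm r \<omega>)"

definition dirac_space :: "nat \<Rightarrow> nat \<Rightarrow> ('n::finite) dirac lcs" where
  "dirac_space k r =
     \<lparr>vcarrier = dirac_chains k,
      vzero = (\<lambda>p. 0),
      vadd = (\<lambda>A B p. A p + B p),
      vscale = (\<lambda>c A p. c *\<^sub>R A p),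
      seminorms = {B_norm k r}\<rparr>"

definition hat_B_r :: "nat \<Rightarrow> nat \<Rightarrow> ('n::finite) dirac filter lcs" where
  "hat_B_r k r = completion (dirac_space k r)"

text \<open>The continuous extension of the identity of Dirac chains, for \<open>r \<le> s\<close>.\<close>

definition hat_B_map :: "nat \<Rightarrow> nat \<Rightarrow> nat \<Rightarrow> ('n::finite) dirac filter \<Rightarrow> 'n dirac filter" where
  "hat_B_map k r s F = compl_point (dirac_space k s) F"

definition hat_B :: "nat \<Rightarrow> (nat \<times> ('n::finite) dirac filter) set lcs" where
  "hat_B k = ind_limit (hat_B_r k) (hat_B_map k)"

definition diff_chains :: "nat \<Rightarrow> (nat \<times> ('n::finite) dirac filter) set filter lcs" where
  "diff_chains k = completion (hat_B k)"

text \<open>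
  The extension of a form by continuity, first to \<open>hat_B\<close> (on the representatives of a class the
  limits agree) and then to its completion.
\<close>

definition hat_B_eval :: "('n::finite) form \<Rightarrow> (nat \<times> 'n dirac filter) set \<Rightarrow> real" where
  "hat_B_eval \<omega> X = the_elem {Lim F (dirac_integral \<omega>) | r F. (r, F) \<in> X}"

definition chain_eval :: "('n::finite) form \<Rightarrow> (nat \<times> 'n dirac filter) set filter \<Rightarrow> real" where
  "chain_eval \<omega> J = Lim J (hat_B_eval \<omega>)"

definition eval_map ::
  "nat \<Rightarrow> (nat \<times> ('n::finite) dirac filter) set filter \<Rightarrow> 'n form \<Rightarrow> real" where
  "eval_map k J = (\<lambda>\<omega>\<in>vcarrier (B_forms k). chain_eval \<omega> J)"

end

theory Submission
  imports Defs
begin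

text \<open>
  For a set \<open>S\<close> of forms that is bounded in every norm \<open>C\<^sup>r\<close>, the gauge \<open>sup {\<bar>\<omega>(X)\<bar> | \<omega> \<in> S}\<close> is a
  continuous seminorm on the inductive limit, so on \<open>S\<close> every chain \<open>J\<close> is a uniform limit of
  Dirac chains. Hence \<open>J\<close> is bounded on bounded sets of forms, which on a Frechet space means
  continuous, and \<open>\<omega>\<^sub>j(J) \<longlonglongrightarrow> \<omega>(J)\<close> whenever \<open>\<omega>\<^sub>j \<longlonglongrightarrow> \<omega>\<close> pointwise with \<open>\<omega>\<^sub>j\<close> in \<open>S\<close>. The latter fails for
  an extended limit \<open>L\<close> along suitable points tending to infinity: the forms \<open>cos (x\<^sub>i / 3\<^sup>j) e\<^sub>I\<close> tend
  pointwise to \<open>e\<^sub>I\<close>, while \<open>L\<close> vanishes on all of them and is \<open>1\<close> on \<open>e\<^sub>I\<close>.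

  For injectivity, Hahn--Banach shows that a continuous seminorm on the inductive limit is normed on
  Dirac chains by functionals bounded for every norm \<open>B\<^sup>r\<close>. Such a functional is integration of a
  form, and testing it on difference quotients of Dirac chains shows that this form is smooth with
  bounded derivatives. So two chains with the same values on all forms are at distance \<open>0\<close>
  in every continuous seminorm.
\<close>

section \<open>Vector spaces on a carrier and the Hahn--Banach theorem\<close>

text \<open>A functional bounded for a single norm B^r need not be integration of a form of class
  C^r: \<open>B_norm k 0\<close> is the mass, and every bounded section, continuous or not, is
  bounded for it. Regularity is therefore bought with two orders: the B^2 bound controls difference
  quotients and second differences, and with them the existence and linearity of first derivatives;
  each derivative then shifts the sequence of bounds by one. The loss is harmless because a
  continuous seminorm on the inductive limit supplies a bound for every r.

  What replaces it is that a single Dirac chain approximates J on all of a bounded set of forms, so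
  that a pointwise limit of forms only has to be tested on a finite sum. Powers of 3 occur because
  dividing (pi / 2) 3^m by 3^j with j <= m leaves an odd multiple of pi / 2, a zero of the cosine;
  frequencies of absolute value at most 1 keep all derivatives bounded by the same constant.\<close>

locale vspace_on =
  fixes E :: "('a, 'm) vspace_scheme"
  assumes zero_closed [simp]: "vzero E \<in> vcarrier E"
    and add_closed [simp]: "x \<in> vcarrier E \<Longrightarrow> y \<in> vcarrier E \<Longrightarrow> vadd E x y \<in> vcarrier E"
    and scale_closed [simp]: "x \<in> vcarrier E \<Longrightarrow> vscale E c x \<in> vcarrier E"
    and add_assoc: "x \<in> vcarrier E \<Longrightarrow> y \<in> vcarrier E \<Longrightarrow> z \<in> vcarrier E \<Longrightarrow>
          vadd E (vadd E x y) z = vadd E x (vadd E y z)"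
    and add_commute: "x \<in> vcarrier E \<Longrightarrow> y \<in> vcarrier E \<Longrightarrow> vadd E x y = vadd E y x"
    and scale_zero: "x \<in> vcarrier E \<Longrightarrow> vscale E 0 x = vzero E"
    and scale_one: "x \<in> vcarrier E \<Longrightarrow> vscale E 1 x = x"
    and scale_scale: "x \<in> vcarrier E \<Longrightarrow> vscale E a (vscale E b x) = vscale E (a * b) x"
    and scale_left_distrib: "x \<in> vcarrier E \<Longrightarrow> vscale E (a + b) x = vadd E (vscale E a x) (vscale E b x)"
    and scale_right_distrib: "x \<in> vcarrier E \<Longrightarrow> y \<in> vcarrier E \<Longrightarrow>
          vscale E a (vadd E x y) = vadd E (vscale E a x) (vscale E a y)"
begin

abbreviation carr where "carr \<equiv> vcarrier E"
abbreviation add (infixl \<open>\<oplus>\<close> 65) where "x \<oplus> y \<equiv> vadd E x y"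
abbreviation scale (infixr \<open>\<odot>\<close> 75) where "c \<odot> x \<equiv> vscale E c x"
abbreviation diff (infixl \<open>\<ominus>\<close> 65) where "x \<ominus> y \<equiv> vdiff E x y"

lemma add_left_commute:
  "x \<in> carr \<Longrightarrow> y \<in> carr \<Longrightarrow> z \<in> carr \<Longrightarrow> x \<oplus> (y \<oplus> z) = y \<oplus> (x \<oplus> z)"
  by (metis add_assoc add_commute)

lemmas add_ac = add_assoc add_commute add_left_commute

lemma zero_add: "x \<in> carr \<Longrightarrow> vzero E \<oplus> x = x"
  using scale_left_distrib[of x 0 1] by (simp add: scale_zero scale_one)

lemma scale_vzero: "c \<odot> vzero E = vzero E"
  using scale_scale[of "vzero E" c 0] scale_zero[of "vzero E"] by simp

lemma add_uminus: "x \<in> carr \<Longrightarrow> x \<oplus> (-1) \<odot> x = vzero E"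
  using scale_left_distrib[of x 1 "-1"] by (simp add: scale_zero scale_one)

lemma uminus_add: "x \<in> carr \<Longrightarrow> (-1) \<odot> x \<oplus> x = vzero E"
  using add_uminus add_commute by (metis scale_closed)

lemma diff_closed [simp]: "x \<in> carr \<Longrightarrow> y \<in> carr \<Longrightarrow> x \<ominus> y \<in> carr"
  by (simp add: vdiff_def)

lemma diff_self: "x \<in> carr \<Longrightarrow> x \<ominus> x = vzero E"
  by (simp add: vdiff_def add_uminus)

lemma diff_add_cancel: "x \<in> carr \<Longrightarrow> y \<in> carr \<Longrightarrow> (x \<ominus> y) \<oplus> y = x"
  by (simp add: vdiff_def add_assoc uminus_add) (metis add_commute zero_add zero_closed)

lemma diff_add_diff:
  assumes "x \<in> carr" "y \<in> carr" "z \<in> carr"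
  shows "(x \<ominus> y) \<oplus> (y \<ominus> z) = x \<ominus> z"
proof -
  have "(x \<ominus> y) \<oplus> (y \<ominus> z) = ((x \<ominus> y) \<oplus> y) \<oplus> (-1) \<odot> z"
    using assms by (simp add: vdiff_def add_assoc)
  then show ?thesis
    using assms by (simp add: diff_add_cancel) (simp add: vdiff_def)
qed

lemma uminus_diff: "x \<in> carr \<Longrightarrow> y \<in> carr \<Longrightarrow> (-1) \<odot> (x \<ominus> y) = y \<ominus> x"
  by (simp add: vdiff_def scale_right_distrib scale_scale scale_one add_commute)

lemma add_diff_add:
  "x \<in> carr \<Longrightarrow> y \<in> carr \<Longrightarrow> x' \<in> carr \<Longrightarrow> y' \<in> carr \<Longrightarrow>
    (x \<oplus> y) \<ominus> (x' \<oplus> y') = (x \<ominus> x') \<oplus> (y \<ominus> y')"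
  by (simp add: vdiff_def scale_right_distrib add_ac)

lemma scale_diff: "x \<in> carr \<Longrightarrow> y \<in> carr \<Longrightarrow> c \<odot> x \<ominus> c \<odot> y = c \<odot> (x \<ominus> y)"
  by (simp add: vdiff_def scale_right_distrib scale_scale mult.commute)

section \<open>Sublinear functions and Hahn--Banach\<close>

definition sublinear :: "('a \<Rightarrow> real) \<Rightarrow> bool" where
  "sublinear p \<longleftrightarrow> (\<forall>x\<in>carr. \<forall>y\<in>carr. p (x \<oplus> y) \<le> p x + p y) \<and>
     (\<forall>c\<ge>0. \<forall>x\<in>carr. p (c \<odot> x) = c * p x)"

lemma sublinear_zero: "sublinear p \<Longrightarrow> p (vzero E) = 0"
  using scale_zero[of "vzero E"] unfolding sublinear_def by (metis mult_zero_left order_refl zero_closed)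

lemma sublinear_lower: "sublinear p \<Longrightarrow> x \<in> carr \<Longrightarrow> - p ((-1) \<odot> x) \<le> p x"
  using add_uminus[of x] sublinear_zero[of p] unfolding sublinear_def
  by (smt (verit) scale_closed)

text \<open>The descent step of the Hahn--Banach argument: below \<open>p\<close> there is a sublinear function
  that is as small as possible at \<open>- x\<^sub>0\<close>.\<close>

lemma sublinear_descent:
  assumes p: "sublinear p" and x0: "x0 \<in> carr"
  obtains p' where "sublinear p'" "\<forall>x\<in>carr. p' x \<le> p x" "p' ((-1) \<odot> x0) \<le> - p x0"
proof -
  \<comment> \<open>At x = - x0 the parameter t = 1 gives p(0) - p(x0) = - p(x0), the required
    value; t = 0 gives the bound by p.\<close>
  define g where "g x t = p (x \<oplus> t \<odot> x0) - t * p x0" for x t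
  define p' where "p' x = (INF t\<in>{0..}. g x t)" for x
  have padd: "p (x \<oplus> y) \<le> p x + p y" if "x \<in> carr" "y \<in> carr" for x y
    using p that by (simp add: sublinear_def)
  have pscale: "p (c \<odot> x) = c * p x" if "0 \<le> c" "x \<in> carr" for c x
    using p that by (simp add: sublinear_def)
  have lower: "- p ((-1) \<odot> x) \<le> g x t" if "x \<in> carr" "0 \<le> t" for x t
  proof -
    have "t \<odot> x0 = (-1) \<odot> x \<oplus> (x \<oplus> t \<odot> x0)"
      using that x0 by (simp add: add_assoc[symmetric] uminus_add zero_add)
    then have "p (t \<odot> x0) \<le> p ((-1) \<odot> x) + p (x \<oplus> t \<odot> x0)"
      using padd[of "(-1) \<odot> x" "x \<oplus> t \<odot> x0"] that x0 by simp
    then show ?thesis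
      using pscale[OF that(2) x0] by (simp add: g_def)
  qed
  have bdd: "bdd_below (g x ` {0..})" if "x \<in> carr" for x
    using lower[OF that] by (intro bdd_belowI2[where m = "- p ((-1) \<odot> x)"]) auto
  have le: "p' x \<le> g x t" if "x \<in> carr" "0 \<le> t" for x t
    unfolding p'_def using bdd that by (intro cINF_lower) auto
  have ge: "c \<le> p' x" if "\<And>t. 0 \<le> t \<Longrightarrow> c \<le> g x t" for c x
    unfolding p'_def using that by (intro cINF_greatest) auto
  have add: "p' (x \<oplus> y) \<le> p' x + p' y" if xy: "x \<in> carr" "y \<in> carr" for x y
  proof -
    have *: "p' (x \<oplus> y) \<le> g x s + g y t" if st: "0 \<le> s" "0 \<le> t" for s t
    proof -
      have "(x \<oplus> y) \<oplus> (s + t) \<odot> x0 = (x \<oplus> s \<odot> x0) \<oplus> (y \<oplus> t \<odot> x0)"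
        using xy x0 by (simp add: scale_left_distrib add_ac)
      then have "g (x \<oplus> y) (s + t) \<le> g x s + g y t"
        using padd[of "x \<oplus> s \<odot> x0" "y \<oplus> t \<odot> x0"] xy x0 by (simp add: g_def algebra_simps)
      then show ?thesis
        using le[of "x \<oplus> y" "s + t"] st xy by simp
    qed
    have "p' (x \<oplus> y) - g y t \<le> p' x" if "0 \<le> t" for t
      using *[of _ t] that by (intro ge) (simp add: algebra_simps)
    then have "p' (x \<oplus> y) - p' x \<le> p' y"
      by (intro ge) (simp add: algebra_simps)
    then show ?thesis by simp
  qed
  have scale_le: "p' (c \<odot> x) \<le> c * p' x" if "0 < c" "x \<in> carr" for c x
  proof -
    have "p' (c \<odot> x) / c \<le> g x t" if t: "0 \<le> t" for t
    proof -
      have "c \<odot> x \<oplus> (c * t) \<odot> x0 = c \<odot> (x \<oplus> t \<odot> x0)"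
        using \<open>x \<in> carr\<close> x0 by (simp add: scale_right_distrib scale_scale)
      then have "g (c \<odot> x) (c * t) = c * g x t"
        using pscale[of c "x \<oplus> t \<odot> x0"] \<open>x \<in> carr\<close> \<open>0 < c\<close> x0 by (simp add: g_def algebra_simps)
      then have "p' (c \<odot> x) \<le> c * g x t"
        using le[of "c \<odot> x" "c * t"] \<open>x \<in> carr\<close> \<open>0 < c\<close> t by simp
      then show ?thesis
        using \<open>0 < c\<close> by (simp add: field_simps)
    qed
    then have "p' (c \<odot> x) / c \<le> p' x" by (rule ge)
    then show ?thesis using \<open>0 < c\<close> by (simp add: field_simps)
  qed
  have zero: "p' (vzero E) = 0"
  proof (rule antisym)
    show "p' (vzero E) \<le> 0"
      using le[of "vzero E" 0] scale_zero[OF x0] zero_add[of "vzero E"] sublinear_zero[OF p]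
      by (simp add: g_def)
    show "0 \<le> p' (vzero E)"
      by (rule ge) (use pscale[OF _ x0] x0 in \<open>simp add: g_def zero_add\<close>)
  qed
  have "p' (c \<odot> x) = c * p' x" if "0 \<le> c" "x \<in> carr" for c x
  proof (cases "c = 0")
    case True
    then show ?thesis using that zero by (simp add: scale_zero)
  next
    case False
    then have c: "0 < c" using that by simp
    have "p' x \<le> p' (c \<odot> x) / c"
      using scale_le[of "1 / c" "c \<odot> x"] c that by (simp add: scale_scale scale_one)
    with scale_le[of c x] c that show ?thesis by (simp add: field_simps)
  qed
  with add have "sublinear p'" by (simp add: sublinear_def)
  moreover have "p' x \<le> p x" if "x \<in> carr" for x
    using le[OF that, of 0] scale_zero[OF x0] zero_add[OF that] that add_commute[OF that zero_closed]
    by (simp add: g_def)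
  moreover have "p' ((-1) \<odot> x0) \<le> - p x0"
    using le[of "(-1) \<odot> x0" 1] x0 sublinear_zero[OF p] by (simp add: g_def scale_one uminus_add)
  ultimately show ?thesis using that by blast
qed

text \<open>Zorn's lemma for the pointwise order. A chain is bounded below at x by - p(- x), which
  makes its pointwise infimum a finite sublinear function. Restriction to \<open>extensional\<close>
  functions makes the order antisymmetric.\<close>

lemma minimal_sublinear_exists:
  assumes p: "sublinear p"
  obtains m where "sublinear m" "\<forall>x\<in>carr. m x \<le> p x"
    "\<And>m' x. sublinear m' \<Longrightarrow> \<forall>x\<in>carr. m' x \<le> m x \<Longrightarrow> x \<in> carr \<Longrightarrow> m' x = m x"
proof -
  define A where "A = {m \<in> extensional carr. sublinear m \<and> (\<forall>x\<in>carr. m x \<le> p x)}"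
  \<comment> \<open>\<open>R a b\<close> says that b lies below a, so that the maximal element
    produced by Zorn's lemma is a minimal function.\<close>
  define R :: "('a \<Rightarrow> real) \<Rightarrow> ('a \<Rightarrow> real) \<Rightarrow> bool" where "R a b \<longleftrightarrow> (\<forall>x\<in>carr. b x \<le> a x)" for a b
  have sub_restrict: "sublinear (restrict m carr)" if "sublinear m" for m
    using that by (simp add: sublinear_def)
  have po: "partial_order_on A (relation_of R A)"
  proof (rule partial_order_on_relation_ofI)
    show "\<And>a. a \<in> A \<Longrightarrow> R a a" by (simp add: R_def)
    show "\<And>a b c. a \<in> A \<Longrightarrow> b \<in> A \<Longrightarrow> c \<in> A \<Longrightarrow> R a b \<Longrightarrow> R b c \<Longrightarrow> R a c"
      unfolding R_def by (meson order_trans)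
    show "\<And>a b. a \<in> A \<Longrightarrow> b \<in> A \<Longrightarrow> R a b \<Longrightarrow> R b a \<Longrightarrow> a = b"
      unfolding R_def A_def by (auto intro: extensionalityI antisym)
  qed
  have ub: "\<exists>u\<in>A. \<forall>a\<in>C. R a u" if C: "C \<in> Chains (relation_of R A)" for C
  proof (cases "C = {}")
    case True
    have "restrict p carr \<in> A" using p sub_restrict by (simp add: A_def)
    with True show ?thesis by blast
  next
    case False
    have CA: "C \<subseteq> A" and tot: "\<And>a b. a \<in> C \<Longrightarrow> b \<in> C \<Longrightarrow> R a b \<or> R b a"
      using C by (auto simp: Chains_def relation_of_def)
    have sub: "sublinear a" and lep: "\<And>x. x \<in> carr \<Longrightarrow> a x \<le> p x" if "a \<in> C" for a
      using CA that by (auto simp: A_def)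
    define u where "u = (\<lambda>x\<in>carr. INF a\<in>C. a x)"
    have bdd: "bdd_below ((\<lambda>a. a x) ` C)" if x: "x \<in> carr" for x
    proof (rule bdd_belowI2)
      show "- p ((-1) \<odot> x) \<le> a x" if "a \<in> C" for a
        using sublinear_lower[OF sub[OF that] x] lep[OF that, of "(-1) \<odot> x"] x by simp
    qed
    have le: "u x \<le> a x" if "a \<in> C" "x \<in> carr" for a x
      using cINF_lower[OF bdd[OF that(2)] that(1)] that(2) by (simp add: u_def)
    have ge: "c \<le> u x" if "\<And>a. a \<in> C \<Longrightarrow> c \<le> a x" "x \<in> carr" for c x
      using that False by (simp add: u_def cINF_greatest)
    have add: "u (x \<oplus> y) \<le> u x + u y" if xy: "x \<in> carr" "y \<in> carr" for x y
    proof -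
      have *: "u (x \<oplus> y) \<le> a x + b y" if ab: "a \<in> C" "b \<in> C" for a b
      proof -
        \<comment> \<open>The smaller of a and b serves at both points; this is where the chain
          property enters.\<close>
        obtain c where c: "c \<in> C" "c x \<le> a x" "c y \<le> b y"
          using tot[OF ab] ab xy unfolding R_def by blast
        have "u (x \<oplus> y) \<le> c (x \<oplus> y)" using le c xy by simp
        also have "\<dots> \<le> c x + c y" using sub[OF c(1)] xy by (simp add: sublinear_def)
        finally show ?thesis using c by simp
      qed
      have "u (x \<oplus> y) - b y \<le> u x" if "b \<in> C" for b
        using *[OF _ that] xy by (intro ge) (simp_all add: algebra_simps)
      then have "u (x \<oplus> y) - u x \<le> u y"
        using xy by (intro ge) (simp_all add: algebra_simps)
      then show ?thesis by simp
    qed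
    have scale: "u (c \<odot> x) = c * u x" if cx: "0 \<le> c" "x \<in> carr" for c x
    proof -
      have eq: "a (c \<odot> x) = c * a x" if "a \<in> C" for a
        using sub[OF that] cx by (simp add: sublinear_def)
      show ?thesis
      proof (cases "c = 0")
        case True
        have "(\<lambda>a. a (c \<odot> x)) ` C = (\<lambda>a. 0) ` C"
          using eq True by (intro image_cong) auto
        then have "u (c \<odot> x) = (INF a\<in>C. 0)" using cx by (simp add: u_def)
        then show ?thesis using True False by simp
      next
        case nz: False
        then have c: "0 < c" using cx by simp
        have "u (c \<odot> x) / c \<le> a x" if "a \<in> C" for a
          using le[OF that, of "c \<odot> x"] eq[OF that] cx c by (simp add: field_simps)
        then have "u (c \<odot> x) / c \<le> u x" using cx by (intro ge)
        moreover have "c * u x \<le> a (c \<odot> x)" if "a \<in> C" for a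
          using le[OF that, of x] eq[OF that] cx c by simp
        then have "c * u x \<le> u (c \<odot> x)" using cx by (intro ge) auto
        ultimately show ?thesis using c by (simp add: field_simps)
      qed
    qed
    obtain a where "a \<in> C" using False by blast
    then have "\<forall>x\<in>carr. u x \<le> p x"
      using le lep by (meson order_trans)
    with add scale have "u \<in> A"
      by (simp add: A_def sublinear_def u_def)
    with le show ?thesis by (auto simp: R_def)
  qed
  obtain m where m: "m \<in> A" "\<And>a. a \<in> A \<Longrightarrow> R m a \<Longrightarrow> a = m"
    using predicate_Zorn[OF po ub] by blast
  show ?thesis
  proof (rule that[of m])
    show "sublinear m" "\<forall>x\<in>carr. m x \<le> p x" using m by (auto simp: A_def)
    fix m' x assume m': "sublinear m'" "\<forall>x\<in>carr. m' x \<le> m x" and x: "x \<in> carr"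
    have "restrict m' carr \<in> A"
      using m' m(1) sub_restrict by (force simp: A_def)
    then have "restrict m' carr = m"
      using m(2)[of "restrict m' carr"] m' by (simp add: R_def)
    then show "m' x = m x" using x by (metis restrict_apply')
  qed
qed

text \<open>A minimal sublinear function is linear: the descent step cannot lower it, so m(- x) <= -
  m(x), and an odd subadditive function is additive. Minimizing below the result of one descent of p
  at x0 forces the value p(x0) there, without extending a functional from a subspace.\<close>

theorem Hahn_Banach:
  assumes p: "sublinear p" and x0: "x0 \<in> carr"
  obtains L where "vlinear E real_vspace L" "\<forall>x\<in>carr. L x \<le> p x" "L x0 = p x0"
proof -
  obtain p' where p': "sublinear p'" "\<forall>x\<in>carr. p' x \<le> p x" "p' ((-1) \<odot> x0) \<le> - p x0"
    using sublinear_descent[OF p x0] by blast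
  obtain m where m: "sublinear m" "\<forall>x\<in>carr. m x \<le> p' x"
    and min: "\<And>m' x. sublinear m' \<Longrightarrow> \<forall>x\<in>carr. m' x \<le> m x \<Longrightarrow> x \<in> carr \<Longrightarrow> m' x = m x"
    using minimal_sublinear_exists[OF p'(1)] by blast
  have madd: "m (x \<oplus> y) \<le> m x + m y" if "x \<in> carr" "y \<in> carr" for x y
    using m(1) that by (simp add: sublinear_def)
  have mscale: "m (c \<odot> x) = c * m x" if "0 \<le> c" "x \<in> carr" for c x
    using m(1) that by (simp add: sublinear_def)
  have odd: "m ((-1) \<odot> x) = - m x" if x: "x \<in> carr" for x
  proof (rule antisym)
    obtain m' where m': "sublinear m'" "\<forall>x\<in>carr. m' x \<le> m x" "m' ((-1) \<odot> x) \<le> - m x"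
      using sublinear_descent[OF m(1) x] by blast
    then show "m ((-1) \<odot> x) \<le> - m x"
      using min[OF m'(1,2), of "(-1) \<odot> x"] x by simp
    show "- m x \<le> m ((-1) \<odot> x)" using sublinear_lower[OF m(1) x] by simp
  qed
  have add: "m (x \<oplus> y) = m x + m y" if xy: "x \<in> carr" "y \<in> carr" for x y
  proof (rule antisym)
    show "m (x \<oplus> y) \<le> m x + m y" using madd xy .
    have "x = (x \<oplus> y) \<oplus> (-1) \<odot> y"
      using xy by (simp add: add_assoc add_uminus) (metis add_commute zero_add zero_closed)
    then have "m x \<le> m (x \<oplus> y) + m ((-1) \<odot> y)"
      using madd[of "x \<oplus> y" "(-1) \<odot> y"] xy by simp
    then show "m x + m y \<le> m (x \<oplus> y)" using odd[OF xy(2)] by simp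
  qed
  have scale: "m (c \<odot> x) = c * m x" if "x \<in> carr" for c x
  proof (cases "0 \<le> c")
    case False
    have "c \<odot> x = (-1) \<odot> ((- c) \<odot> x)" using that by (simp add: scale_scale)
    then show ?thesis using odd[of "(- c) \<odot> x"] mscale[of "- c" x] False that by simp
  qed (use mscale that in simp)
  have lep: "m x \<le> p x" if "x \<in> carr" for x
    using m(2) p'(2) that by (meson order_trans)
  have "- m x0 \<le> - p x0"
    using m(2) p'(3) odd[OF x0] x0 by (metis order_trans scale_closed)
  then have "m x0 = p x0" using lep[OF x0] by simp
  with add scale lep show ?thesis
    by (intro that[of m]) (auto simp: vlinear_def real_vspace_def)
qed

end

lemma tendsto_cauchyI:
  fixes f :: "'a \<Rightarrow> 'b::banach"
  assumes "F \<noteq> bot"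
    and "\<And>e. 0 < e \<Longrightarrow> \<exists>P. eventually P F \<and> (\<forall>x y. P x \<and> P y \<longrightarrow> norm (f x - f y) < e)"
  shows "\<exists>l. (f \<longlongrightarrow> l) F"
proof -
  have "cauchy_filter (filtermap f F)"
    unfolding cauchy_filter_metric_filtermap dist_norm using assms(2) by blast
  then have "\<exists>l. filtermap f F \<le> nhds l"
    by (rule cauchy_filter_complete_converges[where A = UNIV])
      (use assms(1) in \<open>auto simp: complete_UNIV filtermap_bot_iff\<close>)
  then show ?thesis by (simp add: filterlim_def)
qed

section \<open>Locally convex spaces and their completion\<close>

locale lcs_on = vspace_on E for E :: "('a, 'm) lcs_scheme" +
  assumes seminorm: "q \<in> seminorms E \<Longrightarrow> is_seminorm E q"
begin

lemma seminorm_nonneg: "q \<in> seminorms E \<Longrightarrow> x \<in> carr \<Longrightarrow> 0 \<le> q x"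
  using seminorm unfolding is_seminorm_def by blast

lemma seminorm_add: "q \<in> seminorms E \<Longrightarrow> x \<in> carr \<Longrightarrow> y \<in> carr \<Longrightarrow> q (x \<oplus> y) \<le> q x + q y"
  using seminorm unfolding is_seminorm_def by blast

lemma seminorm_scale: "q \<in> seminorms E \<Longrightarrow> x \<in> carr \<Longrightarrow> q (c \<odot> x) = \<bar>c\<bar> * q x"
  using seminorm unfolding is_seminorm_def by blast

lemma seminorm_zero: "q \<in> seminorms E \<Longrightarrow> q (vzero E) = 0"
  using seminorm_scale[of q "vzero E" 0] scale_zero[of "vzero E"] by simp

lemma seminorm_diff_self: "q \<in> seminorms E \<Longrightarrow> x \<in> carr \<Longrightarrow> q (x \<ominus> x) = 0"
  by (simp add: diff_self seminorm_zero)

lemma seminorm_diff_commute: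
  "q \<in> seminorms E \<Longrightarrow> x \<in> carr \<Longrightarrow> y \<in> carr \<Longrightarrow> q (x \<ominus> y) = q (y \<ominus> x)"
  using seminorm_scale[of q "x \<ominus> y" "-1"] by (simp add: uminus_diff)

lemma seminorm_diff_triangle:
  "q \<in> seminorms E \<Longrightarrow> x \<in> carr \<Longrightarrow> y \<in> carr \<Longrightarrow> z \<in> carr \<Longrightarrow> q (x \<ominus> z) \<le> q (x \<ominus> y) + q (y \<ominus> z)"
  using seminorm_add[of q "x \<ominus> y" "y \<ominus> z"] by (simp add: diff_add_diff)

lemma seminorm_reverse_triangle:
  assumes "q \<in> seminorms E" "x \<in> carr" "y \<in> carr"
  shows "\<bar>q x - q y\<bar> \<le> q (x \<ominus> y)"
  using seminorm_add[of q "x \<ominus> y" y] seminorm_add[of q "y \<ominus> x" x] assms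
    seminorm_diff_commute[OF assms] by (simp add: diff_add_cancel)

text \<open>One notion for linear functionals and seminorms alike: a Lipschitz bound by a single
  seminorm gives continuity as well as convergence along every Cauchy filter.\<close>

definition lipschitz :: "('a \<Rightarrow> real) \<Rightarrow> bool" where
  "lipschitz f \<longleftrightarrow> (\<exists>q\<in>seminorms E. \<exists>M>0. \<forall>x\<in>carr. \<forall>y\<in>carr. \<bar>f x - f y\<bar> \<le> M * q (x \<ominus> y))"

lemma lipschitzI:
  assumes "q \<in> seminorms E" "\<And>x y. x \<in> carr \<Longrightarrow> y \<in> carr \<Longrightarrow> \<bar>f x - f y\<bar> \<le> M * q (x \<ominus> y)"
  shows "lipschitz f"
  unfolding lipschitz_def
\<comment> \<open>\<open>lipschitz\<close> asks for a positive constant, whatever the sign of M, so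
  that later arguments may divide by it.\<close>
proof (intro bexI[OF _ assms(1)] exI[of _ "\<bar>M\<bar> + 1"] conjI ballI)
  fix x y assume xy: "x \<in> carr" "y \<in> carr"
  have "M * q (x \<ominus> y) \<le> (\<bar>M\<bar> + 1) * q (x \<ominus> y)"
    using seminorm_nonneg[OF assms(1), of "x \<ominus> y"] xy by (intro mult_right_mono) auto
  then show "\<bar>f x - f y\<bar> \<le> (\<bar>M\<bar> + 1) * q (x \<ominus> y)" using assms(2)[OF xy] by simp
qed auto

lemma lipschitz_linearI:
  assumes f: "vlinear E real_vspace f" and q: "q \<in> seminorms E"
    and le: "\<And>x. x \<in> carr \<Longrightarrow> \<bar>f x\<bar> \<le> M * q x"
  shows "lipschitz f"
proof (rule lipschitzI[OF q])
  fix x y assume xy: "x \<in> carr" "y \<in> carr"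
  have "f (x \<ominus> y) = f x - f y"
    using f xy by (simp add: vlinear_def vdiff_def real_vspace_def)
  then show "\<bar>f x - f y\<bar> \<le> M * q (x \<ominus> y)" using le[of "x \<ominus> y"] xy by simp
qed

lemma lipschitz_seminorm: "q \<in> seminorms E \<Longrightarrow> lipschitz q"
  by (rule lipschitzI[where M = 1]) (auto simp: seminorm_reverse_triangle)

lemma topspace_lc_topology: "topspace (lc_topology E) = carr"
  by (auto simp: lc_topology_def)

lemma continuous_map_lipschitz:
  assumes "lipschitz f"
  shows "continuous_map (lc_topology E) euclideanreal f"
proof -
  obtain q M where q: "q \<in> seminorms E" and M: "0 < M"
    and lip: "\<And>x y. x \<in> carr \<Longrightarrow> y \<in> carr \<Longrightarrow> \<bar>f x - f y\<bar> \<le> M * q (x \<ominus> y)"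
    using assms unfolding lipschitz_def by blast
  show ?thesis
    unfolding continuous_map_def topspace_lc_topology
  proof (intro conjI allI impI)
    fix U :: "real set" assume "openin euclideanreal U"
    then have U: "open U" by simp
    show "openin (lc_topology E) {x \<in> carr. f x \<in> U}"
    proof (subst openin_subopen, intro ballI)
      fix x assume "x \<in> {x \<in> carr. f x \<in> U}"
      then have x: "x \<in> carr" "f x \<in> U" by auto
      obtain e where e: "e > 0" "\<And>y. \<bar>y - f x\<bar> < e \<Longrightarrow> y \<in> U"
        using U x(2) unfolding open_dist dist_real_def by blast
      let ?B = "{y \<in> carr. q (y \<ominus> x) < e / M}"
      have "openin (lc_topology E) ?B"
        unfolding lc_topology_def
        using q x e M divide_pos_pos[of e M] by (intro topology_generated_by_Basis) blast
      moreover have "x \<in> ?B"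
        using x e M q by (simp add: seminorm_diff_self)
      moreover have "?B \<subseteq> {x \<in> carr. f x \<in> U}"
      proof
        fix y assume "y \<in> ?B"
        then have y: "y \<in> carr" "q (y \<ominus> x) < e / M" by auto
        have "\<bar>f y - f x\<bar> \<le> M * q (y \<ominus> x)" using lip y x by simp
        also have "\<dots> < e" using y M by (simp add: field_simps)
        finally show "y \<in> {x \<in> carr. f x \<in> U}" using e y by simp
      qed
      ultimately show "\<exists>T. openin (lc_topology E) T \<and> x \<in> T \<and> T \<subseteq> {x \<in> carr. f x \<in> U}"
        by blast
    qed
  qed auto
qed

text \<open>Continuity at 0 gives a p-ball on which q < 1, and homogeneity spreads this to all x.
  This turns the topological condition in the definition of the inductive limit into an
  inequality.\<close>

lemma continuous_seminorm_bounded: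
  assumes sn: "seminorms E = {p}" and q: "is_seminorm E q"
    and cont: "continuous_map (lc_topology E) euclideanreal q"
  obtains M where "0 \<le> M" "\<And>x. x \<in> carr \<Longrightarrow> q x \<le> M * p x"
proof -
  have p: "p \<in> seminorms E" using sn by simp
  \<comment> \<open>The topology is given by a subbase, so balls around the points of an open set
    are found by induction on its generation.\<close>
  have nbhd: "\<exists>e>0. {y \<in> carr. p (y \<ominus> x) < e} \<subseteq> U"
    if "openin (lc_topology E) U" "x \<in> U" for U x
  proof -
    have "generate_topology_on (insert carr {{y \<in> carr. q (y \<ominus> x) < e} | q x e.
        q \<in> seminorms E \<and> x \<in> carr \<and> e > 0}) U"
      using that(1) by (simp add: lc_topology_def openin_topology_generated_by_iff)
    then show ?thesis using that(2)
    proof (induction arbitrary: x)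
      case Empty
      then show ?case by simp
    next
      case (Int a b)
      then obtain e1 e2 where "e1 > 0" "e2 > 0" "{y \<in> carr. p (y \<ominus> x) < e1} \<subseteq> a"
        "{y \<in> carr. p (y \<ominus> x) < e2} \<subseteq> b" by (meson IntE)
      then show ?case by (intro exI[of _ "min e1 e2"]) auto
    next
      case (UN K)
      then obtain k where k: "k \<in> K" "x \<in> k" by auto
      from UN.IH[OF k] k show ?case by blast
    next
      case (Basis s)
      show ?case
      proof (cases "s = carr")
        case True
        then show ?thesis by (auto intro: exI[of _ 1])
      next
        case False
        then obtain z e where s: "s = {y \<in> carr. p (y \<ominus> z) < e}" and z: "z \<in> carr"
          using Basis sn by auto
        show ?thesis
        proof (intro exI[of _ "e - p (x \<ominus> z)"] conjI subsetI)
          show "0 < e - p (x \<ominus> z)" using Basis s by simp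
          fix y assume y: "y \<in> {y \<in> carr. p (y \<ominus> x) < e - p (x \<ominus> z)}"
          then show "y \<in> s"
            using seminorm_diff_triangle[OF p, of y x z] Basis s z by auto
        qed
      qed
    qed
  qed
  have q0: "q (vzero E) = 0"
    using q scale_zero[of "vzero E"] unfolding is_seminorm_def by (metis abs_zero mult_zero_left zero_closed)
  have qs: "q (c \<odot> x) = \<bar>c\<bar> * q x" if "x \<in> carr" for c x
    using q that by (simp add: is_seminorm_def)
  have "openin (lc_topology E) {x \<in> carr. q x \<in> {..<1}}"
    using cont openin_continuous_map_preimage[OF cont, of "{..<1}"] by (simp add: topspace_lc_topology)
  then obtain e where e: "e > 0" "{y \<in> carr. p (y \<ominus> vzero E) < e} \<subseteq> {x \<in> carr. q x \<in> {..<1}}"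
    using nbhd[of "{x \<in> carr. q x \<in> {..<1}}" "vzero E"] q0 by auto
  have small: "q y < 1" if "y \<in> carr" "p y < e" for y
  proof -
    have "y \<ominus> vzero E = y"
      using that zero_add[of y] add_commute[of y "vzero E"] by (simp add: vdiff_def scale_vzero)
    then show ?thesis using e(2) that by auto
  qed
  show ?thesis
  \<comment> \<open>A multiple of x with p-value e / 2 lies strictly inside the ball, whence the
    factor 2.\<close>
  proof (rule that[of "2 / e"])
    fix x assume x: "x \<in> carr"
    have px: "0 \<le> p x" using seminorm_nonneg[OF p x] .
    have bound: "c * q x \<le> 1" if "0 < c" "c * p x < e" for c
      using small[of "c \<odot> x"] that x seminorm_scale[OF p x, of c] qs[OF x, of c] by simp
    show "q x \<le> 2 / e * p x"
    proof (cases "p x = 0")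
      case True
      have "q x \<le> 0"
      proof (rule ccontr)
        assume "\<not> q x \<le> 0"
        \<comment> \<open>Where p vanishes, every multiple of x lies in the ball, and the multiple
          by 2 / q x would have q-value 2.\<close>
        then show False using bound[of "2 / q x"] True e by simp
      qed
      then show ?thesis using True by simp
    next
      case False
      then have "0 < p x" using px by simp
      then show ?thesis using bound[of "e / (2 * p x)"] e by (simp add: field_simps)
    qed
  qed (use e in simp)
qed

end

section \<open>Cauchy filters and their minimal representatives\<close>

context lcs_on
begin

lemma lc_cauchyI:
  assumes "F \<noteq> bot" "\<forall>\<^sub>F x in F. x \<in> carr"
    and "\<And>q e. q \<in> seminorms E \<Longrightarrow> 0 < e \<Longrightarrow>
      \<exists>P. eventually P F \<and> (\<forall>x y. P x \<longrightarrow> P y \<longrightarrow> x \<in> carr \<longrightarrow> y \<in> carr \<longrightarrow> q (x \<ominus> y) < e)"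
  shows "lc_cauchy E F"
  unfolding lc_cauchy_def
proof (intro conjI ballI allI impI)
  show "F \<noteq> bot" "F \<le> principal carr" using assms by (auto simp: le_principal)
  fix q and e :: real assume "q \<in> seminorms E" "0 < e"
  then obtain P where P: "eventually P F"
    "\<And>x y. P x \<Longrightarrow> P y \<Longrightarrow> x \<in> carr \<Longrightarrow> y \<in> carr \<Longrightarrow> q (x \<ominus> y) < e"
    using assms(3)[of q e] by blast
  show "\<forall>\<^sub>F (x, y) in F \<times>\<^sub>F F. q (x \<ominus> y) < e"
    unfolding eventually_prod_filter
    using P assms(2)
    by (intro exI[of _ "\<lambda>x. P x \<and> x \<in> carr"]) (auto intro: eventually_conj)
qed

text \<open>A neighbourhood in the product filter consists of two sets, possibly different; their
  intersection is a single small set.\<close>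

lemma lc_cauchyD:
  assumes "lc_cauchy E F" "q \<in> seminorms E" "0 < e"
  obtains P where "eventually P F" "\<And>x. P x \<Longrightarrow> x \<in> carr"
    "\<And>x y. P x \<Longrightarrow> P y \<Longrightarrow> q (x \<ominus> y) < e"
proof -
  have "\<forall>\<^sub>F (x, y) in F \<times>\<^sub>F F. q (x \<ominus> y) < e" and car: "\<forall>\<^sub>F x in F. x \<in> carr"
    using assms by (auto simp: lc_cauchy_def le_principal)
  then obtain P Q where PQ: "eventually P F" "eventually Q F" "\<And>x y. P x \<Longrightarrow> Q y \<Longrightarrow> q (x \<ominus> y) < e"
    unfolding eventually_prod_filter by auto
  show ?thesis
    by (rule that[of "\<lambda>x. (P x \<and> Q x) \<and> x \<in> carr"])
      (use PQ car in \<open>auto intro!: eventually_conj\<close>)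
qed

lemma lc_cauchy_nonbot: "lc_cauchy E F \<Longrightarrow> F \<noteq> bot"
  by (simp add: lc_cauchy_def)

lemma lc_cauchy_carrier: "lc_cauchy E F \<Longrightarrow> \<forall>\<^sub>F x in F. x \<in> carr"
  by (simp add: lc_cauchy_def le_principal)

definition thick :: "'a filter \<Rightarrow> ('a \<Rightarrow> real) \<Rightarrow> real \<Rightarrow> 'a set" where
  "thick F q e = {y \<in> carr. \<forall>\<^sub>F x in F. q (x \<ominus> y) < e}"

text \<open>The coarsest Cauchy filter among those coarser than a given Cauchy filter is generated by its
  uniform thickenings.\<close>

definition thicken :: "'a filter \<Rightarrow> 'a filter" where
  "thicken F = inf (principal carr)
     (INF (q, e)\<in>seminorms E \<times> {0<..}. principal (thick F q e))"

lemma eventually_thicken: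
  assumes "q \<in> seminorms E" "0 < e"
  shows "\<forall>\<^sub>F y in thicken F. y \<in> thick F q e"
proof -
  have "thicken F \<le> principal (thick F q e)"
    unfolding thicken_def using assms by (intro le_infI2 INF_lower2[of "(q, e)"]) auto
  then show ?thesis by (simp add: le_principal)
qed

lemma le_thicken:
  assumes G: "\<forall>\<^sub>F x in G. x \<in> carr"
    and "\<And>q e. q \<in> seminorms E \<Longrightarrow> 0 < e \<Longrightarrow> \<forall>\<^sub>F y in G. y \<in> thick F q e"
  shows "G \<le> thicken F"
  using assms unfolding thicken_def by (auto intro!: INF_greatest simp: le_principal)

text \<open>The points of a small set of G are close to each other, and the set belongs to the finer
  filter F as well; so each of its points is eventually close to F. Thus \<open>thicken F\<close>
  lies above every Cauchy filter above F.\<close>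

lemma cauchy_le_thicken:
  assumes F: "lc_cauchy E F" and G: "lc_cauchy E G" and le: "F \<le> G"
  shows "G \<le> thicken F"
proof (rule le_thicken)
  show "\<forall>\<^sub>F x in G. x \<in> carr" using lc_cauchy_carrier[OF G] .
  fix q and e :: real assume q: "q \<in> seminorms E" and e: "0 < e"
  obtain P where P: "eventually P G" "\<And>x. P x \<Longrightarrow> x \<in> carr"
    "\<And>x y. P x \<Longrightarrow> P y \<Longrightarrow> q (x \<ominus> y) < e"
    using lc_cauchyD[OF G q e] by blast
  have PF: "eventually P F" using P(1) le by (simp add: le_filter_def)
  from P(1) show "\<forall>\<^sub>F y in G. y \<in> thick F q e"
  proof eventually_elim
    case (elim y)
    then show ?case
      unfolding thick_def using P eventually_mono[OF PF] by auto
  qed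
qed

lemma thicken_cauchy:
  assumes F: "lc_cauchy E F"
  shows "lc_cauchy E (thicken F)"
proof (rule lc_cauchyI)
  show "thicken F \<noteq> bot"
    using cauchy_le_thicken[OF F F order_refl] lc_cauchy_nonbot[OF F] by (auto simp: bot_unique)
  show "\<forall>\<^sub>F x in thicken F. x \<in> carr"
    by (simp add: thicken_def le_principal[symmetric])
  fix q and e :: real assume q: "q \<in> seminorms E" and e: "0 < e"
  show "\<exists>P. eventually P (thicken F) \<and>
      (\<forall>x y. P x \<longrightarrow> P y \<longrightarrow> x \<in> carr \<longrightarrow> y \<in> carr \<longrightarrow> q (x \<ominus> y) < e)"
  proof (intro exI conjI allI impI)
    show "\<forall>\<^sub>F y in thicken F. y \<in> thick F q (e / 2)" using eventually_thicken q e by simp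
    fix x y assume xy: "x \<in> thick F q (e / 2)" "y \<in> thick F q (e / 2)"
    then have "\<forall>\<^sub>F z in F. q (z \<ominus> x) < e / 2 \<and> q (z \<ominus> y) < e / 2 \<and> z \<in> carr"
      using lc_cauchy_carrier[OF F] by (auto simp: thick_def intro: eventually_conj)
    then obtain z where "q (z \<ominus> x) < e / 2" "q (z \<ominus> y) < e / 2" "z \<in> carr"
      using lc_cauchy_nonbot[OF F] eventually_happens' by blast
    then show "q (x \<ominus> y) < e"
      using seminorm_diff_triangle[OF q, of x z y] seminorm_diff_commute[OF q, of x z] xy
      by (auto simp: thick_def)
  qed
qed

lemma thicken_min_cauchy:
  assumes F: "lc_cauchy E F"
  shows "min_cauchy E (thicken F)"
  unfolding min_cauchy_def
proof (intro conjI allI impI)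
  show "lc_cauchy E (thicken F)" using thicken_cauchy[OF F] .
  fix G assume G: "lc_cauchy E G \<and> thicken F \<le> G"
  then have "F \<le> G" using cauchy_le_thicken[OF F F order_refl] by auto
  then show "G = thicken F" using cauchy_le_thicken[OF F] G by (simp add: antisym)
qed

text \<open>Replaces the definite description by an explicit filter: a minimal Cauchy filter above F
  lies below \<open>thicken F\<close>, which is itself Cauchy, and minimality makes them
  equal.\<close>

lemma compl_point_eq: "lc_cauchy E F \<Longrightarrow> compl_point E F = thicken F"
  unfolding compl_point_def
proof (rule the_equality)
  assume F: "lc_cauchy E F"
  show "min_cauchy E (thicken F) \<and> F \<le> thicken F"
    using thicken_min_cauchy[OF F] cauchy_le_thicken[OF F F order_refl] by simp
  fix G assume G: "min_cauchy E G \<and> F \<le> G"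
  then have "G \<le> thicken F" using cauchy_le_thicken[OF F] by (simp add: min_cauchy_def)
  then show "G = thicken F" using G thicken_cauchy[OF F] unfolding min_cauchy_def by metis
qed

lemma compl_point_min_cauchy: "lc_cauchy E F \<Longrightarrow> min_cauchy E (compl_point E F)"
  by (simp add: compl_point_eq thicken_min_cauchy)

lemma min_cauchy_cauchy: "min_cauchy E F \<Longrightarrow> lc_cauchy E F"
  by (simp add: min_cauchy_def)

lemma compl_point_id: "min_cauchy E F \<Longrightarrow> compl_point E F = F"
  using cauchy_le_thicken[of F F] thicken_cauchy[of F] by (simp add: min_cauchy_def compl_point_eq)

lemma thicken_mono:
  assumes F: "lc_cauchy E F" and G: "lc_cauchy E G"
    and close: "\<And>q e. q \<in> seminorms E \<Longrightarrow> 0 < e \<Longrightarrow>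
      \<exists>P Q. eventually P F \<and> eventually Q G \<and>
        (\<forall>x\<in>carr. \<forall>y\<in>carr. P x \<longrightarrow> Q y \<longrightarrow> q (x \<ominus> y) < e)"
  shows "thicken G \<le> thicken F"
proof (rule le_thicken)
  show "\<forall>\<^sub>F x in thicken G. x \<in> carr" using lc_cauchy_carrier[OF thicken_cauchy[OF G]] .
  fix q and e :: real assume q: "q \<in> seminorms E" and e: "0 < e"
  obtain P Q where P: "eventually P F" and Q: "eventually Q G"
    and PQ: "\<And>x y. x \<in> carr \<Longrightarrow> y \<in> carr \<Longrightarrow> P x \<Longrightarrow> Q y \<Longrightarrow> q (x \<ominus> y) < e / 2"
    using close[OF q, of "e / 2"] e by auto
  have "\<forall>\<^sub>F y in thicken G. y \<in> thick G q (e / 2)" using eventually_thicken q e by simp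
  then show "\<forall>\<^sub>F y in thicken G. y \<in> thick F q e"
  proof eventually_elim
    case (elim y)
    then have y: "y \<in> carr" and "\<forall>\<^sub>F z in G. q (z \<ominus> y) < e / 2 \<and> Q z \<and> z \<in> carr"
      using Q lc_cauchy_carrier[OF G] by (auto simp: thick_def intro: eventually_conj)
    then obtain z where z: "q (z \<ominus> y) < e / 2" "Q z" "z \<in> carr"
      using lc_cauchy_nonbot[OF G] eventually_happens' by blast
    have "\<forall>\<^sub>F x in F. q (x \<ominus> y) < e"
      using P lc_cauchy_carrier[OF F]
    proof eventually_elim
      case (elim x)
      then show ?case using seminorm_diff_triangle[OF q, of x z y] PQ[of x z] z y by simp
    qed
    then show ?case using y by (simp add: thick_def)
  qed
qed

text \<open>Filters that are uniformly close have the same thickening, and a minimal Cauchy filter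
  is its own thickening.\<close>

lemma min_cauchy_eqI:
  assumes F: "min_cauchy E F" and G: "min_cauchy E G"
    and close: "\<And>q e. q \<in> seminorms E \<Longrightarrow> 0 < e \<Longrightarrow>
      \<exists>P Q. eventually P F \<and> eventually Q G \<and>
        (\<forall>x\<in>carr. \<forall>y\<in>carr. P x \<longrightarrow> Q y \<longrightarrow> q (x \<ominus> y) < e)"
  shows "F = G"
proof -
  have "thicken G \<le> thicken F"
    by (rule thicken_mono) (use F G close in \<open>auto simp: min_cauchy_cauchy\<close>)
  moreover have "thicken F \<le> thicken G"
  proof (rule thicken_mono)
    fix q and e :: real assume q: "q \<in> seminorms E" and e: "0 < e"
    show "\<exists>P Q. eventually P G \<and> eventually Q F \<and>
        (\<forall>x\<in>carr. \<forall>y\<in>carr. P x \<longrightarrow> Q y \<longrightarrow> q (x \<ominus> y) < e)"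
    proof -
      obtain P Q where PQ: "eventually P F" "eventually Q G"
        "\<And>x y. x \<in> carr \<Longrightarrow> y \<in> carr \<Longrightarrow> P x \<Longrightarrow> Q y \<Longrightarrow> q (x \<ominus> y) < e"
        using close[OF q e] by blast
      have "q (y \<ominus> x) < e" if "x \<in> carr" "y \<in> carr" "P x" "Q y" for x y
        using PQ(3)[OF that] seminorm_diff_commute[OF q that(1,2)] by simp
      with PQ(1,2) show ?thesis by blast
    qed
  qed (use F G in \<open>auto simp: min_cauchy_cauchy\<close>)
  ultimately have "thicken F = thicken G" by (rule antisym[rotated])
  then show ?thesis
    using compl_point_id[OF F] compl_point_id[OF G] F G by (simp add: compl_point_eq min_cauchy_cauchy)
qed

text \<open>\<open>Lim\<close> is a definite description and carries information only once a limit
  exists. Lipschitz functions map Cauchy filters to Cauchy filters of reals, which converge.\<close>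

lemma lipschitz_tendsto:
  assumes f: "lipschitz f" and F: "lc_cauchy E F"
  shows "(f \<longlongrightarrow> Lim F f) F"
proof -
  obtain q M where q: "q \<in> seminorms E" and M: "0 < M"
    and lip: "\<And>x y. x \<in> carr \<Longrightarrow> y \<in> carr \<Longrightarrow> \<bar>f x - f y\<bar> \<le> M * q (x \<ominus> y)"
    using f unfolding lipschitz_def by blast
  have "\<exists>l. (f \<longlongrightarrow> l) F"
  proof (rule tendsto_cauchyI[OF lc_cauchy_nonbot[OF F]])
    fix e :: real assume e: "0 < e"
    obtain P where P: "eventually P F" "\<And>x. P x \<Longrightarrow> x \<in> carr"
      "\<And>x y. P x \<Longrightarrow> P y \<Longrightarrow> q (x \<ominus> y) < e / M"
      by (rule lc_cauchyD[OF F q, of "e / M"]) (use e M in auto)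
    have "\<bar>f x - f y\<bar> < e" if "P x" "P y" for x y
    proof -
      have "M * q (x \<ominus> y) < e" using P(3)[OF that] M by (simp add: field_simps)
      then show ?thesis using lip[OF P(2)[OF that(1)] P(2)[OF that(2)]] by simp
    qed
    with P(1) show "\<exists>P. eventually P F \<and> (\<forall>x y. P x \<and> P y \<longrightarrow> norm (f x - f y) < e)" by auto
  qed
  then show ?thesis using tendsto_Lim[OF lc_cauchy_nonbot[OF F]] by blast
qed

text \<open>F is finer than its completion point, so a limit along the latter is a limit along
  F.\<close>

lemma Lim_compl_point:
  assumes f: "lipschitz f" and F: "lc_cauchy E F"
  shows "Lim (compl_point E F) f = Lim F f"
proof -
  have C: "lc_cauchy E (thicken F)" using thicken_cauchy[OF F] .
  have "(f \<longlongrightarrow> Lim (thicken F) f) F"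
    using tendsto_mono[OF cauchy_le_thicken[OF F F order_refl] lipschitz_tendsto[OF f C]] .
  then show ?thesis
    using lipschitz_tendsto[OF f F] tendsto_unique[OF lc_cauchy_nonbot[OF F]]
    by (auto simp: compl_point_eq[OF F])
qed

section \<open>Operations and seminorms of the completion\<close>

lemma cauchy_add:
  assumes F: "lc_cauchy E F" and G: "lc_cauchy E G"
  shows "lc_cauchy E (filtermap (\<lambda>(x, y). x \<oplus> y) (F \<times>\<^sub>F G))"
proof (rule lc_cauchyI)
  show "filtermap (\<lambda>(x, y). x \<oplus> y) (F \<times>\<^sub>F G) \<noteq> bot"
    using lc_cauchy_nonbot[OF F] lc_cauchy_nonbot[OF G] by (simp add: filtermap_bot_iff prod_filter_eq_bot)
  show "\<forall>\<^sub>F x in filtermap (\<lambda>(x, y). x \<oplus> y) (F \<times>\<^sub>F G). x \<in> carr"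
    using lc_cauchy_carrier[OF F] lc_cauchy_carrier[OF G]
    unfolding eventually_filtermap eventually_prod_filter by force
  fix q and e :: real assume q: "q \<in> seminorms E" and e: "0 < e"
  obtain P where P: "eventually P F" "\<And>x. P x \<Longrightarrow> x \<in> carr"
    "\<And>x y. P x \<Longrightarrow> P y \<Longrightarrow> q (x \<ominus> y) < e / 2"
    by (rule lc_cauchyD[OF F q, of "e / 2"]) (use e in auto)
  obtain Q where Q: "eventually Q G" "\<And>x. Q x \<Longrightarrow> x \<in> carr"
    "\<And>x y. Q x \<Longrightarrow> Q y \<Longrightarrow> q (x \<ominus> y) < e / 2"
    by (rule lc_cauchyD[OF G q, of "e / 2"]) (use e in auto)
  show "\<exists>R. eventually R (filtermap (\<lambda>(x, y). x \<oplus> y) (F \<times>\<^sub>F G)) \<and>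
      (\<forall>x y. R x \<longrightarrow> R y \<longrightarrow> x \<in> carr \<longrightarrow> y \<in> carr \<longrightarrow> q (x \<ominus> y) < e)"
  proof (intro exI[of _ "\<lambda>z. \<exists>x y. P x \<and> Q y \<and> z = x \<oplus> y"] conjI allI impI)
    show "\<forall>\<^sub>F z in filtermap (\<lambda>(x, y). x \<oplus> y) (F \<times>\<^sub>F G). \<exists>x y. P x \<and> Q y \<and> z = x \<oplus> y"
      unfolding eventually_filtermap eventually_prod_filter using P(1) Q(1) by force
    fix z z' assume "\<exists>x y. P x \<and> Q y \<and> z = x \<oplus> y" "\<exists>x y. P x \<and> Q y \<and> z' = x \<oplus> y"
    then obtain x y x' y' where *: "P x" "Q y" "z = x \<oplus> y" "P x'" "Q y'" "z' = x' \<oplus> y'" by blast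
    then have "q (z \<ominus> z') \<le> q (x \<ominus> x') + q (y \<ominus> y')"
      using P(2) Q(2) seminorm_add[OF q, of "x \<ominus> x'" "y \<ominus> y'"] by (simp add: add_diff_add)
    also have "\<dots> < e" using P(3)[of x x'] Q(3)[of y y'] * by simp
    finally show "q (z \<ominus> z') < e" .
  qed
qed

lemma cauchy_scale:
  assumes F: "lc_cauchy E F"
  shows "lc_cauchy E (filtermap (vscale E c) F)"
proof (rule lc_cauchyI)
  show "filtermap (vscale E c) F \<noteq> bot"
    using lc_cauchy_nonbot[OF F] by (simp add: filtermap_bot_iff)
  show "\<forall>\<^sub>F x in filtermap (vscale E c) F. x \<in> carr"
    using lc_cauchy_carrier[OF F] unfolding eventually_filtermap by eventually_elim simp
  fix q and e :: real assume q: "q \<in> seminorms E" and e: "0 < e"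
  obtain P where P: "eventually P F" "\<And>x. P x \<Longrightarrow> x \<in> carr"
    "\<And>x y. P x \<Longrightarrow> P y \<Longrightarrow> q (x \<ominus> y) < e / (\<bar>c\<bar> + 1)"
    by (rule lc_cauchyD[OF F q, of "e / (\<bar>c\<bar> + 1)"]) (use e in auto)
  show "\<exists>R. eventually R (filtermap (vscale E c) F) \<and>
      (\<forall>x y. R x \<longrightarrow> R y \<longrightarrow> x \<in> carr \<longrightarrow> y \<in> carr \<longrightarrow> q (x \<ominus> y) < e)"
  proof (intro exI[of _ "\<lambda>z. \<exists>x. P x \<and> z = c \<odot> x"] conjI allI impI)
    show "\<forall>\<^sub>F z in filtermap (vscale E c) F. \<exists>x. P x \<and> z = c \<odot> x"
      unfolding eventually_filtermap using P(1) by eventually_elim auto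
    fix z z' assume "\<exists>x. P x \<and> z = c \<odot> x" "\<exists>x. P x \<and> z' = c \<odot> x"
    then obtain x x' where *: "P x" "z = c \<odot> x" "P x'" "z' = c \<odot> x'" by blast
    have "q (z \<ominus> z') = \<bar>c\<bar> * q (x \<ominus> x')"
      using * P(2) seminorm_scale[OF q] by (simp add: scale_diff)
    also have "\<dots> \<le> (\<bar>c\<bar> + 1) * q (x \<ominus> x')"
      using seminorm_nonneg[OF q] P(2) * by (intro mult_right_mono) auto
    also have "\<dots> < e" using P(3)[of x x'] * by (simp add: field_simps)
    finally show "q (z \<ominus> z') < e" .
  qed
qed

lemma tendsto_add_filter:
  assumes f: "lipschitz f" and F: "lc_cauchy E F" and G: "lc_cauchy E G"
  shows "((\<lambda>(x, y). f (x \<oplus> y)) \<longlongrightarrow> Lim (compl_point E (filtermap (\<lambda>(x, y). x \<oplus> y) (F \<times>\<^sub>F G))) f) (F \<times>\<^sub>F G)"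
proof -
  let ?H = "filtermap (\<lambda>(x, y). x \<oplus> y) (F \<times>\<^sub>F G)"
  have "(f \<longlongrightarrow> Lim (compl_point E ?H) f) ?H"
    unfolding Lim_compl_point[OF f cauchy_add[OF F G]] by (rule lipschitz_tendsto[OF f cauchy_add[OF F G]])
  then show ?thesis unfolding filterlim_filtermap by (simp add: case_prod_beta')
qed

lemma tendsto_scale_filter:
  assumes f: "lipschitz f" and F: "lc_cauchy E F"
  shows "((\<lambda>x. f (c \<odot> x)) \<longlongrightarrow> Lim (compl_point E (filtermap (vscale E c) F)) f) F"
proof -
  let ?H = "filtermap (vscale E c) F"
  have "(f \<longlongrightarrow> Lim (compl_point E ?H) f) ?H"
    unfolding Lim_compl_point[OF f cauchy_scale[OF F]] by (rule lipschitz_tendsto[OF f cauchy_scale[OF F]])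
  then show ?thesis unfolding filterlim_filtermap by simp
qed

lemma tendsto_prod_fst: "(f \<longlongrightarrow> l) F \<Longrightarrow> ((\<lambda>z. f (fst z)) \<longlongrightarrow> l) (F \<times>\<^sub>F G)"
  by (rule filterlim_compose[OF _ filterlim_fst])

lemma tendsto_prod_snd: "(f \<longlongrightarrow> l) G \<Longrightarrow> ((\<lambda>z. f (snd z)) \<longlongrightarrow> l) (F \<times>\<^sub>F G)"
  by (rule filterlim_compose[OF _ filterlim_snd])

lemma eventually_prod_carrier:
  "lc_cauchy E F \<Longrightarrow> lc_cauchy E G \<Longrightarrow> \<forall>\<^sub>F z in F \<times>\<^sub>F G. fst z \<in> carr \<and> snd z \<in> carr"
  using lc_cauchy_carrier[of F] lc_cauchy_carrier[of G] unfolding eventually_prod_filter by force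

text \<open>Both sides are limits of one function along the product filter, which avoids computing
  with the filter that represents the sum.\<close>

lemma Lim_completion_add:
  assumes lin: "vlinear E real_vspace f" and f: "lipschitz f"
    and F: "lc_cauchy E F" and G: "lc_cauchy E G"
  shows "Lim (vadd (completion E) F G) f = Lim F f + Lim G f"
proof (rule tendsto_unique[of "F \<times>\<^sub>F G"])
  show "F \<times>\<^sub>F G \<noteq> bot"
    using lc_cauchy_nonbot F G by (simp add: prod_filter_eq_bot)
  show "((\<lambda>(x, y). f (x \<oplus> y)) \<longlongrightarrow> Lim (vadd (completion E) F G) f) (F \<times>\<^sub>F G)"
    using tendsto_add_filter[OF f F G] by (simp add: completion_def)
  have "((\<lambda>z. f (fst z) + f (snd z)) \<longlongrightarrow> Lim F f + Lim G f) (F \<times>\<^sub>F G)"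
    by (intro tendsto_add tendsto_prod_fst tendsto_prod_snd lipschitz_tendsto f F G)
  moreover have "\<forall>\<^sub>F z in F \<times>\<^sub>F G. f (fst z) + f (snd z) = (case z of (x, y) \<Rightarrow> f (x \<oplus> y))"
    using eventually_prod_carrier[OF F G]
    by eventually_elim (use lin in \<open>auto simp: vlinear_def real_vspace_def\<close>)
  ultimately show "((\<lambda>(x, y). f (x \<oplus> y)) \<longlongrightarrow> Lim F f + Lim G f) (F \<times>\<^sub>F G)"
    by (rule Lim_transform_eventually)
qed

lemma Lim_completion_scale:
  assumes lin: "vlinear E real_vspace f" and f: "lipschitz f" and F: "lc_cauchy E F"
  shows "Lim (vscale (completion E) c F) f = c * Lim F f"
proof (rule tendsto_unique[OF lc_cauchy_nonbot[OF F]])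
  show "((\<lambda>x. f (c \<odot> x)) \<longlongrightarrow> Lim (vscale (completion E) c F) f) F"
    using tendsto_scale_filter[OF f F] by (simp add: completion_def)
  have "((\<lambda>x. c * f x) \<longlongrightarrow> c * Lim F f) F"
    by (intro tendsto_intros lipschitz_tendsto f F)
  moreover have "\<forall>\<^sub>F x in F. c * f x = f (c \<odot> x)"
    using lc_cauchy_carrier[OF F]
    by eventually_elim (use lin in \<open>auto simp: vlinear_def real_vspace_def\<close>)
  ultimately show "((\<lambda>x. f (c \<odot> x)) \<longlongrightarrow> c * Lim F f) F"
    by (rule Lim_transform_eventually)
qed

lemma completion_simps:
  "vcarrier (completion E) = {F. min_cauchy E F}"
  "seminorms (completion E) = (\<lambda>q F. Lim F q) ` seminorms E"
  by (auto simp: completion_def)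

lemma completion_add_closed:
  "lc_cauchy E F \<Longrightarrow> lc_cauchy E G \<Longrightarrow> min_cauchy E (vadd (completion E) F G)"
  by (simp add: completion_def compl_point_min_cauchy cauchy_add)

lemma completion_scale_closed: "lc_cauchy E F \<Longrightarrow> min_cauchy E (vscale (completion E) c F)"
  by (simp add: completion_def compl_point_min_cauchy cauchy_scale)

lemma principal_cauchy:
  assumes "x \<in> carr"
  shows "lc_cauchy E (principal {x})"
proof (rule lc_cauchyI)
  fix q and e :: real assume "q \<in> seminorms E" "0 < e"
  then show "\<exists>P. eventually P (principal {x}) \<and>
      (\<forall>x y. P x \<longrightarrow> P y \<longrightarrow> x \<in> carr \<longrightarrow> y \<in> carr \<longrightarrow> q (x \<ominus> y) < e)"
    using assms by (intro exI[of _ "\<lambda>y. y = x"]) (simp add: eventually_principal seminorm_diff_self)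
qed (use assms in \<open>auto simp: eventually_principal principal_eq_bot_iff\<close>)

lemma Lim_principal:
  assumes "x \<in> carr" "lipschitz f"
  shows "Lim (compl_point E (principal {x})) f = f x"
proof -
  have "(f \<longlongrightarrow> f x) (principal {x})"
    by (rule tendsto_eventually) (simp add: eventually_principal)
  then have "Lim (principal {x}) f = f x"
    by (intro tendsto_Lim) (simp_all add: principal_eq_bot_iff)
  then show ?thesis
    using Lim_compl_point[OF assms(2) principal_cauchy[OF assms(1)]] by simp
qed

lemma completion_seminorm:
  assumes "p \<in> seminorms (completion E)"
  shows "is_seminorm (completion E) p"
proof -
  obtain q where q: "q \<in> seminorms E" and p: "p = (\<lambda>F. Lim F q)"
    using assms by (auto simp: completion_simps)
  have f: "lipschitz q" using lipschitz_seminorm[OF q] .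
  show ?thesis
    unfolding is_seminorm_def completion_simps p mem_Collect_eq
  proof (intro conjI ballI allI)
    fix F assume "F \<in> {F. min_cauchy E F}"
    then have F: "lc_cauchy E F" by (simp add: min_cauchy_cauchy)
    show "0 \<le> Lim F q"
      using tendsto_lowerbound[OF lipschitz_tendsto[OF f F], of 0] lc_cauchy_nonbot[OF F]
        lc_cauchy_carrier[OF F] seminorm_nonneg[OF q] by (simp add: eventually_mono)
    show "Lim (vscale (completion E) c F) q = \<bar>c\<bar> * Lim F q" for c
    proof (rule tendsto_unique[OF lc_cauchy_nonbot[OF F]])
      show "((\<lambda>x. q (c \<odot> x)) \<longlongrightarrow> Lim (vscale (completion E) c F) q) F"
        using tendsto_scale_filter[OF f F] by (simp add: completion_def)
      have "((\<lambda>x. \<bar>c\<bar> * q x) \<longlongrightarrow> \<bar>c\<bar> * Lim F q) F"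
        by (intro tendsto_intros lipschitz_tendsto f F)
      moreover have "\<forall>\<^sub>F x in F. \<bar>c\<bar> * q x = q (c \<odot> x)"
        using lc_cauchy_carrier[OF F] by eventually_elim (simp add: seminorm_scale[OF q])
      ultimately show "((\<lambda>x. q (c \<odot> x)) \<longlongrightarrow> \<bar>c\<bar> * Lim F q) F"
        by (rule Lim_transform_eventually)
    qed
    fix G assume "G \<in> {F. min_cauchy E F}"
    then have G: "lc_cauchy E G" by (simp add: min_cauchy_cauchy)
    show "Lim (vadd (completion E) F G) q \<le> Lim F q + Lim G q"
    proof (rule tendsto_le)
      show "F \<times>\<^sub>F G \<noteq> bot" using lc_cauchy_nonbot F G by (simp add: prod_filter_eq_bot)
      show "((\<lambda>(x, y). q (x \<oplus> y)) \<longlongrightarrow> Lim (vadd (completion E) F G) q) (F \<times>\<^sub>F G)"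
        using tendsto_add_filter[OF f F G] by (simp add: completion_def)
      show "((\<lambda>z. q (fst z) + q (snd z)) \<longlongrightarrow> Lim F q + Lim G q) (F \<times>\<^sub>F G)"
        by (intro tendsto_add tendsto_prod_fst tendsto_prod_snd lipschitz_tendsto f F G)
      show "\<forall>\<^sub>F z in F \<times>\<^sub>F G. (case z of (x, y) \<Rightarrow> q (x \<oplus> y)) \<le> q (fst z) + q (snd z)"
        using eventually_prod_carrier[OF F G]
        by eventually_elim (auto simp: seminorm_add[OF q])
    qed
  qed
qed

end

section \<open>Inductive limits of vector spaces\<close>

locale ind_system =
  fixes E :: "nat \<Rightarrow> 'a lcs" and c :: "nat \<Rightarrow> nat \<Rightarrow> 'a \<Rightarrow> 'a"
  assumes vspace_E: "\<And>r. vspace_on (E r)"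
    and linear_c: "\<And>r s. r \<le> s \<Longrightarrow> vlinear (E r) (E s) (c r s)"
    and c_comp: "\<And>r s t x. r \<le> s \<Longrightarrow> s \<le> t \<Longrightarrow> x \<in> vcarrier (E r) \<Longrightarrow> c s t (c r s x) = c r t x"
begin

abbreviation inj where "inj \<equiv> ind_inj E c"

lemma c_closed: "r \<le> s \<Longrightarrow> x \<in> vcarrier (E r) \<Longrightarrow> c r s x \<in> vcarrier (E s)"
  using linear_c unfolding vlinear_def by blast

lemma c_add: "r \<le> s \<Longrightarrow> x \<in> vcarrier (E r) \<Longrightarrow> y \<in> vcarrier (E r) \<Longrightarrow>
    c r s (vadd (E r) x y) = vadd (E s) (c r s x) (c r s y)"
  using linear_c unfolding vlinear_def by blast

lemma c_scale: "r \<le> s \<Longrightarrow> x \<in> vcarrier (E r) \<Longrightarrow> c r s (vscale (E r) a x) = vscale (E s) a (c r s x)"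
  using linear_c unfolding vlinear_def by blast

lemma add_closed_E: "x \<in> vcarrier (E r) \<Longrightarrow> y \<in> vcarrier (E r) \<Longrightarrow> vadd (E r) x y \<in> vcarrier (E r)"
  using vspace_E by (rule vspace_on.add_closed)

lemma scale_closed_E: "x \<in> vcarrier (E r) \<Longrightarrow> vscale (E r) a x \<in> vcarrier (E r)"
  using vspace_E by (rule vspace_on.scale_closed)

lemma c_eq_later:
  assumes "c r t x = c s t y" "r \<le> t" "s \<le> t" "t \<le> t'" "x \<in> vcarrier (E r)" "y \<in> vcarrier (E s)"
  shows "c r t' x = c s t' y"
  using c_comp[of r t t' x] c_comp[of s t t' y] assms by simp

lemma equiv_ind_rel: "equiv (SIGMA r:UNIV. vcarrier (E r)) (ind_rel E c)"
proof (rule equivI)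
  show "ind_rel E c \<subseteq> (SIGMA r:UNIV. vcarrier (E r)) \<times> (SIGMA r:UNIV. vcarrier (E r))"
    by (auto simp: ind_rel_def)
  show "refl_on (SIGMA r:UNIV. vcarrier (E r)) (ind_rel E c)"
    by (auto simp: refl_on_def ind_rel_def)
  show "sym (ind_rel E c)"
    by (auto simp: sym_def ind_rel_def)
  show "trans (ind_rel E c)"
  proof (rule transI)
    fix a b d assume "(a, b) \<in> ind_rel E c" "(b, d) \<in> ind_rel E c"
    then obtain r x s y u z t t' where *: "a = (r, x)" "b = (s, y)" "d = (u, z)"
      "x \<in> vcarrier (E r)" "y \<in> vcarrier (E s)" "z \<in> vcarrier (E u)"
      "r \<le> t" "s \<le> t" "c r t x = c s t y" "s \<le> t'" "u \<le> t'" "c s t' y = c u t' z"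
      by (auto simp: ind_rel_def)
    have "c r (max t t') x = c s (max t t') y" "c s (max t t') y = c u (max t t') z"
      by (rule c_eq_later[OF *(9) *(7,8) max.cobounded1 *(4,5)],
          rule c_eq_later[OF *(12) *(10,11) max.cobounded2 *(5,6)])
    with * show "(a, d) \<in> ind_rel E c"
      by (auto simp: ind_rel_def intro!: exI[of _ "max t t'"])
  qed
qed

lemma mem_inj: "(s, y) \<in> inj r x \<longleftrightarrow> ((r, x), (s, y)) \<in> ind_rel E c"
  by (simp add: ind_inj_def)

lemma inj_eq_iff:
  assumes "x \<in> vcarrier (E r)" "y \<in> vcarrier (E s)"
  shows "inj r x = inj s y \<longleftrightarrow> (\<exists>t. r \<le> t \<and> s \<le> t \<and> c r t x = c s t y)"
  unfolding ind_inj_def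
  using eq_equiv_class_iff[OF equiv_ind_rel, of "(r, x)" "(s, y)"] assms
  by (auto simp: ind_rel_def)

lemma inj_c: "r \<le> s \<Longrightarrow> x \<in> vcarrier (E r) \<Longrightarrow> inj s (c r s x) = inj r x"
  by (subst inj_eq_iff) (auto simp: c_closed c_comp)

lemma inj_self: "x \<in> vcarrier (E r) \<Longrightarrow> (r, x) \<in> inj r x"
  by (auto simp: mem_inj ind_rel_def)

lemma ind_carrier: "vcarrier (ind_vspace E c) = {inj r x | r x. x \<in> vcarrier (E r)}"
  by (auto simp: ind_vspace_def quotient_def ind_inj_def)

lemma inj_closed: "x \<in> vcarrier (E r) \<Longrightarrow> inj r x \<in> vcarrier (ind_vspace E c)"
  by (auto simp: ind_carrier)

lemma ind_carrierE:
  assumes "X \<in> vcarrier (ind_vspace E c)"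
  obtains r x where "x \<in> vcarrier (E r)" "X = inj r x"
  using assms by (auto simp: ind_carrier)

lemma ind_carrierE2:
  assumes "X \<in> vcarrier (ind_vspace E c)" "Y \<in> vcarrier (ind_vspace E c)"
  obtains r x y where "x \<in> vcarrier (E r)" "X = inj r x" "y \<in> vcarrier (E r)" "Y = inj r y"
proof -
  obtain r x s y where *: "x \<in> vcarrier (E r)" "X = inj r x" "y \<in> vcarrier (E s)" "Y = inj s y"
    using assms by (meson ind_carrierE)
  then show ?thesis
    using inj_c[of r "max r s" x] inj_c[of s "max r s" y]
    by (intro that[of "c r (max r s) x" "max r s" "c s (max r s) y"]) (auto simp: c_closed)
qed

lemma ind_carrierE3:
  assumes "X \<in> vcarrier (ind_vspace E c)" "Y \<in> vcarrier (ind_vspace E c)" "Z \<in> vcarrier (ind_vspace E c)"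
  obtains r x y z where "x \<in> vcarrier (E r)" "X = inj r x" "y \<in> vcarrier (E r)" "Y = inj r y"
    "z \<in> vcarrier (E r)" "Z = inj r z"
proof -
  obtain r x y s z where *: "x \<in> vcarrier (E r)" "X = inj r x" "y \<in> vcarrier (E r)" "Y = inj r y"
      "z \<in> vcarrier (E s)" "Z = inj s z"
    using assms by (meson ind_carrierE ind_carrierE2)
  then show ?thesis
    using inj_c[of r "max r s" x] inj_c[of r "max r s" y] inj_c[of s "max r s" z]
    by (intro that[of "c r (max r s) x" "max r s" "c r (max r s) y" "c s (max r s) z"])
      (auto simp: c_closed)
qed

text \<open>The set under \<open>the_elem\<close> is a singleton: other representatives agree with x
  and y from some step on, and the connecting maps are additive, so the classes of the sums
  coincide.\<close>

lemma inj_add: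
  assumes x: "x \<in> vcarrier (E r)" and y: "y \<in> vcarrier (E r)"
  shows "vadd (ind_vspace E c) (inj r x) (inj r y) = inj r (vadd (E r) x y)"
proof -
  have "inj s (vadd (E s) x' y') = inj r (vadd (E r) x y)"
    if x': "(s, x') \<in> inj r x" and y': "(s, y') \<in> inj r y" for s x' y'
  proof -
    obtain t where t: "r \<le> t" "s \<le> t" "c r t x = c s t x'" "x' \<in> vcarrier (E s)"
      using x' by (auto simp: mem_inj ind_rel_def)
    obtain t' where t': "r \<le> t'" "s \<le> t'" "c r t' y = c s t' y'" "y' \<in> vcarrier (E s)"
      using y' by (auto simp: mem_inj ind_rel_def)
    have "c r (max t t') x = c s (max t t') x'" "c r (max t t') y = c s (max t t') y'"
      by (rule c_eq_later[OF t(3) t(1,2) max.cobounded1 x t(4)],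
          rule c_eq_later[OF t'(3) t'(1,2) max.cobounded2 y t'(4)])
    then show ?thesis
      using t t' x y
      by (subst inj_eq_iff) (auto simp: c_add add_closed_E le_max_iff_disj intro!: exI[of _ "max t t'"])
  qed
  then have "{inj s (vadd (E s) x' y') | s x' y'. (s, x') \<in> inj r x \<and> (s, y') \<in> inj r y}
      = {inj r (vadd (E r) x y)}"
    using inj_self[OF x] inj_self[OF y] by blast
  then show ?thesis by (simp add: ind_vspace_def)
qed

lemma inj_scale:
  assumes x: "x \<in> vcarrier (E r)"
  shows "vscale (ind_vspace E c) a (inj r x) = inj r (vscale (E r) a x)"
proof -
  have "inj s (vscale (E s) a x') = inj r (vscale (E r) a x)" if x': "(s, x') \<in> inj r x" for s x'
  proof -
    obtain t where t: "r \<le> t" "s \<le> t" "c r t x = c s t x'" "x' \<in> vcarrier (E s)"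
      using x' by (auto simp: mem_inj ind_rel_def)
    then show ?thesis
      using x by (subst inj_eq_iff) (auto simp: c_scale scale_closed_E intro!: exI[of _ t])
  qed
  then have "{inj s (vscale (E s) a x') | s x'. (s, x') \<in> inj r x} = {inj r (vscale (E r) a x)}"
    using inj_self[OF x] by blast
  then show ?thesis by (simp add: ind_vspace_def)
qed

text \<open>The zero of the limit is defined through step 0; linear maps preserve the product of 0
  with a vector, so every step gives the same zero.\<close>

lemma inj_zero: "inj r (vzero (E r)) = vzero (ind_vspace E c)"
proof -
  have z: "vzero (E s) \<in> vcarrier (E s)" for s using vspace_on.zero_closed[OF vspace_E] .
  have "c 0 r (vzero (E 0)) = vscale (E r) 0 (c 0 r (vzero (E 0)))"
    using c_scale[of 0 r "vzero (E 0)" 0] vspace_on.scale_zero[OF vspace_E z, of 0] z by simp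
  then have "c 0 r (vzero (E 0)) = vzero (E r)"
    using vspace_on.scale_zero[OF vspace_E c_closed[OF _ z]] by simp
  then show ?thesis using inj_c[of 0 r "vzero (E 0)"] z by (simp add: ind_vspace_def)
qed

text \<open>Each axiom is pulled back to one step that contains representatives of all elements
  involved.\<close>

lemma vspace_ind: "vspace_on (ind_vspace E c)"
proof
  show "vzero (ind_vspace E c) \<in> vcarrier (ind_vspace E c)"
    using inj_closed[OF vspace_on.zero_closed[OF vspace_E]] by (simp add: inj_zero)
  fix X assume X: "X \<in> vcarrier (ind_vspace E c)"
  obtain r x where x: "x \<in> vcarrier (E r)" "X = inj r x" using ind_carrierE[OF X] .
  show "vscale (ind_vspace E c) a X \<in> vcarrier (ind_vspace E c)"
    and "vscale (ind_vspace E c) 0 X = vzero (ind_vspace E c)"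
    and "vscale (ind_vspace E c) 1 X = X"
    and "vscale (ind_vspace E c) a (vscale (ind_vspace E c) b X) = vscale (ind_vspace E c) (a * b) X"
    and "vscale (ind_vspace E c) (a + b) X =
      vadd (ind_vspace E c) (vscale (ind_vspace E c) a X) (vscale (ind_vspace E c) b X)" for a b
    using x vspace_on.scale_zero[OF vspace_E x(1)] vspace_on.scale_one[OF vspace_E x(1)]
      vspace_on.scale_scale[OF vspace_E x(1)] vspace_on.scale_left_distrib[OF vspace_E x(1)]
    by (simp_all add: inj_scale inj_add inj_zero scale_closed_E inj_closed)
  fix Y assume Y: "Y \<in> vcarrier (ind_vspace E c)"
  obtain r x y where xy: "x \<in> vcarrier (E r)" "X = inj r x" "y \<in> vcarrier (E r)" "Y = inj r y"
    using ind_carrierE2[OF X Y] .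
  show "vadd (ind_vspace E c) X Y \<in> vcarrier (ind_vspace E c)"
    and "vadd (ind_vspace E c) X Y = vadd (ind_vspace E c) Y X"
    and "vscale (ind_vspace E c) a (vadd (ind_vspace E c) X Y) =
      vadd (ind_vspace E c) (vscale (ind_vspace E c) a X) (vscale (ind_vspace E c) a Y)" for a
    using xy vspace_on.add_commute[OF vspace_E xy(1,3)] vspace_on.scale_right_distrib[OF vspace_E xy(1,3)]
    by (simp_all add: inj_scale inj_add scale_closed_E add_closed_E inj_closed)
  fix Z assume Z: "Z \<in> vcarrier (ind_vspace E c)"
  obtain r x y z where xyz: "x \<in> vcarrier (E r)" "X = inj r x" "y \<in> vcarrier (E r)" "Y = inj r y"
    "z \<in> vcarrier (E r)" "Z = inj r z"
    using ind_carrierE3[OF X Y Z] .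
  show "vadd (ind_vspace E c) (vadd (ind_vspace E c) X Y) Z =
      vadd (ind_vspace E c) X (vadd (ind_vspace E c) Y Z)"
    using xyz vspace_on.add_assoc[OF vspace_E xyz(1,3,5)] by (simp add: inj_add add_closed_E)
qed

lemma ind_limit_simps:
  "vcarrier (ind_limit E c) = vcarrier (ind_vspace E c)"
  "vzero (ind_limit E c) = vzero (ind_vspace E c)"
  "vadd (ind_limit E c) = vadd (ind_vspace E c)"
  "vscale (ind_limit E c) = vscale (ind_vspace E c)"
  "seminorms (ind_limit E c) = {q. is_seminorm (ind_vspace E c) q \<and>
     (\<forall>r. continuous_map (lc_topology (E r)) euclideanreal (q \<circ> inj r))}"
  by (simp_all add: ind_limit_def vspace.defs lcs.defs)

lemma lcs_ind_limit: "lcs_on (ind_limit E c)"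
proof -
  interpret vspace_on "ind_vspace E c" by (rule vspace_ind)
  show ?thesis
    by unfold_locales
      (simp_all add: ind_limit_simps add_assoc scale_zero scale_one scale_scale scale_left_distrib
        scale_right_distrib is_seminorm_def add_commute add_left_commute)
qed

end

section \<open>Calculus of Lie derivatives\<close>

lemma lie_eq:
  assumes "(f has_derivative D) (at p)"
  shows "lie v f p = D v"
proof -
  have "((\<lambda>t. p + t *\<^sub>R v) has_derivative (\<lambda>t. t *\<^sub>R v)) (at 0)"
    by (auto intro!: derivative_eq_intros)
  then have "((\<lambda>t. f (p + t *\<^sub>R v)) has_derivative (\<lambda>t. D (t *\<^sub>R v))) (at 0)"
    using assms has_derivative_compose[of "\<lambda>t. p + t *\<^sub>R v" "\<lambda>t. t *\<^sub>R v" 0 UNIV f D] by simp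
  then have "((\<lambda>t. f (p + t *\<^sub>R v)) has_vector_derivative D v) (at 0)"
    using linear_scale[OF has_derivative_linear[OF assms]] by (simp add: has_vector_derivative_def)
  then show ?thesis by (simp add: lie_def vector_derivative_at)
qed

lemma has_derivative_lie: "f differentiable (at p) \<Longrightarrow> (f has_derivative (\<lambda>v. lie v f p)) (at p)"
  using lie_eq unfolding differentiable_def by (metis (full_types) ext)

lemma lie_translate: "lie v (\<lambda>p. f (p + w)) = (\<lambda>p. lie v f (p + w))"
  by (simp add: lie_def fun_eq_iff add_ac)

lemma has_vector_derivative_lie:
  assumes "\<And>p. f differentiable (at p)"
  shows "((\<lambda>t. f (p + t *\<^sub>R v)) has_vector_derivative lie v f (p + t *\<^sub>R v)) (at t)"
proof -
  have D: "(f has_derivative (\<lambda>h. lie h f (p + t *\<^sub>R v))) (at (p + t *\<^sub>R v))"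
    by (rule has_derivative_lie[OF assms])
  have "((\<lambda>t. p + t *\<^sub>R v) has_derivative (\<lambda>t. t *\<^sub>R v)) (at t)"
    by (auto intro!: derivative_eq_intros)
  from has_derivative_compose[OF this D] show ?thesis
    using linear_scale[OF has_derivative_linear[OF has_derivative_lie[OF assms]]]
    by (simp add: has_vector_derivative_def)
qed

lemma lie_scale_direction:
  assumes "f differentiable (at p)"
  shows "lie (c *\<^sub>R v) f p = c *\<^sub>R lie v f p"
  using linear_scale[OF has_derivative_linear[OF has_derivative_lie[OF assms]]] by simp

lemma lie_add:
  assumes "\<And>p. f differentiable (at p)" "\<And>p. g differentiable (at p)"
  shows "lie v (\<lambda>p. f p + g p) = (\<lambda>p. lie v f p + lie v g p)"
  by (intro ext lie_eq[OF has_derivative_add[OF has_derivative_lie has_derivative_lie]] assms)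

lemma lie_scaleR:
  assumes "\<And>p. f differentiable (at p)"
  shows "lie v (\<lambda>p. c *\<^sub>R f p) = (\<lambda>p. c *\<^sub>R lie v f p)"
  by (intro ext lie_eq[OF has_derivative_scaleR_right[OF has_derivative_lie]] assms)

lemma lie_const: "lie v (\<lambda>p. a) = (\<lambda>p. 0)"
  by (auto simp: lie_eq[OF has_derivative_const])

lemma differentiable_translate: "\<forall>p. f differentiable (at p) \<Longrightarrow> (\<lambda>p. f (p + w)) differentiable (at p)"
  using differentiable_chain_at[of "\<lambda>p. p + w" p f] by (simp add: comp_def)

lemma C_class_Suc_imp: "C_class (Suc r) f \<Longrightarrow> C_class r f"
  by (induction r arbitrary: f)
    (auto simp: continuous_on_eq_continuous_at differentiable_imp_continuous_within)

lemma C_class_mono: "r \<le> s \<Longrightarrow> C_class s f \<Longrightarrow> C_class r f"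
  by (induction s rule: dec_induct) (auto intro: C_class_Suc_imp simp del: C_class.simps)

lemma C_class_add: "C_class r f \<Longrightarrow> C_class r g \<Longrightarrow> C_class r (\<lambda>p. f p + g p)"
  by (induction r arbitrary: f g) (auto intro: continuous_on_add differentiable_add simp: lie_add)

lemma C_class_scaleR: "C_class r f \<Longrightarrow> C_class r (\<lambda>p. c *\<^sub>R f p)"
  by (induction r arbitrary: f) (auto intro: continuous_on_scaleR simp: lie_scaleR)

lemma C_class_translate: "C_class r f \<Longrightarrow> C_class r (\<lambda>p. f (p + w))"
proof (induction r arbitrary: f)
  case 0
  then show ?case
    using continuous_on_compose2[of UNIV f UNIV "\<lambda>p. p + w"]
    by (simp add: continuous_on_add continuous_on_id continuous_on_const)
qed (auto simp: lie_translate differentiable_translate)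

lemma C_class_const: "C_class r (\<lambda>p. a)"
  by (induction r arbitrary: a) (auto simp: lie_const)

lemma C_class_foldr_lie: "C_class (length vs + r) f \<Longrightarrow> C_class r (foldr lie vs f)"
proof (induction vs arbitrary: r)
  case (Cons v vs)
  then show ?case using Cons.IH[of "Suc r"] by simp
qed simp

lemma foldr_lie_differentiable: "C_class r f \<Longrightarrow> length vs < r \<Longrightarrow> foldr lie vs f differentiable (at p)"
  using C_class_foldr_lie[of vs 1 f] C_class_mono[of "length vs + 1" r f] by simp

lemma foldr_lie_add:
  assumes "C_class r f" "C_class r g" "length vs \<le> r"
  shows "foldr lie vs (\<lambda>p. f p + g p) = (\<lambda>p. foldr lie vs f p + foldr lie vs g p)"
  using assms(3)
proof (induction vs)
  case (Cons v vs)
  then show ?case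
    using lie_add[of "foldr lie vs f" "foldr lie vs g"] foldr_lie_differentiable[OF assms(1), of vs]
      foldr_lie_differentiable[OF assms(2), of vs] by simp
qed simp

lemma foldr_lie_scaleR:
  assumes "C_class r f" "length vs \<le> r"
  shows "foldr lie vs (\<lambda>p. c *\<^sub>R f p) = (\<lambda>p. c *\<^sub>R foldr lie vs f p)"
  using assms(2)
proof (induction vs)
  case (Cons v vs)
  then show ?case
    using lie_scaleR[of "foldr lie vs f"] foldr_lie_differentiable[OF assms(1), of vs] by simp
qed simp

lemma foldr_lie_translate: "foldr lie vs (\<lambda>p. f (p + w)) = (\<lambda>p. foldr lie vs f (p + w))"
  by (induction vs) (simp_all add: lie_translate)

text \<open>\<open>C_norm\<close> sees unit directions only; homogeneity in the direction extends
  its bound to all v, including v = 0.\<close>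

lemma lie_norm_le:
  assumes "f differentiable (at p)" "\<And>u. norm u = 1 \<Longrightarrow> norm (lie u f p) \<le> C" "0 \<le> C"
  shows "norm (lie v f p) \<le> C * norm v"
proof (cases "v = 0")
  case True
  then show ?thesis using lie_scale_direction[OF assms(1), of 0 v] assms(3) by simp
next
  case False
  have "norm (lie v f p) = norm v * norm (lie (v /\<^sub>R norm v) f p)"
    using lie_scale_direction[OF assms(1), of "norm v" "v /\<^sub>R norm v"] False by simp
  also have "\<dots> \<le> norm v * C" using assms(2) False by (intro mult_left_mono) auto
  finally show ?thesis by (simp add: mult.commute)
qed

lemma lie_bound_lipschitz:
  assumes "\<And>p. f differentiable (at p)" "\<And>u p. norm u = 1 \<Longrightarrow> norm (lie u f p) \<le> C" "0 \<le> C"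
  shows "norm (f p - f q) \<le> C * norm (p - q)"
proof (rule differentiable_bound[of UNIV f "\<lambda>x v. lie v f x"])
  fix x show "(f has_derivative (\<lambda>v. lie v f x)) (at x within UNIV)"
    using has_derivative_lie[OF assms(1)] by simp
  show "onorm (\<lambda>v. lie v f x) \<le> C"
    by (intro onorm_bound lie_norm_le assms)
qed auto

text \<open>The mean value inequality for g(t) - t g'(0) on [-|s|, |s|], whose derivative has norm
  at most K |s| there.\<close>

lemma first_order_remainder:
  fixes g :: "real \<Rightarrow> 'b::real_normed_vector"
  assumes "\<And>t. (g has_vector_derivative g' t) (at t)" "\<And>t. norm (g' t - g' 0) \<le> K * \<bar>t\<bar>" "0 \<le> K"
  shows "norm (g s - g 0 - s *\<^sub>R g' 0) \<le> K * s\<^sup>2"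
proof -
  have "norm ((g s - s *\<^sub>R g' 0) - (g 0 - 0 *\<^sub>R g' 0)) \<le> K * \<bar>s\<bar> * norm (s - 0)"
  proof (rule differentiable_bound[of "{- \<bar>s\<bar>..\<bar>s\<bar>}" _ "\<lambda>t h. h *\<^sub>R (g' t - g' 0)"])
    fix t assume t: "t \<in> {- \<bar>s\<bar>..\<bar>s\<bar>}"
    have "(g has_derivative (\<lambda>h. h *\<^sub>R g' t)) (at t)"
      using assms(1) by (simp add: has_vector_derivative_def)
    then show "((\<lambda>t. g t - t *\<^sub>R g' 0) has_derivative (\<lambda>h. h *\<^sub>R (g' t - g' 0))) (at t within {- \<bar>s\<bar>..\<bar>s\<bar>})"
      using has_derivative_at_withinI[OF has_derivative_diff[OF _
          has_derivative_scaleR_left[OF has_derivative_ident, of "g' 0"]]]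
      by (simp add: scaleR_diff_right)
    have "\<bar>t\<bar> \<le> \<bar>s\<bar>" using t by (simp add: abs_le_iff)
    then have "norm (g' t - g' 0) \<le> K * \<bar>s\<bar>"
      using assms(2)[of t] mult_left_mono[of "\<bar>t\<bar>" "\<bar>s\<bar>" K] assms(3) by linarith
    then show "onorm (\<lambda>h. h *\<^sub>R (g' t - g' 0)) \<le> K * \<bar>s\<bar>"
      using assms(3) by (intro onorm_bound) (auto simp: mult.commute intro: mult_left_mono)
  qed auto
  then show ?thesis by (simp add: power2_eq_square abs_mult_self algebra_simps)
qed

section \<open>Forms and Dirac chains\<close>

lemma Lam_add: "a \<in> Lam k \<Longrightarrow> b \<in> Lam k \<Longrightarrow> a + b \<in> Lam k"
  by (simp add: Lam_def)

lemma Lam_scaleR: "a \<in> Lam k \<Longrightarrow> c *\<^sub>R a \<in> Lam k"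
  by (simp add: Lam_def)

lemma Lam_zero: "0 \<in> Lam k"
  by (simp add: Lam_def)

lemma Lam_diff: "a \<in> Lam k \<Longrightarrow> b \<in> Lam k \<Longrightarrow> a - b \<in> Lam k"
  by (simp add: Lam_def)

lemma closed_Lam: "closed (Lam k :: ('n::finite) multivec set)"
proof -
  have "(Lam k :: 'n multivec set) = (\<Inter>I\<in>{I. card I \<noteq> k}. {a. a $ I = 0})" by (auto simp: Lam_def)
  moreover have "closed {a :: 'n multivec. a $ I = 0}" for I
    by (intro closed_Collect_eq continuous_intros)
  ultimately show ?thesis by auto
qed

lemma axis_mem_Lam: "card I = k \<Longrightarrow> axis I c \<in> Lam k"
  by (auto simp: Lam_def axis_def)

lemma lie_values_mono: "r \<le> s \<Longrightarrow> lie_values r \<omega> \<subseteq> lie_values s \<omega>"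
  unfolding lie_values_def by (auto dest: order_trans)

lemma lie_values_nonempty: "lie_values r \<omega> \<noteq> {}"
  unfolding lie_values_def by (auto intro!: exI[of _ "[]"])

lemma bdd_lie_values: "bounded (lie_values r \<omega>) \<Longrightarrow> bdd_above (norm ` lie_values r \<omega>)"
  by (auto simp: bdd_above_def bounded_iff)

lemma norm_lie_le_C_norm:
  assumes "\<omega> \<in> B_forms_r k r" "length vs \<le> r" "\<forall>v\<in>set vs. norm v = 1"
  shows "norm (foldr lie vs \<omega> p) \<le> C_norm r \<omega>"
  unfolding C_norm_def
  by (rule cSUP_upper[OF _ bdd_lie_values]) (use assms in \<open>auto simp: B_forms_r_def lie_values_def\<close>)

lemma norm_le_C_norm: "\<omega> \<in> B_forms_r k r \<Longrightarrow> norm (\<omega> p) \<le> C_norm r \<omega>"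
  using norm_lie_le_C_norm[of \<omega> k r "[]" p] by simp

lemma C_norm_leI:
  assumes "\<And>vs p. length vs \<le> r \<Longrightarrow> \<forall>v\<in>set vs. norm v = 1 \<Longrightarrow> norm (foldr lie vs \<omega> p) \<le> M"
  shows "C_norm r \<omega> \<le> M"
  unfolding C_norm_def
  by (rule cSUP_least[OF lie_values_nonempty]) (use assms in \<open>auto simp: lie_values_def\<close>)

lemma B_forms_rI:
  assumes "range \<omega> \<subseteq> Lam k" "C_class r \<omega>"
    "\<And>vs p. length vs \<le> r \<Longrightarrow> \<forall>v\<in>set vs. norm v = 1 \<Longrightarrow> norm (foldr lie vs \<omega> p) \<le> M"
  shows "\<omega> \<in> B_forms_r k r"
proof -
  have "bounded (lie_values r \<omega>)"
    unfolding bounded_iff lie_values_def using assms(3) by (intro exI[of _ M]) auto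
  with assms show ?thesis by (simp add: B_forms_r_def)
qed

lemma C_norm_nonneg: "\<omega> \<in> B_forms_r k r \<Longrightarrow> 0 \<le> C_norm r \<omega>"
  using norm_le_C_norm[of \<omega> k r undefined] norm_ge_zero order_trans by blast

lemma C_norm_pos: "\<omega> \<in> B_forms_r k r \<Longrightarrow> \<omega> \<noteq> (\<lambda>p. 0) \<Longrightarrow> 0 < C_norm r \<omega>"
proof -
  assume *: "\<omega> \<in> B_forms_r k r" "\<omega> \<noteq> (\<lambda>p. 0)"
  then obtain p where "\<omega> p \<noteq> 0" by auto
  then have "0 < norm (\<omega> p)" by simp
  then show ?thesis using norm_le_C_norm[OF *(1), of p] by linarith
qed

lemma B_forms_r_mono: "r \<le> s \<Longrightarrow> B_forms_r k s \<subseteq> B_forms_r k r"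
  using C_class_mono[of r s] bounded_subset[OF _ lie_values_mono[of r s]] by (auto simp: B_forms_r_def)

lemma C_norm_mono: "r \<le> s \<Longrightarrow> \<omega> \<in> B_forms_r k s \<Longrightarrow> C_norm r \<omega> \<le> C_norm s \<omega>"
  by (intro C_norm_leI norm_lie_le_C_norm) auto

lemma B_forms_r_add:
  assumes "\<omega> \<in> B_forms_r k r" "\<eta> \<in> B_forms_r k r"
  shows "(\<lambda>p. \<omega> p + \<eta> p) \<in> B_forms_r k r" "C_norm r (\<lambda>p. \<omega> p + \<eta> p) \<le> C_norm r \<omega> + C_norm r \<eta>"
proof -
  have C: "C_class r \<omega>" "C_class r \<eta>" using assms by (auto simp: B_forms_r_def)
  have *: "norm (foldr lie vs (\<lambda>p. \<omega> p + \<eta> p) p) \<le> C_norm r \<omega> + C_norm r \<eta>"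
    if "length vs \<le> r" "\<forall>v\<in>set vs. norm v = 1" for vs p
    unfolding foldr_lie_add[OF C that(1)]
    using norm_lie_le_C_norm[OF assms(1) that] norm_lie_le_C_norm[OF assms(2) that] norm_triangle_le add_mono by blast
  show "(\<lambda>p. \<omega> p + \<eta> p) \<in> B_forms_r k r"
    using assms * by (intro B_forms_rI) (auto simp: B_forms_r_def C_class_add intro!: Lam_add)
  show "C_norm r (\<lambda>p. \<omega> p + \<eta> p) \<le> C_norm r \<omega> + C_norm r \<eta>"
    using * by (rule C_norm_leI)
qed

lemma B_forms_r_scaleR:
  assumes "\<omega> \<in> B_forms_r k r"
  shows "(\<lambda>p. c *\<^sub>R \<omega> p) \<in> B_forms_r k r" "C_norm r (\<lambda>p. c *\<^sub>R \<omega> p) \<le> \<bar>c\<bar> * C_norm r \<omega>"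
proof -
  have C: "C_class r \<omega>" using assms by (auto simp: B_forms_r_def)
  have *: "norm (foldr lie vs (\<lambda>p. c *\<^sub>R \<omega> p) p) \<le> \<bar>c\<bar> * C_norm r \<omega>"
    if "length vs \<le> r" "\<forall>v\<in>set vs. norm v = 1" for vs p
    unfolding foldr_lie_scaleR[OF C that(1)]
    using norm_lie_le_C_norm[OF assms(1) that] by (simp add: mult_left_mono)
  show "(\<lambda>p. c *\<^sub>R \<omega> p) \<in> B_forms_r k r"
    using assms * by (intro B_forms_rI) (auto simp: B_forms_r_def C_class_scaleR intro!: Lam_scaleR)
  show "C_norm r (\<lambda>p. c *\<^sub>R \<omega> p) \<le> \<bar>c\<bar> * C_norm r \<omega>"
    using * by (rule C_norm_leI)
qed

lemma B_forms_r_const: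
  assumes "a \<in> Lam k"
  shows "(\<lambda>p. a) \<in> B_forms_r k r"
proof (rule B_forms_rI[where M = "norm a"])
  fix vs :: "(real ^ 'a) list" and p
  have zero: "foldr lie us (\<lambda>p :: real ^ 'a. 0 :: 'a multivec) = (\<lambda>p. 0)" for us
    by (induction us) (simp_all add: lie_const)
  \<comment> \<open>\<open>foldr\<close> applies the last direction first, and that one already
    kills the constant.\<close>
  show "norm (foldr lie vs (\<lambda>p. a) p) \<le> norm a"
    by (cases vs rule: rev_cases) (simp_all add: lie_const zero)
qed (use assms in \<open>auto simp: C_class_const\<close>)

text \<open>Lie derivatives commute with translations, and the mean value inequality pays for the
  translation with one more derivative.\<close>

lemma translation_difference:
  assumes "\<omega> \<in> B_forms_r k (Suc r)"
  shows "(\<lambda>p. \<omega> (p + v) - \<omega> p) \<in> B_forms_r k r"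
    "C_norm r (\<lambda>p. \<omega> (p + v) - \<omega> p) \<le> norm v * C_norm (Suc r) \<omega>"
proof -
  have C: "C_class (Suc r) \<omega>" using assms by (auto simp: B_forms_r_def)
  then have Cr: "C_class r \<omega>" by (rule C_class_Suc_imp)
  have eq: "(\<lambda>p. \<omega> (p + v) - \<omega> p) = (\<lambda>p. \<omega> (p + v) + (-1) *\<^sub>R \<omega> p)" by simp
  have *: "norm (foldr lie vs (\<lambda>p. \<omega> (p + v) - \<omega> p) p) \<le> norm v * C_norm (Suc r) \<omega>"
    if vs: "length vs \<le> r" "\<forall>v\<in>set vs. norm v = 1" for vs p
  proof -
    have "foldr lie vs (\<lambda>p. \<omega> (p + v) - \<omega> p) p = foldr lie vs \<omega> (p + v) - foldr lie vs \<omega> p"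
      unfolding eq foldr_lie_add[OF C_class_translate[OF Cr] C_class_scaleR[OF Cr] vs(1)]
        foldr_lie_scaleR[OF Cr vs(1)] foldr_lie_translate by simp
    also have "norm \<dots> \<le> C_norm (Suc r) \<omega> * norm (p + v - p)"
    proof (rule lie_bound_lipschitz)
      show "foldr lie vs \<omega> differentiable at q" for q
        using foldr_lie_differentiable[OF C] vs by simp
      show "norm (lie u (foldr lie vs \<omega>) q) \<le> C_norm (Suc r) \<omega>" if "norm u = 1" for u q
        using norm_lie_le_C_norm[OF assms, of "u # vs" q] vs that by simp
    qed (rule C_norm_nonneg[OF assms])
    finally show ?thesis by (simp add: mult.commute)
  qed
  have "range (\<lambda>p. \<omega> (p + v) - \<omega> p) \<subseteq> Lam k"
    using assms by (auto simp: B_forms_r_def intro!: Lam_diff)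
  moreover have "C_class r (\<lambda>p. \<omega> (p + v) - \<omega> p)"
    unfolding eq by (intro C_class_add C_class_scaleR C_class_translate Cr)
  ultimately show "(\<lambda>p. \<omega> (p + v) - \<omega> p) \<in> B_forms_r k r"
    using * by (rule B_forms_rI)
  show "C_norm r (\<lambda>p. \<omega> (p + v) - \<omega> p) \<le> norm v * C_norm (Suc r) \<omega>"
    using * by (rule C_norm_leI)
qed

lemma B_forms_simps:
  "vcarrier (B_forms k) = (\<Inter>r. B_forms_r k r)"
  "vzero (B_forms k) = (\<lambda>p. 0)"
  "vadd (B_forms k) = (\<lambda>\<omega> \<eta> p. \<omega> p + \<eta> p)"
  "vscale (B_forms k) = (\<lambda>c \<omega> p. c *\<^sub>R \<omega> p)"
  "seminorms (B_forms k) = range C_norm"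
  by (simp_all add: B_forms_def)

lemma dirac_space_simps:
  "vcarrier (dirac_space k r) = dirac_chains k"
  "vzero (dirac_space k r) = (\<lambda>p. 0)"
  "vadd (dirac_space k r) = (\<lambda>A B p. A p + B p)"
  "vscale (dirac_space k r) = (\<lambda>c A p. c *\<^sub>R A p)"
  "seminorms (dirac_space k r) = {B_norm k r}"
  by (simp_all add: dirac_space_def)

section \<open>Dirac chains and integration over them\<close>

lemma dirac_zero: "(\<lambda>p. 0) \<in> dirac_chains k"
  by (auto simp: dirac_chains_def Lam_zero)

lemma dirac_add: "A \<in> dirac_chains k \<Longrightarrow> B \<in> dirac_chains k \<Longrightarrow> (\<lambda>p. A p + B p) \<in> dirac_chains k"
  unfolding dirac_chains_def
  by (auto intro!: Lam_add intro: finite_subset[of _ "{p. A p \<noteq> 0} \<union> {p. B p \<noteq> 0}"])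

lemma dirac_scaleR: "A \<in> dirac_chains k \<Longrightarrow> (\<lambda>p. c *\<^sub>R A p) \<in> dirac_chains k"
  unfolding dirac_chains_def
  by (auto intro!: Lam_scaleR intro: finite_subset[of _ "{p. A p \<noteq> 0}"])

lemma vspace_dirac: "vspace_on (dirac_space k r)"
  by unfold_locales (auto simp: dirac_space_simps dirac_zero dirac_add dirac_scaleR algebra_simps)

lemma vspace_B_forms: "vspace_on (B_forms k)"
  by unfold_locales
    (auto simp: B_forms_simps B_forms_r_add B_forms_r_scaleR B_forms_r_const Lam_zero algebra_simps)

lemma dirac_integral_eq:
  assumes "finite T" "{p. A p \<noteq> 0} \<subseteq> T"
  shows "dirac_integral \<omega> A = (\<Sum>p\<in>T. \<omega> p \<bullet> A p)"
  unfolding dirac_integral_def by (rule sum.mono_neutral_left) (use assms in auto)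

lemma dirac_integral_add:
  assumes "A \<in> dirac_chains k" "B \<in> dirac_chains k"
  shows "dirac_integral \<omega> (\<lambda>p. A p + B p) = dirac_integral \<omega> A + dirac_integral \<omega> B"
proof -
  let ?T = "{p. A p \<noteq> 0} \<union> {p. B p \<noteq> 0}"
  have T: "finite ?T" using assms by (auto simp: dirac_chains_def)
  have "dirac_integral \<omega> (\<lambda>p. A p + B p) = (\<Sum>p\<in>?T. \<omega> p \<bullet> (A p + B p))"
    by (rule dirac_integral_eq[OF T]) auto
  also have "\<dots> = (\<Sum>p\<in>?T. \<omega> p \<bullet> A p) + (\<Sum>p\<in>?T. \<omega> p \<bullet> B p)"
    by (simp add: inner_add_right sum.distrib)
  also have "\<dots> = dirac_integral \<omega> A + dirac_integral \<omega> B"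
    using T by (simp add: dirac_integral_eq[OF T])
  finally show ?thesis .
qed

lemma dirac_integral_scaleR:
  assumes "A \<in> dirac_chains k"
  shows "dirac_integral \<omega> (\<lambda>p. c *\<^sub>R A p) = c * dirac_integral \<omega> A"
proof -
  have T: "finite {p. A p \<noteq> 0}" using assms by (auto simp: dirac_chains_def)
  then have "dirac_integral \<omega> (\<lambda>p. c *\<^sub>R A p) = (\<Sum>p | A p \<noteq> 0. \<omega> p \<bullet> (c *\<^sub>R A p))"
    by (rule dirac_integral_eq) auto
  then show ?thesis by (simp add: dirac_integral_def sum_distrib_left)
qed

lemma dirac_integral_diff:
  assumes "A \<in> dirac_chains k" "B \<in> dirac_chains k"
  shows "dirac_integral \<omega> (\<lambda>p. A p - B p) = dirac_integral \<omega> A - dirac_integral \<omega> B"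
  using dirac_integral_add[OF assms(1) dirac_scaleR[OF assms(2), of "-1"]]
    dirac_integral_scaleR[OF assms(2), of \<omega> "-1"] by simp

lemma dirac_diff: "A \<in> dirac_chains k \<Longrightarrow> B \<in> dirac_chains k \<Longrightarrow> (\<lambda>p. A p - B p) \<in> dirac_chains k"
  using dirac_add[OF _ dirac_scaleR[of B k "-1"], of A] by simp

lemma dirac_integral_form_add:
  "dirac_integral (\<lambda>p. \<omega> p + \<eta> p) A = dirac_integral \<omega> A + dirac_integral \<eta> A"
  by (simp add: dirac_integral_def inner_add_left sum.distrib)

lemma dirac_integral_form_scaleR: "dirac_integral (\<lambda>p. c *\<^sub>R \<omega> p) A = c * dirac_integral \<omega> A"
  by (simp add: dirac_integral_def sum_distrib_left)

lemma dirac_integral_form_diff: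
  "dirac_integral (\<lambda>p. \<omega> p - \<eta> p) A = dirac_integral \<omega> A - dirac_integral \<eta> A"
  by (simp add: dirac_integral_def inner_diff_left sum_subtractf)

definition single :: "real ^ 'n \<Rightarrow> ('n::finite) multivec \<Rightarrow> 'n dirac" where
  "single p a = (\<lambda>x. if x = p then a else 0)"

lemma single_mem: "a \<in> Lam k \<Longrightarrow> single p a \<in> dirac_chains k"
  by (auto simp: dirac_chains_def single_def Lam_zero)

lemma dirac_integral_single: "dirac_integral \<omega> (single p a) = \<omega> p \<bullet> a"
  by (subst dirac_integral_eq[of "{p}"]) (auto simp: single_def)

lemma dirac_integral_translate:
  "dirac_integral \<omega> (\<lambda>p. A (p - v)) = dirac_integral (\<lambda>p. \<omega> (p + v)) A"
proof -
  have "(\<Sum>p | A (p - v) \<noteq> 0. \<omega> p \<bullet> A (p - v)) = (\<Sum>p | A p \<noteq> 0. \<omega> (p + v) \<bullet> A p)"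
    by (rule sum.reindex_bij_witness[of _ "\<lambda>p. p + v" "\<lambda>p. p - v"]) auto
  then show ?thesis by (simp add: dirac_integral_def)
qed

lemma dirac_translate:
  assumes "A \<in> dirac_chains k"
  shows "(\<lambda>p. A (p - v)) \<in> dirac_chains k"
proof -
  have "{p. A (p - v) \<noteq> 0} = (\<lambda>p. p + v) ` {p. A p \<noteq> 0}"
    by (auto intro!: image_eqI[of _ _ "_ - v"])
  then show ?thesis using assms by (auto simp: dirac_chains_def)
qed

text \<open>Bounds integral over \<open>C_norm r\<close> for all r at once: this makes the supremum
  in \<open>B_norm\<close> finite and later provides an estimate independent of r.\<close>

definition mass :: "('n::finite) dirac \<Rightarrow> real" where
  "mass A = (\<Sum>p | A p \<noteq> 0. norm (A p))"

lemma dirac_integral_le_mass: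
  assumes "\<omega> \<in> B_forms_r k r"
  shows "\<bar>dirac_integral \<omega> A\<bar> \<le> C_norm r \<omega> * mass A"
proof -
  have "\<bar>dirac_integral \<omega> A\<bar> \<le> (\<Sum>p | A p \<noteq> 0. \<bar>\<omega> p \<bullet> A p\<bar>)"
    unfolding dirac_integral_def by (rule sum_abs)
  also have "\<dots> \<le> (\<Sum>p | A p \<noteq> 0. C_norm r \<omega> * norm (A p))"
    by (intro sum_mono order_trans[OF Cauchy_Schwarz_ineq2] mult_right_mono norm_le_C_norm[OF assms]) auto
  finally show ?thesis by (simp add: mass_def sum_distrib_left)
qed

text \<open>\<open>B_norm\<close> is a supremum without absolute values; the lower bound for the
  integral comes from testing with - \<omega>.\<close>

lemma dirac_integral_le_B_norm:
  fixes A :: "('n::finite) dirac"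
  assumes w: "\<omega> \<in> B_forms_r k r"
  shows "\<bar>dirac_integral \<omega> A\<bar> \<le> C_norm r \<omega> * B_norm k r A"
proof (cases "\<omega> = (\<lambda>p. 0)")
  case True
  have "C_norm r \<omega> \<le> 0"
    using B_forms_r_scaleR(2)[OF w, of 0] True by simp
  then show ?thesis
    using C_norm_nonneg[OF w] True by (simp add: dirac_integral_def)
next
  case False
  have bdd: "bdd_above ((\<lambda>\<omega>. dirac_integral \<omega> A / C_norm r \<omega>) ` (B_forms_r k r - {\<lambda>p. 0}))"
  proof (rule bdd_aboveI2)
    fix \<eta> :: "'n form" assume "\<eta> \<in> B_forms_r k r - {\<lambda>p. 0}"
    then show "dirac_integral \<eta> A / C_norm r \<eta> \<le> mass A"
      using dirac_integral_le_mass[of \<eta> k r A] C_norm_pos[of \<eta> k r]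
      by (auto simp: field_simps)
  qed
  have le: "dirac_integral \<eta> A / C_norm r \<eta> \<le> B_norm k r A" if "\<eta> \<in> B_forms_r k r - {\<lambda>p. 0}" for \<eta> :: "'n form"
    unfolding B_norm_def using cSUP_upper[OF that bdd] .
  have pos: "0 < C_norm r \<omega>" using C_norm_pos[OF w False] .
  have m: "(\<lambda>p. (-1) *\<^sub>R \<omega> p) \<in> B_forms_r k r" "(\<lambda>p. (-1) *\<^sub>R \<omega> p) \<noteq> (\<lambda>p. 0)"
    using B_forms_r_scaleR(1)[OF w, of "-1"] False by (simp_all add: fun_eq_iff)
  have posm: "0 < C_norm r (\<lambda>p. (-1) *\<^sub>R \<omega> p)" using C_norm_pos[OF m] .
  have lem: "C_norm r (\<lambda>p. (-1) *\<^sub>R \<omega> p) \<le> C_norm r \<omega>" using B_forms_r_scaleR(2)[OF w, of "-1"] by simp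
  have 1: "dirac_integral \<omega> A \<le> C_norm r \<omega> * B_norm k r A"
    using le[of \<omega>] w False pos by (simp add: field_simps)
  have 2: "- dirac_integral \<omega> A \<le> C_norm r (\<lambda>p. (-1) *\<^sub>R \<omega> p) * B_norm k r A"
    using le[of "\<lambda>p. (-1) *\<^sub>R \<omega> p"] m posm dirac_integral_form_scaleR[of "-1" \<omega> A] by (simp add: field_simps)
  \<comment> \<open>A negative supremum would make the integrals of \<omega> and - \<omega> both
    negative.\<close>
  have "0 \<le> B_norm k r A"
  proof (rule ccontr)
    assume "\<not> 0 \<le> B_norm k r A"
    then have "C_norm r \<omega> * B_norm k r A < 0" "C_norm r (\<lambda>p. (-1) *\<^sub>R \<omega> p) * B_norm k r A < 0"
      using pos posm by (auto simp: mult_less_0_iff)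
    with 1 2 show False by linarith
  qed
  then have "C_norm r (\<lambda>p. (-1) *\<^sub>R \<omega> p) * B_norm k r A \<le> C_norm r \<omega> * B_norm k r A"
    using lem by (rule mult_right_mono[rotated])
  with 1 2 show ?thesis by linarith
qed

lemma vlinear_dirac_integral: "vlinear (dirac_space k r) real_vspace (dirac_integral \<omega>)"
  by (simp add: vlinear_def real_vspace_def dirac_space_simps dirac_integral_add dirac_integral_scaleR)

text \<open>For k > n the zero form is the only one, and \<open>B_norm\<close> would be a supremum
  over the empty set; k <= n provides a basis element e_I and with it a nonzero form. The parameter
  \<open>dim\<close> fixes the type 'n, whose cardinality is n >= 1.\<close>

locale degree =
  fixes k :: nat and dim :: "'n::finite itself"
  assumes degree_le: "k \<le> CARD('n)"
begin

lemma index_exists: obtains I :: "'n set" where "card I = k"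
  using degree_le obtain_subset_with_card_n by metis

lemma B_forms_r_nontrivial: "B_forms_r k r - {\<lambda>p. 0} \<noteq> ({} :: 'n form set)"
proof -
  obtain I :: "'n set" where I: "card I = k" by (rule index_exists)
  have "(\<lambda>p. axis I 1) \<in> B_forms_r k r"
    using B_forms_r_const[OF axis_mem_Lam[OF I]] .
  moreover have "(\<lambda>p :: real ^ 'n. axis I (1::real)) \<noteq> (\<lambda>p. 0)"
    by (simp add: fun_eq_iff axis_eq_0_iff)
  ultimately show ?thesis by blast
qed

section \<open>The norms B^r on Dirac chains\<close>

lemma B_norm_leI:
  fixes A :: "'n dirac"
  assumes "\<And>\<omega>. \<omega> \<in> B_forms_r k r \<Longrightarrow> dirac_integral \<omega> A \<le> M * C_norm r \<omega>"
  shows "B_norm k r A \<le> M"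
  unfolding B_norm_def
proof (rule cSUP_least[OF B_forms_r_nontrivial])
  fix \<omega> :: "'n form" assume "\<omega> \<in> B_forms_r k r - {\<lambda>p. 0}"
  then show "dirac_integral \<omega> A / C_norm r \<omega> \<le> M"
    using assms[of \<omega>] C_norm_pos[of \<omega> k r] by (simp add: field_simps)
qed

lemma B_norm_nonneg: "0 \<le> B_norm k r (A :: 'n dirac)"
proof -
  obtain \<omega> :: "'n form" where w: "\<omega> \<in> B_forms_r k r" "\<omega> \<noteq> (\<lambda>p. 0)"
    using B_forms_r_nontrivial by blast
  have "0 \<le> C_norm r \<omega> * B_norm k r A"
    using dirac_integral_le_B_norm[OF w(1), of A] by linarith
  then show ?thesis using C_norm_pos[OF w] by (simp add: zero_le_mult_iff)
qed

lemma seminorm_B_norm: "is_seminorm (dirac_space k r) (B_norm k r :: 'n dirac \<Rightarrow> real)"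
  unfolding is_seminorm_def dirac_space_simps
proof (intro conjI ballI allI)
  fix A B :: "'n dirac" assume A: "A \<in> dirac_chains k" and B: "B \<in> dirac_chains k"
  show "B_norm k r (\<lambda>p. A p + B p) \<le> B_norm k r A + B_norm k r B"
  proof (rule B_norm_leI)
    fix \<omega> :: "'n form" assume w: "\<omega> \<in> B_forms_r k r"
    show "dirac_integral \<omega> (\<lambda>p. A p + B p) \<le> (B_norm k r A + B_norm k r B) * C_norm r \<omega>"
      unfolding dirac_integral_add[OF A B]
      using dirac_integral_le_B_norm[OF w, of A] dirac_integral_le_B_norm[OF w, of B]
      by (simp add: algebra_simps)
  qed
next
  have le: "B_norm k r (\<lambda>p. c *\<^sub>R A p) \<le> \<bar>c\<bar> * B_norm k r A" if A: "A \<in> dirac_chains k" for c and A :: "'n dirac"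
  proof (rule B_norm_leI)
    fix \<omega> :: "'n form" assume w: "\<omega> \<in> B_forms_r k r"
    have "dirac_integral \<omega> (\<lambda>p. c *\<^sub>R A p) \<le> \<bar>c\<bar> * \<bar>dirac_integral \<omega> A\<bar>"
      unfolding dirac_integral_scaleR[OF A] by (metis abs_ge_self abs_mult)
    also have "\<dots> \<le> \<bar>c\<bar> * (C_norm r \<omega> * B_norm k r A)"
      using dirac_integral_le_B_norm[OF w, of A] by (rule mult_left_mono) simp
    finally show "dirac_integral \<omega> (\<lambda>p. c *\<^sub>R A p) \<le> \<bar>c\<bar> * B_norm k r A * C_norm r \<omega>"
      by (simp add: algebra_simps)
  qed
  fix c and A :: "'n dirac" assume A: "A \<in> dirac_chains k"
  show "B_norm k r (\<lambda>p. c *\<^sub>R A p) = \<bar>c\<bar> * B_norm k r A"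
  proof (cases "c = 0")
    case True
    then show ?thesis using le[OF A, of 0] B_norm_nonneg[of r "\<lambda>p. 0"] by simp
  next
    case False
    then have "\<bar>c\<bar> * B_norm k r A \<le> B_norm k r (\<lambda>p. c *\<^sub>R A p)"
      using le[OF dirac_scaleR[OF A, of c], of "inverse c"] by (simp add: field_simps)
    with le[OF A, of c] show ?thesis by simp
  qed
qed (rule B_norm_nonneg)

lemma B_norm_antimono:
  assumes "r \<le> s"
  shows "B_norm k s A \<le> B_norm k r (A :: 'n dirac)"
proof (rule B_norm_leI)
  fix \<omega> :: "'n form" assume w: "\<omega> \<in> B_forms_r k s"
  then have wr: "\<omega> \<in> B_forms_r k r" using B_forms_r_mono[OF assms] by blast
  have "dirac_integral \<omega> A \<le> C_norm r \<omega> * B_norm k r A"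
    using dirac_integral_le_B_norm[OF wr, of A] by simp
  also have "\<dots> \<le> C_norm s \<omega> * B_norm k r A"
    using C_norm_mono[OF assms w] B_norm_nonneg by (rule mult_right_mono)
  finally show "dirac_integral \<omega> A \<le> B_norm k r A * C_norm s \<omega>" by (simp add: mult.commute)
qed

lemma lcs_dirac: "lcs_on (dirac_space k r :: 'n dirac lcs)"
proof -
  interpret vspace_on "dirac_space k r :: 'n dirac lcs" by (rule vspace_dirac)
  show ?thesis
    by unfold_locales (simp add: dirac_space_simps(5) seminorm_B_norm)
qed

end

section \<open>Regularity of tame forms\<close>

context degree
begin

text \<open>A form is tame if its integral over Dirac chains is bounded for every norm \<open>B\<^sup>r\<close>. Nothing is
  assumed about its regularity: smoothness is extracted from the bounds, by testing on
  difference quotients, and the class is stable under Lie derivatives.\<close>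

definition tame :: "(nat \<Rightarrow> real) \<Rightarrow> 'n form \<Rightarrow> bool" where
  "tame M \<omega> \<longleftrightarrow> range \<omega> \<subseteq> Lam k \<and> (\<forall>r. 0 \<le> M r) \<and>
     (\<forall>r. \<forall>A\<in>dirac_chains k. \<bar>dirac_integral \<omega> A\<bar> \<le> M r * B_norm k r A)"

lemma tame_mem: "tame M \<omega> \<Longrightarrow> \<omega> p \<in> Lam k"
  by (auto simp: tame_def)

lemma tame_bound:
  assumes "tame M \<omega>" "A \<in> dirac_chains k"
    "\<And>\<eta> :: 'n form. \<eta> \<in> B_forms_r k r \<Longrightarrow> dirac_integral \<eta> A \<le> c * C_norm r \<eta>"
  shows "\<bar>dirac_integral \<omega> A\<bar> \<le> M r * c"
proof -
  have "\<bar>dirac_integral \<omega> A\<bar> \<le> M r * B_norm k r A"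
    using assms(1,2) by (auto simp: tame_def)
  also have "\<dots> \<le> M r * c"
    using B_norm_leI[OF assms(3)] assms(1) by (intro mult_left_mono) (auto simp: tame_def)
  finally show ?thesis .
qed

text \<open>Test on the chain (p; \<omega>(p)): its integral is |\<omega>(p)|^2, while its B^0 norm
  is at most |\<omega>(p)|.\<close>

lemma tame_norm:
  assumes "tame M \<omega>"
  shows "norm (\<omega> p) \<le> M 0"
proof -
  have "\<bar>dirac_integral \<omega> (single p (\<omega> p))\<bar> \<le> M 0 * norm (\<omega> p)"
  proof (rule tame_bound[OF assms single_mem[OF tame_mem[OF assms]]])
    fix \<eta> :: "'n form" assume e: "\<eta> \<in> B_forms_r k 0"
    have "\<eta> p \<bullet> \<omega> p \<le> norm (\<eta> p) * norm (\<omega> p)" by (rule norm_cauchy_schwarz)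
    also have "\<dots> \<le> C_norm 0 \<eta> * norm (\<omega> p)"
      using norm_le_C_norm[OF e] by (rule mult_right_mono) simp
    finally show "dirac_integral \<eta> (single p (\<omega> p)) \<le> norm (\<omega> p) * C_norm 0 \<eta>"
      by (simp add: dirac_integral_single mult.commute)
  qed
  then have "norm (\<omega> p) * norm (\<omega> p) \<le> M 0 * norm (\<omega> p)"
    by (simp add: dirac_integral_single dot_square_norm power2_eq_square)
  then show ?thesis
    using assms by (cases "\<omega> p = 0") (auto simp: tame_def)
qed

text \<open>By duality the translation passes to the chain: a chain minus its translate has B^(r+1)
  norm at most |v| times the B^r norm of the chain, which shifts the bounds by one.\<close>

lemma tame_translation_difference:
  assumes "tame M \<omega>"
  shows "tame (\<lambda>r. norm v * M (Suc r)) (\<lambda>p. \<omega> (p + v) - \<omega> p)"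
  unfolding tame_def
proof (intro conjI allI ballI)
  show "range (\<lambda>p. \<omega> (p + v) - \<omega> p) \<subseteq> Lam k"
    using tame_mem[OF assms] by (auto intro: Lam_diff)
  show "0 \<le> norm v * M (Suc r)" for r using assms by (simp add: tame_def)
  fix r and A :: "'n dirac" assume A: "A \<in> dirac_chains k"
  let ?B = "\<lambda>p. A (p - v) - A p"
  have int: "dirac_integral \<eta> ?B = dirac_integral (\<lambda>p. \<eta> (p + v) - \<eta> p) A" for \<eta> :: "'n form"
    by (simp add: dirac_integral_diff[OF dirac_translate[OF A] A] dirac_integral_translate
        dirac_integral_form_diff)
  have "\<bar>dirac_integral \<omega> ?B\<bar> \<le> M (Suc r) * (norm v * B_norm k r A)"
  proof (rule tame_bound[OF assms dirac_diff[OF dirac_translate[OF A] A]])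
    fix \<eta> :: "'n form" assume e: "\<eta> \<in> B_forms_r k (Suc r)"
    note d = translation_difference[OF e, of v]
    have "dirac_integral \<eta> ?B \<le> C_norm r (\<lambda>p. \<eta> (p + v) - \<eta> p) * B_norm k r A"
      using dirac_integral_le_B_norm[OF d(1), of A] by (simp add: int)
    also have "\<dots> \<le> norm v * C_norm (Suc r) \<eta> * B_norm k r A"
      using d(2) B_norm_nonneg by (rule mult_right_mono)
    finally show "dirac_integral \<eta> ?B \<le> norm v * B_norm k r A * C_norm (Suc r) \<eta>"
      by (simp add: algebra_simps)
  qed
  then show "\<bar>dirac_integral (\<lambda>p. \<omega> (p + v) - \<omega> p) A\<bar> \<le> norm v * M (Suc r) * B_norm k r A"
    by (simp add: int algebra_simps)
qed

lemma tame_lipschitz: "tame M \<omega> \<Longrightarrow> norm (\<omega> (p + v) - \<omega> p) \<le> norm v * M 1"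
  using tame_norm[OF tame_translation_difference] by simp

text \<open>Two translations shift the bounds by two, and the B^0 estimate then sees
  \<open>M 2\<close>. This stands in for a bound on second derivatives before these are known to
  exist.\<close>

lemma tame_second_difference:
  assumes "tame M \<omega>"
  shows "norm (\<omega> (p + w + v) - \<omega> (p + w) - (\<omega> (p + v) - \<omega> p)) \<le> norm w * (norm v * M 2)"
  using tame_norm[OF tame_translation_difference[OF tame_translation_difference[OF assms]], of p w v]
  by (simp add: numeral_2_eq_2)

text \<open>For \<eta> of class C^2 the derivative along v is Lipschitz, so the Taylor remainder is
  quadratic in s, and division by s leaves one factor. This is the source of the B^2 estimate for
  difference quotients of Dirac chains.\<close>

lemma difference_quotient_error:
  assumes e: "\<eta> \<in> B_forms_r k 2" and s: "s \<noteq> 0"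
  shows "norm ((1 / s) *\<^sub>R (\<eta> (p + s *\<^sub>R v) - \<eta> p) - lie v \<eta> p) \<le> \<bar>s\<bar> * (norm v)\<^sup>2 * C_norm 2 \<eta>"
proof -
  let ?C = "C_norm 2 \<eta>"
  have C0: "0 \<le> ?C" using C_norm_nonneg[OF e] .
  have C2: "C_class (Suc (Suc 0)) \<eta>" using e by (simp add: B_forms_r_def numeral_2_eq_2)
  have diff: "\<eta> differentiable (at q)" for q using C2 by simp
  have lip: "norm (lie v \<eta> q - lie v \<eta> p) \<le> norm v * (?C * norm (q - p))" for q
  proof (cases "v = 0")
    case True
    then show ?thesis using lie_scale_direction[OF diff, of 0 v] by simp
  next
    case False
    define u where "u = v /\<^sub>R norm v"
    have u: "norm u = 1" "v = norm v *\<^sub>R u" using False by (auto simp: u_def)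
    have "norm (lie u \<eta> q - lie u \<eta> p) \<le> ?C * norm (q - p)"
    proof (rule lie_bound_lipschitz)
      show "lie u \<eta> differentiable (at q)" for q using C2 by simp
      show "norm (lie u' (lie u \<eta>) q) \<le> ?C" if "norm u' = 1" for u' q
        using norm_lie_le_C_norm[OF e, of "[u', u]" q] that u by simp
    qed (rule C0)
    moreover have "lie v \<eta> q = norm v *\<^sub>R lie u \<eta> q" for q
      using lie_scale_direction[OF diff, of "norm v" u] u by metis
    ultimately show ?thesis
      by (simp flip: scaleR_diff_right add: mult_left_mono)
  qed
  have "norm (\<eta> (p + s *\<^sub>R v) - \<eta> (p + 0 *\<^sub>R v) - s *\<^sub>R lie v \<eta> (p + 0 *\<^sub>R v)) \<le> (norm v)\<^sup>2 * ?C * s\<^sup>2"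
  proof (rule first_order_remainder[where g = "\<lambda>t. \<eta> (p + t *\<^sub>R v)" and g' = "\<lambda>t. lie v \<eta> (p + t *\<^sub>R v)"])
    show "((\<lambda>t. \<eta> (p + t *\<^sub>R v)) has_vector_derivative lie v \<eta> (p + t *\<^sub>R v)) (at t)" for t
      using has_vector_derivative_lie[OF diff] .
    show "norm (lie v \<eta> (p + t *\<^sub>R v) - lie v \<eta> (p + 0 *\<^sub>R v)) \<le> (norm v)\<^sup>2 * ?C * \<bar>t\<bar>" for t
      using lip[of "p + t *\<^sub>R v"] by (simp add: power2_eq_square algebra_simps)
  qed (use C0 in simp)
  then have "norm (\<eta> (p + s *\<^sub>R v) - \<eta> p - s *\<^sub>R lie v \<eta> p) / \<bar>s\<bar> \<le> (norm v)\<^sup>2 * ?C * s\<^sup>2 / \<bar>s\<bar>"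
    by (intro divide_right_mono) simp_all
  also have "(norm v)\<^sup>2 * ?C * s\<^sup>2 / \<bar>s\<bar> = \<bar>s\<bar> * (norm v)\<^sup>2 * ?C"
    using s by (simp add: power2_eq_square[of s] field_simps)
  also have "norm (\<eta> (p + s *\<^sub>R v) - \<eta> p - s *\<^sub>R lie v \<eta> p) / \<bar>s\<bar>
      = norm ((1 / s) *\<^sub>R (\<eta> (p + s *\<^sub>R v) - \<eta> p - s *\<^sub>R lie v \<eta> p))"
    by simp
  also have "(1 / s) *\<^sub>R (\<eta> (p + s *\<^sub>R v) - \<eta> p - s *\<^sub>R lie v \<eta> p)
      = (1 / s) *\<^sub>R (\<eta> (p + s *\<^sub>R v) - \<eta> p) - lie v \<eta> p"
    using s by (simp add: scaleR_diff_right)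
  finally show ?thesis .
qed

text \<open>The difference of two quotient chains is small in B^2: on every \<eta> of class C^2 both
  quotients are close to \<open>lie v \<eta> p\<close>. Hence the quotients of \<omega> are Cauchy,
  although \<omega> itself is not yet known to be differentiable.\<close>

lemma tame_quotient_cauchy:
  assumes w: "tame M \<omega>" and s: "s \<noteq> 0" and t: "t \<noteq> 0"
  shows "norm ((1 / s) *\<^sub>R (\<omega> (p + s *\<^sub>R v) - \<omega> p) - (1 / t) *\<^sub>R (\<omega> (p + t *\<^sub>R v) - \<omega> p))
    \<le> M 2 * ((\<bar>s\<bar> + \<bar>t\<bar>) * (norm v)\<^sup>2)"
proof -
  define Q where "Q \<eta> = (1 / s) *\<^sub>R (\<eta> (p + s *\<^sub>R v) - \<eta> p) - (1 / t) *\<^sub>R (\<eta> (p + t *\<^sub>R v) - \<eta> p)"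
    for \<eta> :: "'n form"
  \<comment> \<open>With the difference itself as the multivector, its integral becomes a squared
    norm, as in \<open>tame_norm\<close>.\<close>
  define a where "a = Q \<omega>"
  have a: "a \<in> Lam k" unfolding a_def Q_def by (intro Lam_diff Lam_scaleR tame_mem[OF w])
  define A where "A = (\<lambda>x. (1 / s) *\<^sub>R (single (p + s *\<^sub>R v) a x - single p a x)
      - (1 / t) *\<^sub>R (single (p + t *\<^sub>R v) a x - single p a x))"
  note mem = single_mem[OF a] dirac_diff dirac_scaleR
  have A: "A \<in> dirac_chains k" unfolding A_def by (intro mem)
  have int: "dirac_integral \<eta> A = Q \<eta> \<bullet> a" for \<eta> :: "'n form"
  proof -
    have "dirac_integral \<eta> A = (1 / s) * (\<eta> (p + s *\<^sub>R v) \<bullet> a - \<eta> p \<bullet> a)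
        - (1 / t) * (\<eta> (p + t *\<^sub>R v) \<bullet> a - \<eta> p \<bullet> a)"
      unfolding A_def
      by (subst dirac_integral_diff[of _ k], (intro mem)+, (subst dirac_integral_scaleR[of _ k], (intro mem)+)+,
          (subst dirac_integral_diff[of _ k], (intro mem)+)+) (simp add: dirac_integral_single)
    then show ?thesis by (simp add: Q_def inner_diff_left)
  qed
  have "\<bar>dirac_integral \<omega> A\<bar> \<le> M 2 * ((\<bar>s\<bar> + \<bar>t\<bar>) * (norm v)\<^sup>2 * norm a)"
  proof (rule tame_bound[OF w A])
    fix \<eta> :: "'n form" assume e: "\<eta> \<in> B_forms_r k 2"
    have "norm (Q \<eta>) \<le> norm ((1 / s) *\<^sub>R (\<eta> (p + s *\<^sub>R v) - \<eta> p) - lie v \<eta> p)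
        + norm ((1 / t) *\<^sub>R (\<eta> (p + t *\<^sub>R v) - \<eta> p) - lie v \<eta> p)"
      unfolding Q_def using norm_triangle_ineq4[of "_ - lie v \<eta> p" "_ - lie v \<eta> p"] by fastforce
    also have "\<dots> \<le> \<bar>s\<bar> * (norm v)\<^sup>2 * C_norm 2 \<eta> + \<bar>t\<bar> * (norm v)\<^sup>2 * C_norm 2 \<eta>"
      by (intro add_mono difference_quotient_error e s t)
    finally have "norm (Q \<eta>) * norm a \<le> (\<bar>s\<bar> + \<bar>t\<bar>) * (norm v)\<^sup>2 * C_norm 2 \<eta> * norm a"
      by (intro mult_right_mono) (simp_all add: algebra_simps)
    then show "dirac_integral \<eta> A \<le> (\<bar>s\<bar> + \<bar>t\<bar>) * (norm v)\<^sup>2 * norm a * C_norm 2 \<eta>"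
      unfolding int using norm_cauchy_schwarz[of "Q \<eta>" a] by (simp add: algebra_simps)
  qed
  then have "norm a * norm a \<le> M 2 * ((\<bar>s\<bar> + \<bar>t\<bar>) * (norm v)\<^sup>2) * norm a"
    by (simp add: int a_def[symmetric] dot_square_norm power2_eq_square mult.assoc)
  moreover have "0 \<le> M 2" using w by (simp add: tame_def)
  ultimately have "norm a \<le> M 2 * ((\<bar>s\<bar> + \<bar>t\<bar>) * (norm v)\<^sup>2)"
    by (cases "a = 0") simp_all
  then show ?thesis by (simp add: a_def Q_def)
qed

lemma has_vector_derivative_iff_quotient:
  fixes f :: "'a::real_normed_vector \<Rightarrow> 'b::real_normed_vector"
  shows "((\<lambda>t. f (p + t *\<^sub>R v)) has_vector_derivative l) (at t) \<longleftrightarrow>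
    ((\<lambda>h. (1 / h) *\<^sub>R (f (p + t *\<^sub>R v + h *\<^sub>R v) - f (p + t *\<^sub>R v))) \<longlongrightarrow> l) (at 0)"
proof -
  let ?Q = "\<lambda>h. (1 / h) *\<^sub>R (f (p + t *\<^sub>R v + h *\<^sub>R v) - f (p + t *\<^sub>R v))"
  have "((\<lambda>t. f (p + t *\<^sub>R v)) has_vector_derivative l) (at t) \<longleftrightarrow>
      ((\<lambda>h. norm (f (p + (t + h) *\<^sub>R v) - f (p + t *\<^sub>R v) - h *\<^sub>R l) / norm h) \<longlongrightarrow> 0) (at 0)"
    by (simp add: has_vector_derivative_def has_derivative_at bounded_linear_scaleR_left)
  also have "\<dots> \<longleftrightarrow> ((\<lambda>h. norm (?Q h - l)) \<longlongrightarrow> 0) (at 0)"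
  proof (rule filterlim_cong[OF refl refl])
    show "\<forall>\<^sub>F h in at 0. norm (f (p + (t + h) *\<^sub>R v) - f (p + t *\<^sub>R v) - h *\<^sub>R l) / norm h = norm (?Q h - l)"
      unfolding eventually_at_filter
    proof (intro always_eventually allI impI)
      fix h :: real assume h: "h \<noteq> 0"
      have "?Q h - l = (1 / h) *\<^sub>R (f (p + (t + h) *\<^sub>R v) - f (p + t *\<^sub>R v) - h *\<^sub>R l)"
        using h by (simp add: scaleR_diff_right scaleR_add_left add.assoc)
      then show "norm (f (p + (t + h) *\<^sub>R v) - f (p + t *\<^sub>R v) - h *\<^sub>R l) / norm h = norm (?Q h - l)"
        by (simp add: divide_inverse mult.commute)
    qed
  qed
  also have "\<dots> \<longleftrightarrow> (?Q \<longlongrightarrow> l) (at 0)"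
    by (subst tendsto_norm_zero_iff) (rule LIM_zero_iff)
  finally show ?thesis .
qed

text \<open>\<open>lie\<close> is a chosen value that is the derivative only where one exists, so
  existence comes first: the quotients are Cauchy, hence converge. Varying the base point moves the
  result from t = 0 to every t.\<close>

lemma tame_has_vector_derivative:
  assumes w: "tame M \<omega>"
  shows "((\<lambda>t. \<omega> (p + t *\<^sub>R v)) has_vector_derivative lie v \<omega> (p + t *\<^sub>R v)) (at t)"
proof -
  let ?Q = "\<lambda>q h. (1 / h) *\<^sub>R (\<omega> (q + h *\<^sub>R v) - \<omega> q)"
  have ex: "\<exists>l. (?Q q \<longlongrightarrow> l) (at 0)" for q
  proof (rule tendsto_cauchyI)
    fix e :: real assume e: "0 < e"
    define K where "K = M 2 * (norm v)\<^sup>2"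
    have K: "0 \<le> K" using w by (simp add: K_def tame_def)
    \<comment> \<open>The summand 1 guards against K = 0 and provides the strict inequality.\<close>
    define d where "d = e / (2 * (K + 1))"
    have d: "0 < d" using e K by (simp add: d_def)
    show "\<exists>P. eventually P (at 0) \<and> (\<forall>s t. P s \<and> P t \<longrightarrow> norm (?Q q s - ?Q q t) < e)"
    proof (intro exI[of _ "\<lambda>s. s \<noteq> 0 \<and> \<bar>s\<bar> < d"] conjI allI impI)
      show "\<forall>\<^sub>F s in at 0. s \<noteq> 0 \<and> \<bar>s\<bar> < d"
        using d by (auto simp: eventually_at intro!: exI[of _ d])
      fix s t assume st: "(s \<noteq> 0 \<and> \<bar>s\<bar> < d) \<and> (t \<noteq> 0 \<and> \<bar>t\<bar> < d)"
      then have "norm (?Q q s - ?Q q t) \<le> M 2 * ((\<bar>s\<bar> + \<bar>t\<bar>) * (norm v)\<^sup>2)"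
        using tame_quotient_cauchy[OF w] by blast
      also have "\<dots> = K * (\<bar>s\<bar> + \<bar>t\<bar>)" by (simp add: K_def)
      also have "\<dots> \<le> K * (2 * d)" using st K by (intro mult_left_mono) auto
      also have "\<dots> < (K + 1) * (2 * d)" using d by simp
      also have "\<dots> = e" using K by (simp add: d_def field_simps)
      finally show "norm (?Q q s - ?Q q t) < e" .
    qed
  qed simp
  have "\<exists>l. ((\<lambda>t. \<omega> (q + t *\<^sub>R v)) has_vector_derivative l) (at 0)" for q
    using ex[of q] has_vector_derivative_iff_quotient[of \<omega> q v _ 0] by simp
  then have "((\<lambda>t. \<omega> (q + t *\<^sub>R v)) has_vector_derivative lie v \<omega> q) (at 0)" for q
    unfolding lie_def using vector_derivative_works differentiableI_vector by blast
  from this[of "p + t *\<^sub>R v"] show ?thesis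
    using has_vector_derivative_iff_quotient[of \<omega> "p + t *\<^sub>R v" v _ 0]
    by (subst has_vector_derivative_iff_quotient) simp
qed

lemma tame_quotient_tendsto:
  assumes "tame M \<omega>"
  shows "((\<lambda>h. (1 / h) *\<^sub>R (\<omega> (p + h *\<^sub>R v) - \<omega> p)) \<longlongrightarrow> lie v \<omega> p) (at 0)"
  using tame_has_vector_derivative[OF assms, of p v 0] has_vector_derivative_iff_quotient[of \<omega> p v _ 0]
  by simp

text \<open>The difference quotients satisfy the bound uniformly in h, and integration over a fixed
  Dirac chain is a finite sum, so the bound survives the limit h -> 0.\<close>

lemma tame_lie:
  assumes w: "tame M \<omega>"
  shows "tame (\<lambda>r. norm v * M (Suc r)) (lie v \<omega>)"
  unfolding tame_def
proof (intro conjI allI ballI)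
  show "range (lie v \<omega>) \<subseteq> Lam k"
  proof clarify
    fix p
    show "lie v \<omega> p \<in> Lam k"
    proof (rule Lim_in_closed_set[OF closed_Lam _ _ tame_quotient_tendsto[OF w]])
      show "\<forall>\<^sub>F h in at 0. (1 / h) *\<^sub>R (\<omega> (p + h *\<^sub>R v) - \<omega> p) \<in> Lam k"
        by (intro always_eventually allI Lam_scaleR Lam_diff tame_mem[OF w])
    qed simp
  qed
  show "0 \<le> norm v * M (Suc r)" for r using w by (simp add: tame_def)
  fix r and A :: "'n dirac" assume A: "A \<in> dirac_chains k"
  let ?Q = "\<lambda>h p. (1 / h) *\<^sub>R (\<omega> (p + h *\<^sub>R v) - \<omega> p)"
  have lim: "((\<lambda>h. \<bar>dirac_integral (?Q h) A\<bar>) \<longlongrightarrow> \<bar>dirac_integral (lie v \<omega>) A\<bar>) (at 0)"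
    unfolding dirac_integral_def by (intro tendsto_intros tame_quotient_tendsto[OF w])
  have bound: "\<forall>\<^sub>F h in at 0. \<bar>dirac_integral (?Q h) A\<bar> \<le> norm v * M (Suc r) * B_norm k r A"
    unfolding eventually_at_filter
  proof (intro always_eventually allI impI)
    fix h :: real assume h: "h \<noteq> 0"
    have "\<bar>dirac_integral (\<lambda>p. \<omega> (p + h *\<^sub>R v) - \<omega> p) A\<bar> \<le> norm (h *\<^sub>R v) * M (Suc r) * B_norm k r A"
      using tame_translation_difference[OF w, of "h *\<^sub>R v"] A by (simp add: tame_def)
    then show "\<bar>dirac_integral (?Q h) A\<bar> \<le> norm v * M (Suc r) * B_norm k r A"
      using h unfolding dirac_integral_form_scaleR by (simp add: abs_mult field_simps)
  qed
  show "\<bar>dirac_integral (lie v \<omega>) A\<bar> \<le> norm v * M (Suc r) * B_norm k r A"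
    by (rule tendsto_upperbound[OF lim bound]) simp
qed

text \<open>Directional derivatives need not be additive in the direction. Here the defect is a
  second difference divided by h, which is of order h by
  \<open>tame_second_difference\<close>.\<close>

lemma tame_lie_add:
  assumes w: "tame M \<omega>"
  shows "lie (u + v) \<omega> p = lie u \<omega> p + lie v \<omega> p"
proof -
  let ?Q = "\<lambda>v h. (1 / h) *\<^sub>R (\<omega> (p + h *\<^sub>R v) - \<omega> p)"
  have 1: "((\<lambda>h. ?Q (u + v) h - ?Q u h - ?Q v h) \<longlongrightarrow> lie (u + v) \<omega> p - lie u \<omega> p - lie v \<omega> p) (at 0)"
    by (intro tendsto_diff tame_quotient_tendsto[OF w])
  have 2: "((\<lambda>h. ?Q (u + v) h - ?Q u h - ?Q v h) \<longlongrightarrow> 0) (at 0)"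
  proof (rule Lim_null_comparison)
    show "((\<lambda>h. \<bar>h\<bar> * (norm u * (norm v * M 2))) \<longlongrightarrow> 0) (at (0::real))"
      by (auto intro!: tendsto_eq_intros)
    show "\<forall>\<^sub>F h in at 0. norm (?Q (u + v) h - ?Q u h - ?Q v h) \<le> \<bar>h\<bar> * (norm u * (norm v * M 2))"
      unfolding eventually_at_filter
    proof (intro always_eventually allI impI)
      fix h :: real assume h: "h \<noteq> 0"
      let ?S = "\<omega> (p + h *\<^sub>R u + h *\<^sub>R v) - \<omega> (p + h *\<^sub>R u) - (\<omega> (p + h *\<^sub>R v) - \<omega> p)"
      have eq: "?Q (u + v) h - ?Q u h - ?Q v h = (1 / h) *\<^sub>R ?S"
        by (simp add: scaleR_diff_right scaleR_add_right add.assoc)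
      have "norm (?Q (u + v) h - ?Q u h - ?Q v h) = norm ?S / \<bar>h\<bar>"
        by (simp only: eq norm_scaleR abs_divide abs_one mult_1 times_divide_eq_left)
      also have "\<dots> \<le> norm (h *\<^sub>R u) * (norm (h *\<^sub>R v) * M 2) / \<bar>h\<bar>"
        by (intro divide_right_mono tame_second_difference[OF w]) simp
      finally show "norm (?Q (u + v) h - ?Q u h - ?Q v h) \<le> \<bar>h\<bar> * (norm u * (norm v * M 2))"
        using h by (simp add: mult.left_commute)
    qed
  qed
  show ?thesis using tendsto_unique[OF _ 1 2] by (simp add: algebra_simps)
qed

lemma tame_lie_scaleR:
  assumes w: "tame M \<omega>"
  shows "lie (c *\<^sub>R v) \<omega> p = c *\<^sub>R lie v \<omega> p"
proof -
  have "((\<lambda>t. c * t) has_vector_derivative c) (at 0)"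
    by (simp flip: has_real_derivative_iff_has_vector_derivative)
  moreover have "((\<lambda>t. \<omega> (p + t *\<^sub>R v)) has_vector_derivative lie v \<omega> p) (at (c * 0))"
    using tame_has_vector_derivative[OF w, of p v 0] by simp
  ultimately have "((\<lambda>t. \<omega> (p + (c * t) *\<^sub>R v)) has_vector_derivative c *\<^sub>R lie v \<omega> p) (at 0)"
    using vector_diff_chain_at[of "\<lambda>t. c * t" c 0 "\<lambda>t. \<omega> (p + t *\<^sub>R v)" "lie v \<omega> p"]
    by (simp add: comp_def)
  then show ?thesis
    by (simp add: lie_def vector_derivative_at mult.commute)
qed

text \<open>Directional derivatives combine to a total one: they are linear in the direction, and
  the remainder is quadratic uniformly over directions because \<open>lie h \<omega>\<close> is
  Lipschitz with constant |h| times \<open>M 2\<close>.\<close>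

lemma tame_differentiable:
  assumes w: "tame M \<omega>"
  shows "\<omega> differentiable (at p)"
proof -
  have M: "0 \<le> M 2" using w by (simp add: tame_def)
  have lin: "bounded_linear (\<lambda>v. lie v \<omega> p)"
    unfolding linear_conv_bounded_linear[symmetric]
    by (intro linearI tame_lie_add[OF w] tame_lie_scaleR[OF w])
  have rem: "norm (\<omega> (p + h) - \<omega> p - lie h \<omega> p) \<le> M 2 * (norm h)\<^sup>2" for h
  proof -
    have "norm (\<omega> (p + 1 *\<^sub>R h) - \<omega> (p + 0 *\<^sub>R h) - 1 *\<^sub>R lie h \<omega> (p + 0 *\<^sub>R h)) \<le> M 2 * (norm h)\<^sup>2 * 1\<^sup>2"
    proof (rule first_order_remainder[where g = "\<lambda>t. \<omega> (p + t *\<^sub>R h)" and g' = "\<lambda>t. lie h \<omega> (p + t *\<^sub>R h)"])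
      show "((\<lambda>t. \<omega> (p + t *\<^sub>R h)) has_vector_derivative lie h \<omega> (p + t *\<^sub>R h)) (at t)" for t
        by (rule tame_has_vector_derivative[OF w])
      show "norm (lie h \<omega> (p + t *\<^sub>R h) - lie h \<omega> (p + 0 *\<^sub>R h)) \<le> M 2 * (norm h)\<^sup>2 * \<bar>t\<bar>" for t
        using tame_lipschitz[OF tame_lie[OF w], of h p "t *\<^sub>R h"]
        by (simp add: power2_eq_square numeral_2_eq_2 algebra_simps)
    qed (use M in simp)
    then show ?thesis by simp
  qed
  have "((\<lambda>h. norm (\<omega> (p + h) - \<omega> p - lie h \<omega> p) / norm h) \<longlongrightarrow> 0) (at 0)"
  proof (rule Lim_null_comparison)
    show "((\<lambda>h. M 2 * norm h) \<longlongrightarrow> 0) (at (0 :: real ^ 'n))"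
      by (auto intro!: tendsto_eq_intros)
    show "\<forall>\<^sub>F h in at 0. norm (norm (\<omega> (p + h) - \<omega> p - lie h \<omega> p) / norm h) \<le> M 2 * norm h"
      unfolding eventually_at_filter
    proof (intro always_eventually allI impI)
      fix h :: "real ^ 'n" assume "h \<noteq> 0"
      then show "norm (norm (\<omega> (p + h) - \<omega> p - lie h \<omega> p) / norm h) \<le> M 2 * norm h"
        using rem[of h] by (simp add: divide_le_eq power2_eq_square mult.assoc)
    qed
  qed
  with lin have "(\<omega> has_derivative (\<lambda>v. lie v \<omega> p)) (at p)"
    by (simp add: has_derivative_at)
  then show ?thesis by (auto simp: differentiable_def)
qed

lemma tame_C_class: "tame M \<omega> \<Longrightarrow> C_class r \<omega>"
proof (induction r arbitrary: M \<omega>)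
  case 0
  then show ?case
    using tame_differentiable[OF 0]
    by (auto simp: continuous_on_eq_continuous_at differentiable_imp_continuous_within)
next
  case (Suc r)
  then show ?case using tame_differentiable[OF Suc.prems] Suc.IH[OF tame_lie[OF Suc.prems]] by simp
qed

lemma tame_foldr_lie:
  assumes "tame M \<omega>" "\<forall>v\<in>set vs. norm v = 1"
  shows "tame (\<lambda>r. M (length vs + r)) (foldr lie vs \<omega>)"
  using assms(2)
proof (induction vs)
  case (Cons v vs)
  then show ?case using tame_lie[OF Cons.IH, of v] by simp
qed (use assms in simp)

theorem tame_mem_B_forms:
  assumes w: "tame M \<omega>"
  shows "\<omega> \<in> B_forms_r k r"
proof (rule B_forms_rI)
  show "range \<omega> \<subseteq> Lam k" "C_class r \<omega>"
    using tame_mem[OF w] tame_C_class[OF w] by auto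
  fix vs :: "(real ^ 'n) list" and p
  assume vs: "length vs \<le> r" "\<forall>v\<in>set vs. norm v = 1"
  have "norm (foldr lie vs \<omega> p) \<le> M (length vs)"
    using tame_norm[OF tame_foldr_lie[OF w vs(2)], of p] by simp
  also have "\<dots> \<le> (\<Sum>j\<le>r. M j)"
    using vs w by (intro member_le_sum) (auto simp: tame_def)
  finally show "norm (foldr lie vs \<omega> p) \<le> (\<Sum>j\<le>r. M j)" .
qed

section \<open>Representation of functionals bounded in every norm B^r\<close>

lemma dirac_induct [consumes 1, case_names zero add]:
  assumes "A \<in> dirac_chains k" "P (\<lambda>p. 0)"
    "\<And>p a A. a \<in> Lam k \<Longrightarrow> A \<in> dirac_chains k \<Longrightarrow> P A \<Longrightarrow> P (\<lambda>x. single p a x + A x)"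
  shows "P (A :: 'n dirac)"
proof -
  have "\<forall>A. A \<in> dirac_chains k \<longrightarrow> {p. A p \<noteq> 0} \<subseteq> T \<longrightarrow> P A" if "finite T" for T
    using that
  proof (induction T)
    case empty
    then show ?case using assms(2) by (auto simp: fun_eq_iff)
  next
    case (insert q T)
    show ?case
    proof (intro allI impI)
      fix A :: "'n dirac" assume A: "A \<in> dirac_chains k" "{p. A p \<noteq> 0} \<subseteq> insert q T"
      have a: "A q \<in> Lam k" using A by (auto simp: dirac_chains_def)
      let ?B = "\<lambda>x. A x - single q (A q) x"
      have B: "?B \<in> dirac_chains k" by (rule dirac_diff[OF A(1) single_mem[OF a]])
      have "{p. ?B p \<noteq> 0} \<subseteq> T" using A(2) by (auto simp: single_def split: if_splits)
      then have "P ?B" using insert.IH B by blast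
      from assms(3)[OF a B this, of q] show "P A" by simp
    qed
  qed
  then show ?thesis using assms(1) by (auto simp: dirac_chains_def)
qed

text \<open>Algebraically any linear functional is integration of a section, whose coefficients are
  its values on the chains (p; e_I); the bounds make this section tame, hence smooth with bounded
  derivatives.\<close>

theorem bounded_functional_representation:
  fixes L :: "'n dirac \<Rightarrow> real"
  assumes L: "vlinear (dirac_space k 0) real_vspace L"
    and bound: "\<And>r. \<exists>M. \<forall>A\<in>dirac_chains k. \<bar>L A\<bar> \<le> M * B_norm k r A"
  obtains \<omega> where "\<omega> \<in> vcarrier (B_forms k)" "\<And>A. A \<in> dirac_chains k \<Longrightarrow> L A = dirac_integral \<omega> A"
proof -
  have Ladd: "L (\<lambda>p. A p + B p) = L A + L B" if "A \<in> dirac_chains k" "B \<in> dirac_chains k" for A B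
    using L that by (simp add: vlinear_def real_vspace_def dirac_space_simps)
  have Lscale: "L (\<lambda>p. c *\<^sub>R A p) = c * L A" if "A \<in> dirac_chains k" for c A
    using L that by (simp add: vlinear_def real_vspace_def dirac_space_simps)
  have Lzero: "L (\<lambda>p. 0) = 0" using Lscale[OF dirac_zero, of 0] by simp
  define \<omega> :: "'n form" where "\<omega> p = (\<chi> I. if card I = k then L (single p (axis I 1)) else 0)" for p
  have w: "\<omega> p \<in> Lam k" for p by (simp add: \<omega>_def Lam_def)
  have Lsingle: "L (single p a) = \<omega> p \<bullet> a" if a: "a \<in> Lam k" for p a
  proof -
    let ?b = "\<lambda>S. \<Sum>I\<in>S. (a $ I) *\<^sub>R axis I (1::real)"
    have ax: "(a $ I) *\<^sub>R axis I (1::real) \<in> Lam k" for I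
      using a by (cases "card I = k") (auto simp: Lam_def axis_def)
    have bS: "?b S \<in> Lam k" for S
      by (induction S rule: infinite_finite_induct) (auto simp: Lam_zero intro: Lam_add ax)
    have "L (single p (?b S)) = (\<Sum>I\<in>S. \<omega> p $ I * a $ I)" if "finite S" for S
      using that
    proof (induction S)
      case empty
      then show ?case using Lzero by (simp add: single_def)
    next
      case (insert I S)
      have eq: "single p (?b (insert I S)) = (\<lambda>x. single p ((a $ I) *\<^sub>R axis I 1) x + single p (?b S) x)"
        using insert by (auto simp: single_def)
      have "L (single p ((a $ I) *\<^sub>R axis I 1)) = \<omega> p $ I * a $ I"
      proof (cases "card I = k")
        case True
        have "single p ((a $ I) *\<^sub>R axis I (1::real)) = (\<lambda>x. (a $ I) *\<^sub>R single p (axis I 1) x)"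
          by (auto simp: single_def)
        then show ?thesis using True Lscale[OF single_mem[OF axis_mem_Lam[OF True]]] by (simp add: \<omega>_def)
      next
        case False
        then have "a $ I = 0" using a by (simp add: Lam_def)
        then show ?thesis using Lzero by (simp add: single_def)
      qed
      then show ?case
        unfolding eq Ladd[OF single_mem[OF ax] single_mem[OF bS]] using insert by simp
    qed
    from this[of UNIV] have "L (single p (?b UNIV)) = \<omega> p \<bullet> a" by (simp add: inner_vec_def)
    moreover have "?b UNIV = a"
      by (simp add: vec_eq_iff axis_def if_distrib cong: if_cong)
    ultimately show ?thesis by simp
  qed
  have rep: "L A = dirac_integral \<omega> A" if "A \<in> dirac_chains k" for A
    using that
  proof (induction rule: dirac_induct)
    case zero
    then show ?case using Lzero by (simp add: dirac_integral_def)
  next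
    case (add p a A)
    then show ?case
      by (simp add: Ladd[OF single_mem] dirac_integral_add[OF single_mem] dirac_integral_single Lsingle)
  qed
  have "\<exists>M\<ge>0. \<forall>A\<in>dirac_chains k. \<bar>L A\<bar> \<le> M * B_norm k r A" for r
  proof -
    obtain M where M: "\<forall>A\<in>dirac_chains k. \<bar>L A\<bar> \<le> M * B_norm k r A" using bound by blast
    have "\<bar>L A\<bar> \<le> \<bar>M\<bar> * B_norm k r A" if "A \<in> dirac_chains k" for A
      using M that mult_right_mono[of M "\<bar>M\<bar>" "B_norm k r A"] B_norm_nonneg[of r A] by fastforce
    then show ?thesis by (intro exI[of _ "\<bar>M\<bar>"]) auto
  qed
  then obtain M where M: "\<And>r. 0 \<le> M r" "\<And>r A. A \<in> dirac_chains k \<Longrightarrow> \<bar>L A\<bar> \<le> M r * B_norm k r A"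
    by metis
  have "tame M \<omega>"
    unfolding tame_def using M w rep by auto
  then have "\<omega> \<in> vcarrier (B_forms k)"
    by (auto simp: B_forms_simps tame_mem_B_forms)
  with rep show ?thesis using that by blast
qed

end

section \<open>The spaces of chains\<close>

lemma vdiff_dirac: "vdiff (dirac_space k r) A B = (\<lambda>p. A p - B p)"
  by (simp add: vdiff_def dirac_space_simps)

section \<open>The Banach space completions for fixed r\<close>

context degree
begin

lemma lipschitz_dirac_integral:
  "\<omega> \<in> B_forms_r k r \<Longrightarrow> lcs_on.lipschitz (dirac_space k r) (dirac_integral (\<omega> :: 'n form))"
  using dirac_integral_le_B_norm
  by (intro lcs_on.lipschitz_linearI[OF lcs_dirac vlinear_dirac_integral, where M = "C_norm r \<omega>" and q = "B_norm k r"])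
    (auto simp: dirac_space_simps)

lemma hat_carrier: "vcarrier (hat_B_r k r) = {F :: 'n dirac filter. min_cauchy (dirac_space k r) F}"
  by (simp add: hat_B_r_def lcs_on.completion_simps[OF lcs_dirac])

lemma hat_seminorms: "seminorms (hat_B_r k r) = {\<lambda>F. Lim F (B_norm k r :: 'n dirac \<Rightarrow> real)}"
  by (simp add: hat_B_r_def lcs_on.completion_simps[OF lcs_dirac] dirac_space_simps)

lemma hat_cauchy: "F \<in> vcarrier (hat_B_r k r) \<Longrightarrow> lc_cauchy (dirac_space k r) (F :: 'n dirac filter)"
  by (simp add: hat_carrier min_cauchy_def)

lemma tendsto_dirac_integral:
  "lc_cauchy (dirac_space k r) (F :: 'n dirac filter) \<Longrightarrow> \<omega> \<in> B_forms_r k r \<Longrightarrow>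
    (dirac_integral \<omega> \<longlongrightarrow> Lim F (dirac_integral \<omega>)) F"
  using lcs_on.lipschitz_tendsto[OF lcs_dirac lipschitz_dirac_integral] .

lemma Lim_dirac_integral_approx:
  fixes F :: "'n dirac filter"
  assumes F: "lc_cauchy (dirac_space k r) F" and w: "\<omega> \<in> B_forms_r k r" and A: "A \<in> dirac_chains k"
    and close: "\<forall>\<^sub>F B in F. B \<in> dirac_chains k \<and> B_norm k r (\<lambda>p. A p - B p) \<le> e"
  shows "\<bar>dirac_integral \<omega> A - Lim F (dirac_integral \<omega>)\<bar> \<le> C_norm r \<omega> * e"
proof (rule tendsto_upperbound)
  show "((\<lambda>B. \<bar>dirac_integral \<omega> A - dirac_integral \<omega> B\<bar>) \<longlongrightarrow> \<bar>dirac_integral \<omega> A - Lim F (dirac_integral \<omega>)\<bar>) F"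
    by (intro tendsto_intros tendsto_dirac_integral[OF F w])
  show "\<forall>\<^sub>F B in F. \<bar>dirac_integral \<omega> A - dirac_integral \<omega> B\<bar> \<le> C_norm r \<omega> * e"
    using close
  proof eventually_elim
    case (elim B)
    then show ?case
      using dirac_integral_le_B_norm[OF w, of "\<lambda>p. A p - B p"] dirac_integral_diff[OF A, of B \<omega>]
        mult_left_mono[OF _ C_norm_nonneg[OF w], of "B_norm k r (\<lambda>p. A p - B p)" e] by simp
  qed
  show "F \<noteq> bot" using lcs_on.lc_cauchy_nonbot[OF lcs_dirac F] .
qed

text \<open>Uniformity is the point: one small set of chains serves all forms of class B^r, with an
  error proportional to \<open>C_norm r \<omega>\<close>.\<close>

lemma hat_small_set:
  fixes F :: "'n dirac filter"
  assumes F: "lc_cauchy (dirac_space k r) F" and e: "0 < e"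
  obtains P where "eventually P F" "\<And>A. P A \<Longrightarrow> A \<in> dirac_chains k"
    "\<And>A \<omega>. P A \<Longrightarrow> \<omega> \<in> B_forms_r k r \<Longrightarrow>
      \<bar>dirac_integral \<omega> A - Lim F (dirac_integral \<omega>)\<bar> \<le> C_norm r \<omega> * e"
proof -
  have q: "B_norm k r \<in> seminorms (dirac_space k r :: 'n dirac lcs)" by (simp add: dirac_space_simps)
  obtain P where P: "eventually P F" "\<And>A. P A \<Longrightarrow> A \<in> vcarrier (dirac_space k r)"
    "\<And>A B. P A \<Longrightarrow> P B \<Longrightarrow> B_norm k r (vdiff (dirac_space k r) A B) < e"
    using lcs_on.lc_cauchyD[OF lcs_dirac F q e] by blast
  show ?thesis
  proof (rule that[OF P(1)])
    show A: "A \<in> dirac_chains k" if "P A" for A using P(2)[OF that] by (simp add: dirac_space_simps)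
    fix A and \<omega> :: "'n form" assume PA: "P A" and w: "\<omega> \<in> B_forms_r k r"
    show "\<bar>dirac_integral \<omega> A - Lim F (dirac_integral \<omega>)\<bar> \<le> C_norm r \<omega> * e"
    proof (rule Lim_dirac_integral_approx[OF F w A[OF PA]])
      show "\<forall>\<^sub>F B in F. B \<in> dirac_chains k \<and> B_norm k r (\<lambda>p. A p - B p) \<le> e"
        using P(1)
      proof eventually_elim
        case (elim B)
        then show ?case using P(3)[OF PA elim] A[OF elim] by (simp add: vdiff_dirac)
      qed
    qed
  qed
qed

text \<open>The forms of class \<open>B\<^sup>r\<close> separate the points of the completion; this reduces identities between
  filters to identities between numbers.\<close>

lemma hat_eqI:
  fixes F G :: "'n dirac filter"
  assumes F: "F \<in> vcarrier (hat_B_r k r)" and G: "G \<in> vcarrier (hat_B_r k r)"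
    and eq: "\<And>\<omega>. \<omega> \<in> B_forms_r k r \<Longrightarrow> Lim F (dirac_integral \<omega>) = Lim G (dirac_integral \<omega>)"
  shows "F = G"
proof (rule lcs_on.min_cauchy_eqI[OF lcs_dirac])
  show "min_cauchy (dirac_space k r) F" "min_cauchy (dirac_space k r) G"
    using F G by (simp_all add: hat_carrier)
  fix q and e :: real assume q: "q \<in> seminorms (dirac_space k r :: 'n dirac lcs)" and e: "0 < e"
  \<comment> \<open>\<open>B_norm_leI\<close> yields a non-strict bound only; two errors of e / 4
    leave room for the strict one.\<close>
  have e4: "0 < e / 4" using e by simp
  obtain P where P: "eventually P F" "\<And>A. P A \<Longrightarrow> A \<in> dirac_chains k"
    "\<And>A \<omega>. P A \<Longrightarrow> \<omega> \<in> B_forms_r k r \<Longrightarrow>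
      \<bar>dirac_integral \<omega> A - Lim F (dirac_integral \<omega>)\<bar> \<le> C_norm r \<omega> * (e / 4)"
    using hat_small_set[OF hat_cauchy[OF F] e4] by blast
  obtain Q where Q: "eventually Q G" "\<And>A. Q A \<Longrightarrow> A \<in> dirac_chains k"
    "\<And>A \<omega>. Q A \<Longrightarrow> \<omega> \<in> B_forms_r k r \<Longrightarrow>
      \<bar>dirac_integral \<omega> A - Lim G (dirac_integral \<omega>)\<bar> \<le> C_norm r \<omega> * (e / 4)"
    using hat_small_set[OF hat_cauchy[OF G] e4] by blast
  have "B_norm k r (\<lambda>p. A p - B p) < e" if "P A" "Q B" for A B
  proof -
    have "B_norm k r (\<lambda>p. A p - B p) \<le> e / 2"
    proof (rule B_norm_leI)
      fix \<omega> :: "'n form" assume w: "\<omega> \<in> B_forms_r k r"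
      have "dirac_integral \<omega> (\<lambda>p. A p - B p) = dirac_integral \<omega> A - dirac_integral \<omega> B"
        using that by (intro dirac_integral_diff[of _ k] P Q)
      moreover have "dirac_integral \<omega> A - Lim F (dirac_integral \<omega>) \<le> C_norm r \<omega> * (e / 4)"
        using P(3)[OF that(1) w] by (rule order_trans[OF abs_ge_self])
      moreover have "- (dirac_integral \<omega> B - Lim G (dirac_integral \<omega>)) \<le> C_norm r \<omega> * (e / 4)"
        using Q(3)[OF that(2) w] by (rule order_trans[OF abs_ge_minus_self])
      moreover have "C_norm r \<omega> * (e / 4) + C_norm r \<omega> * (e / 4) = e / 2 * C_norm r \<omega>" by simp
      ultimately show "dirac_integral \<omega> (\<lambda>p. A p - B p) \<le> e / 2 * C_norm r \<omega>"
        using eq[OF w] by linarith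
    qed
    then show ?thesis using e by simp
  qed
  then show "\<exists>P Q. eventually P F \<and> eventually Q G \<and>
      (\<forall>x\<in>vcarrier (dirac_space k r). \<forall>y\<in>vcarrier (dirac_space k r). P x \<longrightarrow> Q y \<longrightarrow>
        q (vdiff (dirac_space k r) x y) < e)"
    using P(1) Q(1) q by (intro exI[of _ P] exI[of _ Q]) (auto simp: dirac_space_simps(5) vdiff_dirac)
qed

lemma hat_add_closed:
  assumes F: "F \<in> vcarrier (hat_B_r k r)" and G: "G \<in> vcarrier (hat_B_r k r)"
  shows "vadd (hat_B_r k r) F G \<in> vcarrier (hat_B_r k r :: 'n dirac filter lcs)"
  using lcs_on.completion_add_closed[OF lcs_dirac hat_cauchy[OF F] hat_cauchy[OF G]]
  by (simp add: hat_carrier flip: hat_B_r_def)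

lemma hat_scale_closed:
  assumes F: "F \<in> vcarrier (hat_B_r k r)"
  shows "vscale (hat_B_r k r) c F \<in> vcarrier (hat_B_r k r :: 'n dirac filter lcs)"
  using lcs_on.completion_scale_closed[OF lcs_dirac hat_cauchy[OF F]]
  by (simp add: hat_carrier flip: hat_B_r_def)

lemma hat_Lim_add:
  "F \<in> vcarrier (hat_B_r k r) \<Longrightarrow> G \<in> vcarrier (hat_B_r k r) \<Longrightarrow> \<omega> \<in> B_forms_r k r \<Longrightarrow>
    Lim (vadd (hat_B_r k r) F G) (dirac_integral \<omega>) = Lim F (dirac_integral \<omega>) + Lim G (dirac_integral (\<omega> :: 'n form))"
  unfolding hat_B_r_def
  by (rule lcs_on.Lim_completion_add[OF lcs_dirac vlinear_dirac_integral lipschitz_dirac_integral])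
    (auto intro: hat_cauchy simp flip: hat_B_r_def)

lemma hat_Lim_scale:
  "F \<in> vcarrier (hat_B_r k r) \<Longrightarrow> \<omega> \<in> B_forms_r k r \<Longrightarrow>
    Lim (vscale (hat_B_r k r) c F) (dirac_integral \<omega>) = c * Lim F (dirac_integral (\<omega> :: 'n form))"
  unfolding hat_B_r_def
  by (rule lcs_on.Lim_completion_scale[OF lcs_dirac vlinear_dirac_integral lipschitz_dirac_integral])
    (auto intro: hat_cauchy simp flip: hat_B_r_def)

definition hat_point :: "nat \<Rightarrow> 'n dirac \<Rightarrow> 'n dirac filter" where
  "hat_point r A = compl_point (dirac_space k r) (principal {A})"

lemma hat_point_closed: "A \<in> dirac_chains k \<Longrightarrow> hat_point r A \<in> vcarrier (hat_B_r k r)"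
  unfolding hat_point_def hat_carrier mem_Collect_eq
  by (intro lcs_on.compl_point_min_cauchy[OF lcs_dirac] lcs_on.principal_cauchy[OF lcs_dirac])
    (simp add: dirac_space_simps)

lemma Lim_hat_point:
  "A \<in> dirac_chains k \<Longrightarrow> lcs_on.lipschitz (dirac_space k r :: 'n dirac lcs) f \<Longrightarrow> Lim (hat_point r A) f = f A"
  unfolding hat_point_def by (intro lcs_on.Lim_principal[OF lcs_dirac]) (simp_all add: dirac_space_simps)

lemma hat_zero: "vzero (hat_B_r k r) = hat_point r (\<lambda>p. 0)"
  by (simp add: hat_B_r_def completion_def hat_point_def dirac_space_simps)

lemma vspace_hat: "vspace_on (hat_B_r k r :: 'n dirac filter lcs)"
proof
  have z: "Lim (vzero (hat_B_r k r)) (dirac_integral \<omega>) = 0" if "\<omega> \<in> B_forms_r k r" for \<omega> :: "'n form"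
    using Lim_hat_point[OF dirac_zero lipschitz_dirac_integral[OF that]]
    by (simp add: hat_zero dirac_integral_def)
  show zc: "vzero (hat_B_r k r) \<in> vcarrier (hat_B_r k r :: 'n dirac filter lcs)"
    by (simp add: hat_zero hat_point_closed dirac_zero)
  fix F :: "'n dirac filter" assume F: "F \<in> vcarrier (hat_B_r k r)"
  show "vscale (hat_B_r k r) c F \<in> vcarrier (hat_B_r k r)" for c using hat_scale_closed[OF F] .
  show "vscale (hat_B_r k r) 0 F = vzero (hat_B_r k r)"
    by (rule hat_eqI[where r = r]) (simp_all add: F hat_scale_closed hat_Lim_scale zc z)
  show "vscale (hat_B_r k r) 1 F = F"
    by (rule hat_eqI[where r = r]) (simp_all add: F hat_scale_closed hat_Lim_scale)
  show "vscale (hat_B_r k r) a (vscale (hat_B_r k r) b F) = vscale (hat_B_r k r) (a * b) F" for a b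
    by (rule hat_eqI[where r = r]) (simp_all add: F hat_scale_closed hat_Lim_scale)
  show "vscale (hat_B_r k r) (a + b) F = vadd (hat_B_r k r) (vscale (hat_B_r k r) a F) (vscale (hat_B_r k r) b F)" for a b
    by (rule hat_eqI[where r = r]) (simp_all add: F hat_scale_closed hat_add_closed hat_Lim_scale hat_Lim_add algebra_simps)
  fix G :: "'n dirac filter" assume G: "G \<in> vcarrier (hat_B_r k r)"
  show "vadd (hat_B_r k r) F G \<in> vcarrier (hat_B_r k r)" using hat_add_closed[OF F G] .
  show "vadd (hat_B_r k r) F G = vadd (hat_B_r k r) G F"
    by (rule hat_eqI[where r = r]) (simp_all add: F G hat_add_closed hat_Lim_add)
  show "vscale (hat_B_r k r) a (vadd (hat_B_r k r) F G) =
      vadd (hat_B_r k r) (vscale (hat_B_r k r) a F) (vscale (hat_B_r k r) a G)" for a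
    by (rule hat_eqI[where r = r]) (simp_all add: F G hat_scale_closed hat_add_closed hat_Lim_scale hat_Lim_add algebra_simps)
  fix K :: "'n dirac filter" assume K: "K \<in> vcarrier (hat_B_r k r)"
  show "vadd (hat_B_r k r) (vadd (hat_B_r k r) F G) K = vadd (hat_B_r k r) F (vadd (hat_B_r k r) G K)"
    by (rule hat_eqI[where r = r]) (simp_all add: F G K hat_add_closed hat_Lim_add)
qed

lemma lcs_hat: "lcs_on (hat_B_r k r :: 'n dirac filter lcs)"
proof -
  interpret vspace_on "hat_B_r k r :: 'n dirac filter lcs" by (rule vspace_hat)
  show ?thesis
    by unfold_locales (simp add: hat_B_r_def lcs_on.completion_seminorm[OF lcs_dirac])
qed

lemma hat_Lim_diff:
  "F \<in> vcarrier (hat_B_r k r) \<Longrightarrow> G \<in> vcarrier (hat_B_r k r) \<Longrightarrow> \<omega> \<in> B_forms_r k r \<Longrightarrow>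
    Lim (vdiff (hat_B_r k r) F G) (dirac_integral \<omega>) = Lim F (dirac_integral \<omega>) - Lim G (dirac_integral (\<omega> :: 'n form))"
  by (simp add: vdiff_def hat_Lim_add hat_Lim_scale hat_scale_closed)

lemma lipschitz_B_norm: "lcs_on.lipschitz (dirac_space k r) (B_norm k r :: 'n dirac \<Rightarrow> real)"
  by (rule lcs_on.lipschitz_seminorm[OF lcs_dirac]) (simp add: dirac_space_simps)

lemma hat_Lim_le:
  fixes F :: "'n dirac filter"
  assumes F: "F \<in> vcarrier (hat_B_r k r)" and w: "\<omega> \<in> B_forms_r k r"
  shows "\<bar>Lim F (dirac_integral \<omega>)\<bar> \<le> C_norm r \<omega> * Lim F (B_norm k r)"
proof (rule tendsto_le)
  show "F \<noteq> bot" using lcs_on.lc_cauchy_nonbot[OF lcs_dirac hat_cauchy[OF F]] .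
  show "((\<lambda>A. C_norm r \<omega> * B_norm k r A) \<longlongrightarrow> C_norm r \<omega> * Lim F (B_norm k r)) F"
    by (intro tendsto_intros lcs_on.lipschitz_tendsto[OF lcs_dirac lipschitz_B_norm hat_cauchy[OF F]])
  show "((\<lambda>A. \<bar>dirac_integral \<omega> A\<bar>) \<longlongrightarrow> \<bar>Lim F (dirac_integral \<omega>)\<bar>) F"
    by (intro tendsto_intros tendsto_dirac_integral[OF hat_cauchy[OF F] w])
  show "\<forall>\<^sub>F A in F. \<bar>dirac_integral \<omega> A\<bar> \<le> C_norm r \<omega> * B_norm k r A"
    by (intro always_eventually allI dirac_integral_le_B_norm[OF w])
qed

text \<open>Along F the Dirac chains eventually have norm at most c + e, since the approximation in
  \<open>hat_small_set\<close> is uniform over the forms. So the extended norm is still dual to the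
  forms.\<close>

lemma hat_norm_leI:
  fixes F :: "'n dirac filter"
  assumes F: "F \<in> vcarrier (hat_B_r k r)"
    and le: "\<And>\<omega>. \<omega> \<in> B_forms_r k r \<Longrightarrow> \<bar>Lim F (dirac_integral \<omega>)\<bar> \<le> C_norm r \<omega> * c"
  shows "Lim F (B_norm k r) \<le> c"
proof (rule field_le_epsilon)
  fix e :: real assume e: "0 < e"
  obtain P where P: "eventually P F" "\<And>A. P A \<Longrightarrow> A \<in> dirac_chains k"
    "\<And>A \<omega>. P A \<Longrightarrow> \<omega> \<in> B_forms_r k r \<Longrightarrow>
      \<bar>dirac_integral \<omega> A - Lim F (dirac_integral \<omega>)\<bar> \<le> C_norm r \<omega> * e"
    using hat_small_set[OF hat_cauchy[OF F] e] by blast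
  show "Lim F (B_norm k r) \<le> c + e"
  proof (rule tendsto_upperbound)
    show "(B_norm k r \<longlongrightarrow> Lim F (B_norm k r)) F"
      using lcs_on.lipschitz_tendsto[OF lcs_dirac lipschitz_B_norm hat_cauchy[OF F]] .
    show "F \<noteq> bot" using lcs_on.lc_cauchy_nonbot[OF lcs_dirac hat_cauchy[OF F]] .
    show "\<forall>\<^sub>F A in F. B_norm k r A \<le> c + e"
      using P(1)
    proof eventually_elim
      case (elim A)
      show ?case
      proof (rule B_norm_leI)
        fix \<omega> :: "'n form" assume w: "\<omega> \<in> B_forms_r k r"
        show "dirac_integral \<omega> A \<le> (c + e) * C_norm r \<omega>"
          using P(3)[OF elim w] le[OF w] by (simp add: algebra_simps abs_le_iff)
      qed
    qed
  qed
qed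

lemma hat_cauchy_mono:
  assumes rs: "r \<le> s" and F: "lc_cauchy (dirac_space k r) F"
  shows "lc_cauchy (dirac_space k s) (F :: 'n dirac filter)"
  using F unfolding lc_cauchy_def dirac_space_simps vdiff_dirac
  by (auto elim!: eventually_mono intro: le_less_trans[OF B_norm_antimono[OF rs]])

lemma hat_map_closed:
  assumes "r \<le> s" "F \<in> vcarrier (hat_B_r k r)"
  shows "hat_B_map k r s F \<in> vcarrier (hat_B_r k s :: 'n dirac filter lcs)"
  using lcs_on.compl_point_min_cauchy[OF lcs_dirac hat_cauchy_mono[OF assms(1) hat_cauchy[OF assms(2)]]]
  by (simp add: hat_B_map_def hat_carrier)

lemma hat_map_Lim:
  assumes "r \<le> s" "F \<in> vcarrier (hat_B_r k r)" "\<omega> \<in> B_forms_r k s"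
  shows "Lim (hat_B_map k r s F) (dirac_integral \<omega>) = Lim F (dirac_integral (\<omega> :: 'n form))"
  unfolding hat_B_map_def
  using lcs_on.Lim_compl_point[OF lcs_dirac lipschitz_dirac_integral[OF assms(3)]
      hat_cauchy_mono[OF assms(1) hat_cauchy[OF assms(2)]]] .

section \<open>The inductive limit and the extension of forms to it\<close>

sublocale hat: ind_system "hat_B_r k :: nat \<Rightarrow> 'n dirac filter lcs" "hat_B_map k"
proof (rule ind_system.intro)
  fix r s t :: nat assume rs: "r \<le> s"
  note mono = subsetD[OF B_forms_r_mono[OF rs]]
  show "vlinear (hat_B_r k r) (hat_B_r k s) (hat_B_map k r s :: 'n dirac filter \<Rightarrow> _)"
    unfolding vlinear_def
  proof (intro conjI ballI allI)
    show "hat_B_map k r s ` vcarrier (hat_B_r k r :: 'n dirac filter lcs) \<subseteq> vcarrier (hat_B_r k s)"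
      using hat_map_closed[OF rs] by blast
    fix F :: "'n dirac filter" assume F: "F \<in> vcarrier (hat_B_r k r)"
    show "hat_B_map k r s (vscale (hat_B_r k r) c F) = vscale (hat_B_r k s) c (hat_B_map k r s F)" for c
      by (rule hat_eqI[where r = s])
        (simp_all add: F rs mono hat_map_closed hat_scale_closed hat_map_Lim hat_Lim_scale)
    fix G :: "'n dirac filter" assume G: "G \<in> vcarrier (hat_B_r k r)"
    show "hat_B_map k r s (vadd (hat_B_r k r) F G) = vadd (hat_B_r k s) (hat_B_map k r s F) (hat_B_map k r s G)"
      by (rule hat_eqI[where r = s])
        (simp_all add: F G rs mono hat_map_closed hat_add_closed hat_map_Lim hat_Lim_add)
  qed
  fix F :: "'n dirac filter" assume st: "s \<le> t" and F: "F \<in> vcarrier (hat_B_r k r)"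
  show "hat_B_map k s t (hat_B_map k r s F) = hat_B_map k r t F"
    by (rule hat_eqI[where r = t])
      (use order_trans[OF rs st] in \<open>simp_all add: F rs st hat_map_closed hat_map_Lim subsetD[OF B_forms_r_mono[OF st]]\<close>)
qed (rule vspace_hat)

lemma lcs_hat_B: "lcs_on (hat_B k :: (nat \<times> 'n dirac filter) set lcs)"
  unfolding hat_B_def by (rule hat.lcs_ind_limit)

lemma hat_B_carrier:
  "vcarrier (hat_B k) = {hat.inj r F | r F. F \<in> vcarrier (hat_B_r k r :: 'n dirac filter lcs)}"
  by (simp add: hat_B_def hat.ind_limit_simps hat.ind_carrier)

lemma hat_B_add:
  "F \<in> vcarrier (hat_B_r k r) \<Longrightarrow> G \<in> vcarrier (hat_B_r k r) \<Longrightarrow>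
    vadd (hat_B k) (hat.inj r F) (hat.inj r G) = hat.inj r (vadd (hat_B_r k r) F (G :: 'n dirac filter))"
  by (simp add: hat_B_def hat.ind_limit_simps hat.inj_add)

lemma hat_B_scale:
  "F \<in> vcarrier (hat_B_r k r) \<Longrightarrow>
    vscale (hat_B k) c (hat.inj r F) = hat.inj r (vscale (hat_B_r k r) c (F :: 'n dirac filter))"
  by (simp add: hat_B_def hat.ind_limit_simps hat.inj_scale)

lemma hat_B_diff:
  "F \<in> vcarrier (hat_B_r k r) \<Longrightarrow> G \<in> vcarrier (hat_B_r k r) \<Longrightarrow>
    vdiff (hat_B k) (hat.inj r F) (hat.inj r G) = hat.inj r (vdiff (hat_B_r k r) F (G :: 'n dirac filter))"
  by (simp add: vdiff_def hat_B_add hat_B_scale hat_scale_closed)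

lemma hat_B_carrierE2:
  assumes "X \<in> vcarrier (hat_B k)" "Y \<in> vcarrier (hat_B k)"
  obtains r F G where "F \<in> vcarrier (hat_B_r k r :: 'n dirac filter lcs)" "X = hat.inj r F"
    "G \<in> vcarrier (hat_B_r k r)" "Y = hat.inj r G"
proof -
  have "X \<in> vcarrier (ind_vspace (hat_B_r k) (hat_B_map k))" "Y \<in> vcarrier (ind_vspace (hat_B_r k) (hat_B_map k))"
    using assms by (simp_all add: hat_B_def hat.ind_limit_simps)
  then obtain r F G where "F \<in> vcarrier (hat_B_r k r :: 'n dirac filter lcs)" "X = hat.inj r F"
    "G \<in> vcarrier (hat_B_r k r)" "Y = hat.inj r G"
    by (rule hat.ind_carrierE2)
  then show ?thesis by (rule that)
qed

text \<open>Representatives of one class agree in a later step, and the connecting maps preserve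
  limits of integrals, so \<open>the_elem\<close> meets a singleton.\<close>

lemma hat_B_eval_inj:
  fixes F :: "'n dirac filter"
  assumes F: "F \<in> vcarrier (hat_B_r k r)" and w: "\<omega> \<in> vcarrier (B_forms k)"
  shows "hat_B_eval \<omega> (hat.inj r F) = Lim F (dirac_integral \<omega>)"
proof -
  have wr: "\<omega> \<in> B_forms_r k t" for t using w by (simp add: B_forms_simps)
  have "Lim G (dirac_integral \<omega>) = Lim F (dirac_integral \<omega>)" if "(s, G) \<in> hat.inj r F" for s G
  proof -
    have "((r, F), (s, G)) \<in> ind_rel (hat_B_r k) (hat_B_map k)" using that by (simp add: hat.mem_inj)
    then obtain t where "r \<le> t" "s \<le> t" "hat_B_map k r t F = hat_B_map k s t G"
      "G \<in> vcarrier (hat_B_r k s)" by (auto simp: ind_rel_def)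
    then show ?thesis using hat_map_Lim[OF _ _ wr] F by metis
  qed
  then have "{Lim G (dirac_integral \<omega>) | s G. (s, G) \<in> hat.inj r F} = {Lim F (dirac_integral \<omega>)}"
    using hat.inj_self[OF F] by blast
  then show ?thesis by (simp add: hat_B_eval_def)
qed

lemma vlinear_hat_B_eval:
  fixes \<omega> :: "'n form"
  assumes w: "\<omega> \<in> vcarrier (B_forms k)"
  shows "vlinear (hat_B k) real_vspace (hat_B_eval \<omega>)"
  unfolding vlinear_def real_vspace_def
proof (simp, intro conjI ballI allI)
  have wr: "\<omega> \<in> B_forms_r k t" for t using w by (simp add: B_forms_simps)
  fix X :: "(nat \<times> 'n dirac filter) set" assume X: "X \<in> vcarrier (hat_B k)"
  then obtain r F where F: "F \<in> vcarrier (hat_B_r k r)" "X = hat.inj r F" by (auto simp: hat_B_carrier)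
  then show "hat_B_eval \<omega> (vscale (hat_B k) c X) = c * hat_B_eval \<omega> X" for c
    by (simp add: hat_B_scale hat_B_eval_inj[OF _ w] hat_scale_closed hat_Lim_scale wr)
  fix Y :: "(nat \<times> 'n dirac filter) set" assume Y: "Y \<in> vcarrier (hat_B k)"
  obtain r F G where "F \<in> vcarrier (hat_B_r k r)" "X = hat.inj r F" "G \<in> vcarrier (hat_B_r k r)" "Y = hat.inj r G"
    using hat_B_carrierE2[OF X Y] .
  then show "hat_B_eval \<omega> (vadd (hat_B k) X Y) = hat_B_eval \<omega> X + hat_B_eval \<omega> Y"
    by (simp add: hat_B_add hat_B_eval_inj[OF _ w] hat_add_closed hat_Lim_add wr)
qed

lemma hat_B_eval_diff:
  fixes \<omega> :: "'n form"
  assumes w: "\<omega> \<in> vcarrier (B_forms k)" and X: "X \<in> vcarrier (hat_B k)" and Y: "Y \<in> vcarrier (hat_B k)"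
  shows "hat_B_eval \<omega> (vdiff (hat_B k) X Y) = hat_B_eval \<omega> X - hat_B_eval \<omega> Y"
  using vlinear_hat_B_eval[OF w] X Y vspace_on.scale_closed[OF lcs_on.axioms(1)[OF lcs_hat_B] Y]
  by (simp add: vlinear_def real_vspace_def vdiff_def)

section \<open>Continuous seminorms on the inductive limit\<close>

lemma hat_B_seminorms:
  "q \<in> seminorms (hat_B k :: (nat \<times> 'n dirac filter) set lcs) \<longleftrightarrow> is_seminorm (hat_B k) q \<and>
    (\<forall>r. continuous_map (lc_topology (hat_B_r k r :: 'n dirac filter lcs)) euclideanreal (q \<circ> hat.inj r))"
  by (simp add: hat_B_def hat.ind_limit_simps is_seminorm_def)

text \<open>Bounded in the sense of Frechet spaces: the bound may depend on r. Nonemptiness keeps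
  the supremum in \<open>polar_gauge\<close> meaningful.\<close>

definition bounded_forms :: "'n form set \<Rightarrow> bool" where
  "bounded_forms S \<longleftrightarrow> S \<noteq> {} \<and> S \<subseteq> vcarrier (B_forms k) \<and> (\<forall>r. \<exists>M. \<forall>\<omega>\<in>S. C_norm r \<omega> \<le> M)"

text \<open>The gauge of the polar of a bounded set \<open>S\<close> of forms; it is continuous because \<open>S\<close> is
  equicontinuous on every step of the inductive limit.\<close>

definition polar_gauge :: "'n form set \<Rightarrow> (nat \<times> 'n dirac filter) set \<Rightarrow> real" where
  "polar_gauge S X = (SUP \<omega>\<in>S. \<bar>hat_B_eval \<omega> X\<bar>)"

context
  fixes S :: "'n form set"
  assumes S: "bounded_forms S"
begin

lemma bounded_forms_mem: "\<omega> \<in> S \<Longrightarrow> \<omega> \<in> vcarrier (B_forms k)"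
  using S by (auto simp: bounded_forms_def)

lemma bounded_forms_mem_r: "\<omega> \<in> S \<Longrightarrow> \<omega> \<in> B_forms_r k r"
  using bounded_forms_mem by (auto simp: B_forms_simps)

lemma hat_norm_nonneg: "F \<in> vcarrier (hat_B_r k r) \<Longrightarrow> 0 \<le> Lim F (B_norm k r :: 'n dirac \<Rightarrow> real)"
  using lcs_on.seminorm_nonneg[OF lcs_hat, of _ r F] by (simp add: hat_seminorms)

lemma equicontinuous:
  obtains M where "0 \<le> M" "\<And>\<omega> F. \<omega> \<in> S \<Longrightarrow> F \<in> vcarrier (hat_B_r k r) \<Longrightarrow>
    \<bar>Lim F (dirac_integral \<omega>)\<bar> \<le> M * Lim F (B_norm k r)"
proof -
  obtain M where M: "\<And>\<omega>. \<omega> \<in> S \<Longrightarrow> C_norm r \<omega> \<le> M"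
    using S unfolding bounded_forms_def by blast
  have M0: "0 \<le> M"
    using S M C_norm_nonneg[OF bounded_forms_mem_r] unfolding bounded_forms_def by (metis ex_in_conv order_trans)
  show ?thesis
  proof (rule that[OF M0])
    fix \<omega> F assume w: "\<omega> \<in> S" and F: "F \<in> vcarrier (hat_B_r k r :: 'n dirac filter lcs)"
    show "\<bar>Lim F (dirac_integral \<omega>)\<bar> \<le> M * Lim F (B_norm k r)"
      using hat_Lim_le[OF F bounded_forms_mem_r[OF w]] mult_right_mono[OF M[OF w] hat_norm_nonneg[OF F]] by linarith
  qed
qed

lemma bdd_polar: "X \<in> vcarrier (hat_B k) \<Longrightarrow> bdd_above ((\<lambda>\<omega>. \<bar>hat_B_eval \<omega> X\<bar>) ` S)"
proof -
  assume "X \<in> vcarrier (hat_B k)"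
  then obtain r F where F: "F \<in> vcarrier (hat_B_r k r)" "X = hat.inj r F" by (auto simp: hat_B_carrier)
  obtain M where M: "\<And>\<omega> F. \<omega> \<in> S \<Longrightarrow> F \<in> vcarrier (hat_B_r k r) \<Longrightarrow>
    \<bar>Lim F (dirac_integral \<omega>)\<bar> \<le> M * Lim F (B_norm k r)" using equicontinuous by blast
  show ?thesis
    by (rule bdd_aboveI2[where M = "M * Lim F (B_norm k r)"])
      (use M F bounded_forms_mem in \<open>simp add: hat_B_eval_inj\<close>)
qed

lemma hat_B_eval_le_polar:
  "\<omega> \<in> S \<Longrightarrow> X \<in> vcarrier (hat_B k) \<Longrightarrow> \<bar>hat_B_eval \<omega> X\<bar> \<le> polar_gauge S X"
  unfolding polar_gauge_def by (intro cSUP_upper bdd_polar)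

lemma polar_leI: "(\<And>\<omega>. \<omega> \<in> S \<Longrightarrow> \<bar>hat_B_eval \<omega> X\<bar> \<le> c) \<Longrightarrow> polar_gauge S X \<le> c"
  unfolding polar_gauge_def using S by (intro cSUP_least) (auto simp: bounded_forms_def)

lemma polar_seminorm: "is_seminorm (hat_B k) (polar_gauge S)"
  unfolding is_seminorm_def
proof (intro conjI ballI allI)
  obtain \<omega>0 where w0: "\<omega>0 \<in> S" using S by (auto simp: bounded_forms_def)
  fix X :: "(nat \<times> 'n dirac filter) set" assume X: "X \<in> vcarrier (hat_B k)"
  show nonneg: "0 \<le> polar_gauge S X" using hat_B_eval_le_polar[OF w0 X] by linarith
  have ev: "hat_B_eval \<omega> (vscale (hat_B k) c X) = c * hat_B_eval \<omega> X" if "\<omega> \<in> S" for \<omega> c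
    using vlinear_hat_B_eval[OF bounded_forms_mem[OF that]] X by (simp add: vlinear_def real_vspace_def)
  have cX: "vscale (hat_B k) c X \<in> vcarrier (hat_B k)" for c
    using vspace_on.scale_closed[OF lcs_on.axioms(1)[OF lcs_hat_B] X] .
  show "polar_gauge S (vscale (hat_B k) c X) = \<bar>c\<bar> * polar_gauge S X" for c
  proof (rule antisym)
    show "polar_gauge S (vscale (hat_B k) c X) \<le> \<bar>c\<bar> * polar_gauge S X"
      by (rule polar_leI) (simp add: ev abs_mult mult_left_mono hat_B_eval_le_polar[OF _ X])
    show "\<bar>c\<bar> * polar_gauge S X \<le> polar_gauge S (vscale (hat_B k) c X)"
    proof (cases "c = 0")
      case True
      then show ?thesis using hat_B_eval_le_polar[OF w0 cX[of c]] by simp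
    next
      case False
      have "polar_gauge S X \<le> polar_gauge S (vscale (hat_B k) c X) / \<bar>c\<bar>"
      proof (rule polar_leI)
        fix \<omega> assume w: "\<omega> \<in> S"
        show "\<bar>hat_B_eval \<omega> X\<bar> \<le> polar_gauge S (vscale (hat_B k) c X) / \<bar>c\<bar>"
          using hat_B_eval_le_polar[OF w cX[of c]] False by (simp add: ev[OF w] abs_mult field_simps)
      qed
      then show ?thesis using False by (simp add: field_simps)
    qed
  qed
  fix Y :: "(nat \<times> 'n dirac filter) set" assume Y: "Y \<in> vcarrier (hat_B k)"
  show "polar_gauge S (vadd (hat_B k) X Y) \<le> polar_gauge S X + polar_gauge S Y"
  proof (rule polar_leI)
    fix \<omega> assume w: "\<omega> \<in> S"
    have "hat_B_eval \<omega> (vadd (hat_B k) X Y) = hat_B_eval \<omega> X + hat_B_eval \<omega> Y"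
      using vlinear_hat_B_eval[OF bounded_forms_mem[OF w]] X Y by (simp add: vlinear_def real_vspace_def)
    then show "\<bar>hat_B_eval \<omega> (vadd (hat_B k) X Y)\<bar> \<le> polar_gauge S X + polar_gauge S Y"
      using hat_B_eval_le_polar[OF w X] hat_B_eval_le_polar[OF w Y] by simp
  qed
qed

lemma polar_gauge_mem: "polar_gauge S \<in> seminorms (hat_B k)"
  unfolding hat_B_seminorms
proof (intro conjI allI polar_seminorm)
  fix r
  obtain M where M: "0 \<le> M" "\<And>\<omega> F. \<omega> \<in> S \<Longrightarrow> F \<in> vcarrier (hat_B_r k r) \<Longrightarrow>
    \<bar>Lim F (dirac_integral \<omega>)\<bar> \<le> M * Lim F (B_norm k r)" using equicontinuous by blast
  let ?N = "\<lambda>F. Lim F (B_norm k r :: 'n dirac \<Rightarrow> real)"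
  have N: "?N \<in> seminorms (hat_B_r k r)" by (simp add: hat_seminorms)
  have le: "polar_gauge S (hat.inj r F) \<le> polar_gauge S (hat.inj r G) + M * ?N (vdiff (hat_B_r k r) F G)"
    if F: "F \<in> vcarrier (hat_B_r k r)" and G: "G \<in> vcarrier (hat_B_r k r)" for F G :: "'n dirac filter"
  proof (rule polar_leI)
    fix \<omega> assume w: "\<omega> \<in> S"
    have "\<bar>Lim (vdiff (hat_B_r k r) F G) (dirac_integral \<omega>)\<bar> \<le> M * ?N (vdiff (hat_B_r k r) F G)"
      using F G by (intro M(2)[OF w] vspace_on.diff_closed[OF vspace_hat])
    moreover have "\<bar>Lim G (dirac_integral \<omega>)\<bar> \<le> polar_gauge S (hat.inj r G)"
      using hat_B_eval_le_polar[OF w, of "hat.inj r G"] G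
      by (auto simp: hat_B_eval_inj[OF G bounded_forms_mem[OF w]] hat_B_carrier)
    ultimately show "\<bar>hat_B_eval \<omega> (hat.inj r F)\<bar> \<le> polar_gauge S (hat.inj r G) + M * ?N (vdiff (hat_B_r k r) F G)"
      by (simp add: hat_B_eval_inj[OF F bounded_forms_mem[OF w]] hat_Lim_diff[OF F G bounded_forms_mem_r[OF w]])
  qed
  have "lcs_on.lipschitz (hat_B_r k r) (polar_gauge S \<circ> hat.inj r)"
  proof (rule lcs_on.lipschitzI[OF lcs_hat N])
    fix F G :: "'n dirac filter"
    assume FG: "F \<in> vcarrier (hat_B_r k r)" "G \<in> vcarrier (hat_B_r k r)"
    show "\<bar>(polar_gauge S \<circ> hat.inj r) F - (polar_gauge S \<circ> hat.inj r) G\<bar> \<le> M * ?N (vdiff (hat_B_r k r) F G)"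
      using le[OF FG] le[OF FG(2,1)] lcs_on.seminorm_diff_commute[OF lcs_hat N FG] by simp
  qed
  then show "continuous_map (lc_topology (hat_B_r k r)) euclideanreal (polar_gauge S \<circ> hat.inj r)"
    by (rule lcs_on.continuous_map_lipschitz[OF lcs_hat])
qed

end

lemma bounded_forms_single: "\<omega> \<in> vcarrier (B_forms k) \<Longrightarrow> bounded_forms {\<omega>}"
  by (auto simp: bounded_forms_def)

text \<open>The polar gauge of the singleton is a continuous seminorm that dominates evaluation at
  \<omega>.\<close>

lemma lipschitz_hat_B_eval:
  fixes \<omega> :: "'n form"
  assumes w: "\<omega> \<in> vcarrier (B_forms k)"
  shows "lcs_on.lipschitz (hat_B k) (hat_B_eval \<omega>)"
  by (rule lcs_on.lipschitz_linearI[OF lcs_hat_B vlinear_hat_B_eval[OF w]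
        polar_gauge_mem[OF bounded_forms_single[OF w]], where M = 1])
    (simp add: hat_B_eval_le_polar[OF bounded_forms_single[OF w]])

text \<open>Each step carries a single norm, so continuity of q on it amounts to domination by a
  multiple of that norm; the constant may depend on r.\<close>

lemma hat_B_seminorm_bounded:
  assumes q: "q \<in> seminorms (hat_B k :: (nat \<times> 'n dirac filter) set lcs)"
  obtains M where "0 \<le> M"
    "\<And>F. F \<in> vcarrier (hat_B_r k r) \<Longrightarrow> q (hat.inj r F) \<le> M * Lim F (B_norm k r)"
proof -
  have sn: "is_seminorm (hat_B k) q" and ct: "continuous_map (lc_topology (hat_B_r k r)) euclideanreal (q \<circ> hat.inj r)"
    using q by (auto simp: hat_B_seminorms)
  have inj: "hat.inj r F \<in> vcarrier (hat_B k)" if "F \<in> vcarrier (hat_B_r k r)" for F :: "'n dirac filter"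
    using that by (auto simp: hat_B_carrier)
  have "is_seminorm (hat_B_r k r) (q \<circ> hat.inj r)"
    unfolding is_seminorm_def comp_def
    using sn inj by (auto simp: is_seminorm_def simp flip: hat_B_add hat_B_scale)
  then show ?thesis
    using lcs_on.continuous_seminorm_bounded[OF lcs_hat hat_seminorms _ ct] that by auto
qed

text \<open>Density is stated for one seminorm at a time; passing to the sum lets one Dirac chain
  approximate in two seminorms simultaneously.\<close>

lemma hat_B_seminorm_add:
  assumes p: "p \<in> seminorms (hat_B k :: (nat \<times> 'n dirac filter) set lcs)" and q: "q \<in> seminorms (hat_B k)"
  shows "(\<lambda>X. p X + q X) \<in> seminorms (hat_B k)"
  unfolding hat_B_seminorms
proof (intro conjI allI)
  have s: "is_seminorm (hat_B k) p" "is_seminorm (hat_B k) q" using p q by (auto simp: hat_B_seminorms)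
  show "is_seminorm (hat_B k) (\<lambda>X. p X + q X)"
    unfolding is_seminorm_def
  proof (intro conjI ballI allI)
    fix X assume X: "X \<in> vcarrier (hat_B k :: (nat \<times> 'n dirac filter) set lcs)"
    show "0 \<le> p X + q X" using s X by (simp add: is_seminorm_def)
    show "p (vscale (hat_B k) c X) + q (vscale (hat_B k) c X) = \<bar>c\<bar> * (p X + q X)" for c
      using s X by (simp add: is_seminorm_def algebra_simps)
    fix Y assume Y: "Y \<in> vcarrier (hat_B k :: (nat \<times> 'n dirac filter) set lcs)"
    show "p (vadd (hat_B k) X Y) + q (vadd (hat_B k) X Y) \<le> p X + q X + (p Y + q Y)"
      using s X Y unfolding is_seminorm_def by (smt (verit))
  qed
  fix r
  have "continuous_map (lc_topology (hat_B_r k r)) euclideanreal (p \<circ> hat.inj r)"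
    and "continuous_map (lc_topology (hat_B_r k r)) euclideanreal (q \<circ> hat.inj r)"
    using p q by (auto simp only: hat_B_seminorms)
  from continuous_map_add[OF this]
  show "continuous_map (lc_topology (hat_B_r k r)) euclideanreal ((\<lambda>X. p X + q X) \<circ> hat.inj r)"
    by (simp add: comp_def)
qed

section \<open>Dirac chains inside the inductive limit and their density\<close>

definition dirac_point :: "'n dirac \<Rightarrow> (nat \<times> 'n dirac filter) set" where
  "dirac_point A = hat.inj 0 (hat_point 0 A)"

text \<open>The definition goes through step 0; in step r the two candidates have the same integrals
  for all forms of class B^r, which frees the choice of the step.\<close>

lemma dirac_point_eq:
  assumes A: "A \<in> dirac_chains k"
  shows "dirac_point A = hat.inj r (hat_point r A)"
proof -
  have "hat_B_map k 0 r (hat_point 0 A) = hat_point r A"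
    by (rule hat_eqI[where r = r]) (simp_all add: A hat_map_closed hat_point_closed hat_map_Lim Lim_hat_point
        lipschitz_dirac_integral subsetD[OF B_forms_r_mono[of 0 r]])
  then show ?thesis
    using hat.inj_c[of 0 r "hat_point 0 A"] hat_point_closed[OF A] by (simp add: dirac_point_def)
qed

lemma dirac_point_closed: "A \<in> dirac_chains k \<Longrightarrow> dirac_point A \<in> vcarrier (hat_B k)"
  using hat_point_closed[of A 0] by (auto simp: dirac_point_def hat_B_carrier)

lemma hat_B_eval_dirac_point:
  assumes "A \<in> dirac_chains k" "\<omega> \<in> vcarrier (B_forms k)"
  shows "hat_B_eval \<omega> (dirac_point A) = dirac_integral \<omega> A"
proof -
  have w: "\<omega> \<in> B_forms_r k 0" using assms(2) by (simp add: B_forms_simps)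
  show ?thesis
    using assms hat_point_closed[of A 0] Lim_hat_point[OF assms(1) lipschitz_dirac_integral[OF w]]
    by (simp add: dirac_point_def hat_B_eval_inj)
qed

lemma dirac_point_add:
  assumes A: "A \<in> dirac_chains k" and B: "B \<in> dirac_chains k"
  shows "dirac_point (\<lambda>p. A p + B p) = vadd (hat_B k) (dirac_point A) (dirac_point B)"
proof -
  have "hat_point 0 (\<lambda>p. A p + B p) = vadd (hat_B_r k 0) (hat_point 0 A) (hat_point 0 B)"
    by (rule hat_eqI[where r = 0])
      (simp_all add: A B dirac_add hat_point_closed hat_add_closed hat_Lim_add Lim_hat_point
        lipschitz_dirac_integral dirac_integral_add[OF A B])
  then show ?thesis by (simp add: dirac_point_def hat_B_add hat_point_closed A B)
qed

lemma dirac_point_scale: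
  assumes A: "A \<in> dirac_chains k"
  shows "dirac_point (\<lambda>p. c *\<^sub>R A p) = vscale (hat_B k) c (dirac_point A)"
proof -
  have "hat_point 0 (\<lambda>p. c *\<^sub>R A p) = vscale (hat_B_r k 0) c (hat_point 0 A)"
    by (rule hat_eqI[where r = 0])
      (simp_all add: A dirac_scaleR hat_point_closed hat_scale_closed hat_Lim_scale Lim_hat_point
        lipschitz_dirac_integral dirac_integral_scaleR[OF A])
  then show ?thesis by (simp add: dirac_point_def hat_B_scale hat_point_closed A)
qed

lemma dirac_point_diff:
  assumes A: "A \<in> dirac_chains k" and B: "B \<in> dirac_chains k"
  shows "dirac_point (\<lambda>p. A p - B p) = vdiff (hat_B k) (dirac_point A) (dirac_point B)"
  using dirac_point_add[OF A dirac_scaleR[OF B, of "-1"]] dirac_point_scale[OF B, of "-1"]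
  by (simp add: vdiff_def)

text \<open>Each step is a completion of the Dirac chains, and on step r the seminorm is at most a
  multiple of the norm, so density within the step carries over.\<close>

lemma hat_B_dense:
  assumes X: "X \<in> vcarrier (hat_B k)" and q: "q \<in> seminorms (hat_B k)" and e: "0 < e"
  obtains A where "A \<in> dirac_chains k" "q (vdiff (hat_B k) X (dirac_point A)) < e"
proof -
  obtain r F where F: "F \<in> vcarrier (hat_B_r k r)" "X = hat.inj r F" using X by (auto simp: hat_B_carrier)
  obtain M where M: "0 \<le> M" "\<And>F. F \<in> vcarrier (hat_B_r k r) \<Longrightarrow> q (hat.inj r F) \<le> M * Lim F (B_norm k r)"
    using hat_B_seminorm_bounded[OF q] by blast
  define d where "d = e / (M + 1)"
  have d: "0 < d" using e M by (simp add: d_def)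
  obtain P where P: "eventually P F" "\<And>A. P A \<Longrightarrow> A \<in> dirac_chains k"
    "\<And>A \<omega>. P A \<Longrightarrow> \<omega> \<in> B_forms_r k r \<Longrightarrow>
      \<bar>dirac_integral \<omega> A - Lim F (dirac_integral \<omega>)\<bar> \<le> C_norm r \<omega> * d"
    using hat_small_set[OF hat_cauchy[OF F(1)] d] by blast
  obtain A where PA: "P A"
    using P(1) lcs_on.lc_cauchy_nonbot[OF lcs_dirac hat_cauchy[OF F(1)]] eventually_happens' by blast
  have A: "A \<in> dirac_chains k" using P(2)[OF PA] .
  let ?D = "vdiff (hat_B_r k r) F (hat_point r A)"
  have D: "?D \<in> vcarrier (hat_B_r k r)"
    using F A by (intro vspace_on.diff_closed[OF vspace_hat] hat_point_closed)
  have "Lim ?D (B_norm k r) \<le> d"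
  proof (rule hat_norm_leI[OF D])
    fix \<omega> :: "'n form" assume w: "\<omega> \<in> B_forms_r k r"
    show "\<bar>Lim ?D (dirac_integral \<omega>)\<bar> \<le> C_norm r \<omega> * d"
      using P(3)[OF PA w] by (simp add: hat_Lim_diff[OF F(1) hat_point_closed[OF A] w]
          Lim_hat_point[OF A lipschitz_dirac_integral[OF w]] abs_minus_commute)
  qed
  then have "M * Lim ?D (B_norm k r) \<le> M * d" using M by (intro mult_left_mono)
  then have "q (hat.inj r ?D) \<le> M * d" using M(2)[OF D] by linarith
  also have "M * d < (M + 1) * d" using d by simp
  also have "(M + 1) * d = e" using M by (simp add: d_def)
  finally show ?thesis
    using that[OF A] by (simp add: F dirac_point_eq[OF A, of r] hat_B_diff hat_point_closed[OF A])
qed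

section \<open>Chains as limits of Dirac chains\<close>

lemma chains_carrier:
  "vcarrier (diff_chains k) = {J :: (nat \<times> 'n dirac filter) set filter. min_cauchy (hat_B k) J}"
  by (simp add: diff_chains_def lcs_on.completion_simps[OF lcs_hat_B])

text \<open>Two approximations of e / 2 each: a point \<open>X0\<close> of a small set of J, then a
  Dirac chain close to \<open>X0\<close>.\<close>

lemma chain_approx:
  assumes J: "lc_cauchy (hat_B k) J" and q: "q \<in> seminorms (hat_B k)" and e: "0 < e"
  obtains A where "A \<in> dirac_chains k"
    "\<forall>\<^sub>F X in J. X \<in> vcarrier (hat_B k) \<and> q (vdiff (hat_B k) X (dirac_point A)) < e"
proof -
  have e2: "0 < e / 2" using e by simp
  obtain P where P: "eventually P J" "\<And>X. P X \<Longrightarrow> X \<in> vcarrier (hat_B k)"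
    "\<And>X Y. P X \<Longrightarrow> P Y \<Longrightarrow> q (vdiff (hat_B k) X Y) < e / 2"
    using lcs_on.lc_cauchyD[OF lcs_hat_B J q e2] by blast
  obtain X0 where X0: "P X0"
    using P(1) lcs_on.lc_cauchy_nonbot[OF lcs_hat_B J] eventually_happens' by blast
  obtain A where A: "A \<in> dirac_chains k" "q (vdiff (hat_B k) X0 (dirac_point A)) < e / 2"
    using hat_B_dense[OF P(2)[OF X0] q e2] .
  show ?thesis
  proof (rule that[OF A(1)])
    show "\<forall>\<^sub>F X in J. X \<in> vcarrier (hat_B k) \<and> q (vdiff (hat_B k) X (dirac_point A)) < e"
      using P(1)
    proof eventually_elim
      case (elim X)
      then show ?case
        using lcs_on.seminorm_diff_triangle[OF lcs_hat_B q P(2)[OF elim] P(2)[OF X0] dirac_point_closed[OF A(1)]]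
          P(3)[OF elim X0] A(2) P(2) by auto
    qed
  qed
qed

lemma tendsto_chain_eval:
  fixes \<omega> :: "'n form"
  shows "lc_cauchy (hat_B k) J \<Longrightarrow> \<omega> \<in> vcarrier (B_forms k) \<Longrightarrow> (hat_B_eval \<omega> \<longlongrightarrow> chain_eval \<omega> J) J"
  unfolding chain_eval_def using lcs_on.lipschitz_tendsto[OF lcs_hat_B lipschitz_hat_B_eval] .

text \<open>Stated for any q dominating \<omega> because it serves twice: with a polar gauge, for
  uniform approximation on bounded sets, and with the seminorm of a norming form, for
  injectivity.\<close>

lemma chain_eval_approx:
  fixes \<omega> :: "'n form"
  assumes J: "lc_cauchy (hat_B k) J" and w: "\<omega> \<in> vcarrier (B_forms k)"
    and A: "A \<in> dirac_chains k"
    and near: "\<forall>\<^sub>F X in J. X \<in> vcarrier (hat_B k) \<and> q (vdiff (hat_B k) X (dirac_point A)) < e"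
    and le: "\<And>X. X \<in> vcarrier (hat_B k) \<Longrightarrow> \<bar>hat_B_eval \<omega> X\<bar> \<le> q X"
  shows "\<bar>chain_eval \<omega> J - dirac_integral \<omega> A\<bar> \<le> e"
proof (rule tendsto_upperbound)
  show "((\<lambda>X. \<bar>hat_B_eval \<omega> X - dirac_integral \<omega> A\<bar>) \<longlongrightarrow> \<bar>chain_eval \<omega> J - dirac_integral \<omega> A\<bar>) J"
    by (intro tendsto_intros tendsto_chain_eval J w)
  show "J \<noteq> bot" using lcs_on.lc_cauchy_nonbot[OF lcs_hat_B J] .
  show "\<forall>\<^sub>F X in J. \<bar>hat_B_eval \<omega> X - dirac_integral \<omega> A\<bar> \<le> e"
    using near
  proof eventually_elim
    case (elim X)
    have "\<bar>hat_B_eval \<omega> (vdiff (hat_B k) X (dirac_point A))\<bar> \<le> q (vdiff (hat_B k) X (dirac_point A))"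
      using elim A by (intro le vspace_on.diff_closed[OF lcs_on.axioms(1)[OF lcs_hat_B]] dirac_point_closed) auto
    then show ?case
      using elim hat_B_eval_diff[OF w _ dirac_point_closed[OF A], of X] hat_B_eval_dirac_point[OF A w] by auto
  qed
qed

lemma chain_eval_uniform_approx:
  assumes J: "lc_cauchy (hat_B k) J" and S: "bounded_forms S" and e: "0 < e"
  obtains A where "A \<in> dirac_chains k" "\<And>\<omega>. \<omega> \<in> S \<Longrightarrow> \<bar>chain_eval \<omega> J - dirac_integral \<omega> A\<bar> \<le> e"
proof -
  obtain A where A: "A \<in> dirac_chains k"
    "\<forall>\<^sub>F X in J. X \<in> vcarrier (hat_B k) \<and> polar_gauge S (vdiff (hat_B k) X (dirac_point A)) < e"
    using chain_approx[OF J polar_gauge_mem[OF S] e] .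
  show ?thesis
    using chain_eval_approx[OF J bounded_forms_mem[OF S] A hat_B_eval_le_polar[OF S]] by (rule that[OF A(1)])
qed

end

section \<open>The evaluation map\<close>

context degree
begin

lemma lcs_B_forms: "lcs_on (B_forms k :: 'n form lcs)"
proof -
  interpret vspace_on "B_forms k :: 'n form lcs" by (rule vspace_B_forms)
  show ?thesis
  proof unfold_locales
    fix q assume "q \<in> seminorms (B_forms k :: 'n form lcs)"
    then obtain r where q: "q = C_norm r" by (auto simp: B_forms_simps)
    show "is_seminorm (B_forms k) q"
      unfolding is_seminorm_def B_forms_simps(1,3,4) q
    proof (intro conjI ballI allI)
      fix \<omega> :: "'n form" assume "\<omega> \<in> (\<Inter>r. B_forms_r k r)"
      then have w: "\<omega> \<in> B_forms_r k r" by blast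
      show "0 \<le> C_norm r \<omega>" using C_norm_nonneg[OF w] .
      show "C_norm r (\<lambda>p. c *\<^sub>R \<omega> p) = \<bar>c\<bar> * C_norm r \<omega>" for c
      proof (cases "c = 0")
        case True
        then show ?thesis
          using B_forms_r_scaleR[OF w, of 0] C_norm_nonneg[of "\<lambda>p. 0 *\<^sub>R \<omega> p" k r] by simp
      next
        case False
        have "C_norm r \<omega> \<le> \<bar>inverse c\<bar> * C_norm r (\<lambda>p. c *\<^sub>R \<omega> p)"
          using B_forms_r_scaleR(2)[OF B_forms_r_scaleR(1)[OF w, of c], of "inverse c"] False by simp
        then have "\<bar>c\<bar> * C_norm r \<omega> \<le> C_norm r (\<lambda>p. c *\<^sub>R \<omega> p)"
          using False by (simp add: field_simps)
        with B_forms_r_scaleR(2)[OF w, of c] show ?thesis by simp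
      qed
      fix \<eta> :: "'n form" assume "\<eta> \<in> (\<Inter>r. B_forms_r k r)"
      then have "\<eta> \<in> B_forms_r k r" by blast
      then show "C_norm r (\<lambda>p. \<omega> p + \<eta> p) \<le> C_norm r \<omega> + C_norm r \<eta>"
        using B_forms_r_add(2)[OF w] by blast
    qed
  qed
qed

section \<open>Chains as continuous functionals on forms\<close>

lemma hat_B_eval_form_add:
  fixes \<omega> \<eta> :: "'n form"
  assumes w: "\<omega> \<in> vcarrier (B_forms k)" and e: "\<eta> \<in> vcarrier (B_forms k)" and X: "X \<in> vcarrier (hat_B k)"
  shows "hat_B_eval (\<lambda>p. \<omega> p + \<eta> p) X = hat_B_eval \<omega> X + hat_B_eval \<eta> X"
proof -
  obtain r F where F: "F \<in> vcarrier (hat_B_r k r)" "X = hat.inj r F" using X by (auto simp: hat_B_carrier)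
  have s: "(\<lambda>p. \<omega> p + \<eta> p) \<in> vcarrier (B_forms k)"
    using w e by (simp add: B_forms_simps B_forms_r_add)
  have "((\<lambda>A. dirac_integral \<omega> A + dirac_integral \<eta> A) \<longlongrightarrow> Lim F (dirac_integral \<omega>) + Lim F (dirac_integral \<eta>)) F"
    using w e by (intro tendsto_add tendsto_dirac_integral[OF hat_cauchy[OF F(1)]]) (auto simp: B_forms_simps)
  then have "Lim F (dirac_integral (\<lambda>p. \<omega> p + \<eta> p)) = Lim F (dirac_integral \<omega>) + Lim F (dirac_integral \<eta>)"
    unfolding dirac_integral_form_add
    by (intro tendsto_Lim lcs_on.lc_cauchy_nonbot[OF lcs_dirac hat_cauchy[OF F(1)]])
  then show ?thesis
    using F by (simp add: hat_B_eval_inj w e s)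
qed

lemma hat_B_eval_form_scaleR:
  fixes \<omega> :: "'n form"
  assumes w: "\<omega> \<in> vcarrier (B_forms k)" and X: "X \<in> vcarrier (hat_B k)"
  shows "hat_B_eval (\<lambda>p. c *\<^sub>R \<omega> p) X = c * hat_B_eval \<omega> X"
proof -
  obtain r F where F: "F \<in> vcarrier (hat_B_r k r)" "X = hat.inj r F" using X by (auto simp: hat_B_carrier)
  have s: "(\<lambda>p. c *\<^sub>R \<omega> p) \<in> vcarrier (B_forms k)"
    using w by (simp add: B_forms_simps B_forms_r_scaleR)
  have "((\<lambda>A. c * dirac_integral \<omega> A) \<longlongrightarrow> c * Lim F (dirac_integral \<omega>)) F"
    using w by (intro tendsto_intros tendsto_dirac_integral[OF hat_cauchy[OF F(1)]]) (auto simp: B_forms_simps)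
  then have "Lim F (dirac_integral (\<lambda>p. c *\<^sub>R \<omega> p)) = c * Lim F (dirac_integral \<omega>)"
    unfolding dirac_integral_form_scaleR
    by (intro tendsto_Lim lcs_on.lc_cauchy_nonbot[OF lcs_dirac hat_cauchy[OF F(1)]])
  then show ?thesis
    using F by (simp add: hat_B_eval_inj w s)
qed

text \<open>Linearity in the form, as opposed to linearity in the chain, which is
  \<open>vlinear_eval_map\<close>. It holds for integrals over Dirac chains and passes through the
  limits along F and J.\<close>

lemma vlinear_chain_eval:
  assumes J: "lc_cauchy (hat_B k) J"
  shows "vlinear (B_forms k) real_vspace (\<lambda>\<omega> :: 'n form. chain_eval \<omega> J)"
  unfolding vlinear_def real_vspace_def
proof (simp, intro conjI ballI allI)
  note unique = tendsto_unique[OF lcs_on.lc_cauchy_nonbot[OF lcs_hat_B J]]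
  note carr = lcs_on.lc_cauchy_carrier[OF lcs_hat_B J]
  fix \<omega> :: "'n form" assume w: "\<omega> \<in> vcarrier (B_forms k)"
  show "chain_eval (vscale (B_forms k) c \<omega>) J = c * chain_eval \<omega> J" for c
  proof (rule unique)
    show "(hat_B_eval (vscale (B_forms k) c \<omega>) \<longlongrightarrow> chain_eval (vscale (B_forms k) c \<omega>) J) J"
      using tendsto_chain_eval[OF J vspace_on.scale_closed[OF vspace_B_forms w]] .
    have "((\<lambda>X. c * hat_B_eval \<omega> X) \<longlongrightarrow> c * chain_eval \<omega> J) J"
      by (intro tendsto_intros tendsto_chain_eval J w)
    then show "(hat_B_eval (vscale (B_forms k) c \<omega>) \<longlongrightarrow> c * chain_eval \<omega> J) J"
      by (rule Lim_transform_eventually)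
        (use carr in eventually_elim, simp add: B_forms_simps hat_B_eval_form_scaleR[OF w])
  qed
  fix \<eta> :: "'n form" assume e: "\<eta> \<in> vcarrier (B_forms k)"
  show "chain_eval (vadd (B_forms k) \<omega> \<eta>) J = chain_eval \<omega> J + chain_eval \<eta> J"
  proof (rule unique)
    show "(hat_B_eval (vadd (B_forms k) \<omega> \<eta>) \<longlongrightarrow> chain_eval (vadd (B_forms k) \<omega> \<eta>) J) J"
      using tendsto_chain_eval[OF J vspace_on.add_closed[OF vspace_B_forms w e]] .
    have "((\<lambda>X. hat_B_eval \<omega> X + hat_B_eval \<eta> X) \<longlongrightarrow> chain_eval \<omega> J + chain_eval \<eta> J) J"
      by (intro tendsto_intros tendsto_chain_eval J w e)
    then show "(hat_B_eval (vadd (B_forms k) \<omega> \<eta>) \<longlongrightarrow> chain_eval \<omega> J + chain_eval \<eta> J) J"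
      by (rule Lim_transform_eventually)
        (use carr in eventually_elim, simp add: B_forms_simps hat_B_eval_form_add[OF w e])
  qed
qed

text \<open>A chain is bounded on bounded sets of forms, and on the Frechet space of forms every
  bounded functional is continuous.\<close>

lemma chain_eval_continuous:
  assumes J: "lc_cauchy (hat_B k) J"
  obtains r M where "\<And>\<omega> :: 'n form. \<omega> \<in> vcarrier (B_forms k) \<Longrightarrow> \<bar>chain_eval \<omega> J\<bar> \<le> M * C_norm r \<omega>"
proof (rule ccontr)
  assume contr: "\<not> thesis"
  \<comment> \<open>Letting the order and the constant both be r produces one sequence that violates
    every possible estimate in the end.\<close>
  have "\<exists>\<omega> :: 'n form. \<omega> \<in> vcarrier (B_forms k) \<and> real r * C_norm r \<omega> < \<bar>chain_eval \<omega> J\<bar>" for r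
    using contr that[where M = "real r" and r = r] by (meson not_le)
  then obtain w :: "nat \<Rightarrow> 'n form" where w: "\<And>r. w r \<in> vcarrier (B_forms k)"
    and big: "\<And>r. real r * C_norm r (w r) < \<bar>chain_eval (w r) J\<bar>" by metis
  have wr: "w r \<in> B_forms_r k s" for r s using w[of r] by (simp add: B_forms_simps)
  have scale: "chain_eval (\<lambda>p. c *\<^sub>R \<omega> p) J = c * chain_eval \<omega> J" if "\<omega> \<in> vcarrier (B_forms k)" for c and \<omega> :: "'n form"
    using vlinear_chain_eval[OF J] that by (simp add: vlinear_def real_vspace_def B_forms_simps)
  have pos: "0 < C_norm r (w r)" for r
  proof (rule C_norm_pos[OF wr])
    show "w r \<noteq> (\<lambda>p. 0)"
    proof
      assume 0: "w r = (\<lambda>p. 0)"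
      have "chain_eval (w r) J = 0" using scale[OF w[of r], of 0] by (simp add: 0)
      then show False
        using big[of r] C_norm_nonneg[OF wr, of r r] by (simp add: mult_less_0_iff not_less)
    qed
  qed
  define v where "v r = (\<lambda>p. (1 / C_norm r (w r)) *\<^sub>R w r p)" for r
  have v: "v r \<in> vcarrier (B_forms k)" for r
    using wr by (simp add: v_def B_forms_simps B_forms_r_scaleR)
  have vr: "v r \<in> B_forms_r k s" for r s using v[of r] by (simp add: B_forms_simps)
  have v1: "C_norm r (v r) \<le> 1" for r
    using B_forms_r_scaleR(2)[OF wr[of r r], of "1 / C_norm r (w r)"] pos[of r] by (simp add: v_def)
  have vbig: "real r < \<bar>chain_eval (v r) J\<bar>" for r
    using big[of r] pos[of r] by (simp add: v_def scale[OF w] field_simps abs_mult)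
  have "bounded_forms (range v)"
    unfolding bounded_forms_def
  proof (intro conjI allI)
    fix s
    \<comment> \<open>From index s on the normalization bounds the norm C^s by 1; the finitely many
      earlier terms are absorbed into the sum.\<close>
    have "C_norm s (v r) \<le> 1 + (\<Sum>j<s. C_norm s (v j))" for r
    proof (cases "r < s")
      case True
      then have "C_norm s (v r) \<le> (\<Sum>j<s. C_norm s (v j))"
        using C_norm_nonneg[OF vr] by (intro member_le_sum) auto
      then show ?thesis by simp
    next
      case False
      then have "C_norm s (v r) \<le> 1"
        using C_norm_mono[OF _ vr, of s r r] v1[of r] by simp
      moreover have "0 \<le> (\<Sum>j<s. C_norm s (v j))"
        using C_norm_nonneg[OF vr] by (intro sum_nonneg) auto
      ultimately show ?thesis by simp
    qed
    then show "\<exists>M. \<forall>\<omega>\<in>range v. C_norm s \<omega> \<le> M" by blast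
  qed (use v in auto)
  then obtain A where A: "A \<in> dirac_chains k" "\<And>\<omega>. \<omega> \<in> range v \<Longrightarrow> \<bar>chain_eval \<omega> J - dirac_integral \<omega> A\<bar> \<le> 1"
    using chain_eval_uniform_approx[OF J _ zero_less_one] by blast
  \<comment> \<open>The mass of A does not depend on r, so A is bounded on all \<open>v r\<close> by
    one constant, whereas J exceeds r on \<open>v r\<close>.\<close>
  obtain r where r: "1 + mass A < real r" using reals_Archimedean2 by blast
  have "\<bar>dirac_integral (v r) A\<bar> \<le> C_norm r (v r) * mass A"
    using dirac_integral_le_mass[OF vr] .
  also have "\<dots> \<le> 1 * mass A"
    using v1 by (intro mult_right_mono) (auto simp: mass_def intro: sum_nonneg)
  finally show False using A(2)[of "v r"] vbig[of r] r by auto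
qed

lemma eval_map_mem:
  assumes J: "lc_cauchy (hat_B k) J"
  shows "(eval_map k J :: 'n form \<Rightarrow> real) \<in> vcarrier (cont_dual (B_forms k))"
proof -
  obtain r M where M: "\<And>\<omega> :: 'n form. \<omega> \<in> vcarrier (B_forms k) \<Longrightarrow> \<bar>chain_eval \<omega> J\<bar> \<le> M * C_norm r \<omega>"
    using chain_eval_continuous[OF J] by blast
  have lin: "vlinear (B_forms k) real_vspace (eval_map k J :: 'n form \<Rightarrow> real)"
    using vlinear_chain_eval[OF J]
    by (simp add: vlinear_def real_vspace_def eval_map_def vspace_on.add_closed[OF vspace_B_forms]
        vspace_on.scale_closed[OF vspace_B_forms])
  have "lcs_on.lipschitz (B_forms k) (eval_map k J :: 'n form \<Rightarrow> real)"
    by (rule lcs_on.lipschitz_linearI[OF lcs_B_forms lin, of "C_norm r" M])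
      (simp_all add: B_forms_simps(5) eval_map_def M)
  then show ?thesis
    using lin lcs_on.continuous_map_lipschitz[OF lcs_B_forms]
    by (simp add: cont_dual_def eval_map_def)
qed

lemma vlinear_eval_map: "vlinear (diff_chains k) (cont_dual (B_forms k :: 'n form lcs)) (eval_map k)"
  unfolding vlinear_def
proof (intro conjI ballI allI)
  show "eval_map k ` vcarrier (diff_chains k) \<subseteq> vcarrier (cont_dual (B_forms k :: 'n form lcs))"
    using eval_map_mem by (auto simp: chains_carrier min_cauchy_def)
  fix J :: "(nat \<times> 'n dirac filter) set filter" assume "J \<in> vcarrier (diff_chains k)"
  then have J: "lc_cauchy (hat_B k) J" by (simp add: chains_carrier min_cauchy_def)
  show "eval_map k (vscale (diff_chains k) c J) = vscale (cont_dual (B_forms k)) c (eval_map k J)" for c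
    using lcs_on.Lim_completion_scale[OF lcs_hat_B vlinear_hat_B_eval lipschitz_hat_B_eval J]
    by (auto simp: eval_map_def cont_dual_def diff_chains_def chain_eval_def intro!: restrict_ext)
  fix J' :: "(nat \<times> 'n dirac filter) set filter" assume "J' \<in> vcarrier (diff_chains k)"
  then have J': "lc_cauchy (hat_B k) J'" by (simp add: chains_carrier min_cauchy_def)
  show "eval_map k (vadd (diff_chains k) J J') = vadd (cont_dual (B_forms k)) (eval_map k J) (eval_map k J')"
    using lcs_on.Lim_completion_add[OF lcs_hat_B vlinear_hat_B_eval lipschitz_hat_B_eval J J']
    by (auto simp: eval_map_def cont_dual_def diff_chains_def chain_eval_def intro!: restrict_ext)
qed

text \<open>Hahn--Banach, combined with the fact that functionals on Dirac chains dominated by a continuous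
  seminorm are forms.\<close>

lemma norming_form:
  assumes q: "q \<in> seminorms (hat_B k)" and A: "A \<in> dirac_chains k"
  obtains \<omega> :: "'n form" where "\<omega> \<in> vcarrier (B_forms k)" "dirac_integral \<omega> A = q (dirac_point A)"
    "\<And>X. X \<in> vcarrier (hat_B k) \<Longrightarrow> \<bar>hat_B_eval \<omega> X\<bar> \<le> q X"
proof -
  let ?p = "\<lambda>A. q (dirac_point A)"
  have sn: "is_seminorm (hat_B k) q" using q by (simp add: hat_B_seminorms)
  \<comment> \<open>The operations of \<open>dirac_space k r\<close> do not depend on r, so step 0
    stands for all of them.\<close>
  have sub: "vspace_on.sublinear (dirac_space k 0) ?p"
    unfolding vspace_on.sublinear_def[OF vspace_dirac] dirac_space_simps
    using sn by (auto simp: is_seminorm_def dirac_point_add dirac_point_scale dirac_point_closed)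
  have "A \<in> vcarrier (dirac_space k 0)" using A by (simp add: dirac_space_simps)
  then obtain L where L: "vlinear (dirac_space k 0) real_vspace L"
    "\<forall>B\<in>dirac_chains k. L B \<le> ?p B" "L A = ?p A"
    using vspace_on.Hahn_Banach[OF vspace_dirac sub] unfolding dirac_space_simps by blast
  have Labs: "\<bar>L B\<bar> \<le> ?p B" if B: "B \<in> dirac_chains k" for B
  proof -
    have "L (vscale (dirac_space k 0) (-1) B) = (-1) * L B"
      using L(1) B by (simp add: vlinear_def real_vspace_def dirac_space_simps(1))
    then have "L (\<lambda>p. (-1) *\<^sub>R B p) = (-1) * L B" by (simp add: dirac_space_simps(4))
    moreover have "?p (\<lambda>p. (-1) *\<^sub>R B p) = ?p B"
      unfolding dirac_point_scale[OF B] using sn dirac_point_closed[OF B] by (simp add: is_seminorm_def)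
    moreover have "L (\<lambda>p. (-1) *\<^sub>R B p) \<le> ?p (\<lambda>p. (-1) *\<^sub>R B p)" using L(2) dirac_scaleR[OF B] by blast
    ultimately show ?thesis using L(2) B by (simp add: abs_le_iff)
  qed
  \<comment> \<open>Continuity of q on every step yields a bound for every norm B^r, which is what
    the representation by a form asks for.\<close>
  have "\<exists>M. \<forall>B\<in>dirac_chains k. \<bar>L B\<bar> \<le> M * B_norm k r B" for r
  proof -
    obtain M where M: "\<And>F. F \<in> vcarrier (hat_B_r k r) \<Longrightarrow> q (hat.inj r F) \<le> M * Lim F (B_norm k r)"
      using hat_B_seminorm_bounded[OF q] by blast
    have "\<bar>L B\<bar> \<le> M * B_norm k r B" if B: "B \<in> dirac_chains k" for B
      using Labs[OF B] M[OF hat_point_closed[OF B]] Lim_hat_point[OF B lipschitz_B_norm]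
      by (simp add: dirac_point_eq[OF B, of r])
    then show ?thesis by blast
  qed
  then obtain \<omega> where w: "\<omega> \<in> vcarrier (B_forms k)" "\<And>B. B \<in> dirac_chains k \<Longrightarrow> L B = dirac_integral \<omega> B"
    using bounded_functional_representation[OF L(1)] by blast
  show ?thesis
  proof (rule that[OF w(1)])
    show "dirac_integral \<omega> A = q (dirac_point A)" using L(3) w(2)[OF A] by simp
    fix X :: "(nat \<times> 'n dirac filter) set" assume X: "X \<in> vcarrier (hat_B k)"
    \<comment> \<open>Approximation in q alone would not control \<omega> on the error X - B, since
      that is the claim itself; adding the gauge of \<omega> to q does.\<close>
    let ?g = "polar_gauge {\<omega>}"
    have b: "bounded_forms {\<omega>}" using bounded_forms_single[OF w(1)] .
    have g: "?g \<in> seminorms (hat_B k)" using polar_gauge_mem[OF b] .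
    show "\<bar>hat_B_eval \<omega> X\<bar> \<le> q X"
    proof (rule field_le_epsilon)
      fix e :: real assume "0 < e"
      then obtain B where B: "B \<in> dirac_chains k"
        "q (vdiff (hat_B k) X (dirac_point B)) + ?g (vdiff (hat_B k) X (dirac_point B)) < e"
        using hat_B_dense[OF X hat_B_seminorm_add[OF q g]] by blast
      let ?D = "vdiff (hat_B k) X (dirac_point B)"
      have D: "?D \<in> vcarrier (hat_B k)"
        using vspace_on.diff_closed[OF lcs_on.axioms(1)[OF lcs_hat_B] X dirac_point_closed[OF B(1)]] .
      have "hat_B_eval \<omega> X = hat_B_eval \<omega> ?D + dirac_integral \<omega> B"
        using hat_B_eval_diff[OF w(1) X dirac_point_closed[OF B(1)]] hat_B_eval_dirac_point[OF B(1) w(1)] by simp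
      moreover have "\<bar>hat_B_eval \<omega> ?D\<bar> \<le> ?g ?D" using hat_B_eval_le_polar[OF b _ D] by simp
      moreover have "\<bar>dirac_integral \<omega> B\<bar> \<le> q (dirac_point B)" using Labs[OF B(1)] w(2)[OF B(1)] by simp
      moreover have "q (dirac_point B) \<le> q X + q ?D"
        using lcs_on.seminorm_reverse_triangle[OF lcs_hat_B q X dirac_point_closed[OF B(1)]] by linarith
      ultimately show "\<bar>hat_B_eval \<omega> X\<bar> \<le> q X + e" using B(2) by linarith
    qed
  qed
qed

text \<open>Norming the difference of two approximating Dirac chains reduces the distance of J and
  J' to their values on one form, which agree. The form depends on the approximants, so agreement on
  all forms is used.\<close>

lemma inj_on_eval_map: "inj_on (eval_map k) (vcarrier (diff_chains k :: (nat \<times> 'n dirac filter) set filter lcs))"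
proof (rule inj_onI)
  fix J J' :: "(nat \<times> 'n dirac filter) set filter"
  assume JJ': "J \<in> vcarrier (diff_chains k)" "J' \<in> vcarrier (diff_chains k)" and eq: "eval_map k J = eval_map k J'"
  then have m: "min_cauchy (hat_B k) J" "min_cauchy (hat_B k) J'" by (simp_all add: chains_carrier)
  then have J: "lc_cauchy (hat_B k) J" and J': "lc_cauchy (hat_B k) J'" by (simp_all add: min_cauchy_def)
  show "J = J'"
  proof (rule lcs_on.min_cauchy_eqI[OF lcs_hat_B m])
    fix q and e :: real assume q: "q \<in> seminorms (hat_B k :: (nat \<times> 'n dirac filter) set lcs)" and e: "0 < e"
    have e4: "0 < e / 4" using e by simp
    obtain A where A: "A \<in> dirac_chains k"
      and near: "\<forall>\<^sub>F X in J. X \<in> vcarrier (hat_B k) \<and> q (vdiff (hat_B k) X (dirac_point A)) < e / 4"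
      using chain_approx[OF J q e4] .
    obtain B where B: "B \<in> dirac_chains k"
      and near': "\<forall>\<^sub>F X in J'. X \<in> vcarrier (hat_B k) \<and> q (vdiff (hat_B k) X (dirac_point B)) < e / 4"
      using chain_approx[OF J' q e4] .
    obtain \<omega> :: "'n form" where w: "\<omega> \<in> vcarrier (B_forms k)"
      and int: "dirac_integral \<omega> (\<lambda>p. A p - B p) = q (dirac_point (\<lambda>p. A p - B p))"
      and le: "\<And>X. X \<in> vcarrier (hat_B k) \<Longrightarrow> \<bar>hat_B_eval \<omega> X\<bar> \<le> q X"
      using norming_form[OF q dirac_diff[OF A B]] by blast
    have "chain_eval \<omega> J = chain_eval \<omega> J'"
      using fun_cong[OF eq, of \<omega>] w by (simp add: eval_map_def)
    then have "q (dirac_point (\<lambda>p. A p - B p)) \<le> e / 4 + e / 4"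
      using chain_eval_approx[OF J w A near le] chain_eval_approx[OF J' w B near' le]
        dirac_integral_diff[OF A B, of \<omega>] int by linarith
    then have AB: "q (vdiff (hat_B k) (dirac_point A) (dirac_point B)) \<le> e / 4 + e / 4"
      by (simp add: dirac_point_diff[OF A B])
    note a = dirac_point_closed[OF A] and b = dirac_point_closed[OF B]
    note tri = lcs_on.seminorm_diff_triangle[OF lcs_hat_B q]
    \<comment> \<open>The distances add up to e / 4 + e / 2 + e / 4, with strict inequality at both
      ends.\<close>
    have "q (vdiff (hat_B k) X Y) < e"
      if X: "X \<in> vcarrier (hat_B k)" "q (vdiff (hat_B k) X (dirac_point A)) < e / 4"
        and Y: "Y \<in> vcarrier (hat_B k)" "q (vdiff (hat_B k) Y (dirac_point B)) < e / 4" for X Y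
      using tri[OF X(1) a Y(1)] tri[OF a b Y(1)] lcs_on.seminorm_diff_commute[OF lcs_hat_B q Y(1) b] X(2) Y(2) AB
      by linarith
    then show "\<exists>P Q. eventually P J \<and> eventually Q J' \<and>
        (\<forall>x\<in>vcarrier (hat_B k). \<forall>y\<in>vcarrier (hat_B k). P x \<longrightarrow> Q y \<longrightarrow> q (vdiff (hat_B k) x y) < e)"
      using near near' by blast
  qed
qed

end

section \<open>A functional that is not a chain\<close>

text \<open>The limit superior of a bounded sequence, as a real number: the infimum of its eventual
  upper bounds. It is sublinear, and linear functionals below it are extended limits.\<close>

definition seq_upper :: "(nat \<Rightarrow> real) \<Rightarrow> real" where
  "seq_upper f = Inf {c. \<forall>\<^sub>F m in sequentially. f m \<le> c}"

context
  fixes f :: "nat \<Rightarrow> real" and C :: real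
  assumes bounded: "\<And>m. \<bar>f m\<bar> \<le> C"
begin

lemma seq_upper_le: "\<forall>\<^sub>F m in sequentially. f m \<le> c \<Longrightarrow> seq_upper f \<le> c"
  unfolding seq_upper_def
proof (rule cInf_lower)
  show "bdd_below {c. \<forall>\<^sub>F m in sequentially. f m \<le> c}"
  proof (rule bdd_belowI)
    fix c assume "c \<in> {c. \<forall>\<^sub>F m in sequentially. f m \<le> c}"
    then obtain m where "f m \<le> c" by (auto simp: eventually_sequentially)
    then show "- C \<le> c" using bounded[of m] by linarith
  qed
qed simp

lemma eventually_le_seq_upper:
  assumes "0 < e"
  shows "\<forall>\<^sub>F m in sequentially. f m \<le> seq_upper f + e"
proof -
  have "C \<in> {c. \<forall>\<^sub>F m in sequentially. f m \<le> c}"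
    using bounded by (auto intro!: always_eventually simp: abs_le_iff)
  then obtain c where c: "\<forall>\<^sub>F m in sequentially. f m \<le> c" "c < seq_upper f + e"
    using cInf_lessD[of "{c. \<forall>\<^sub>F m in sequentially. f m \<le> c}" "seq_upper f + e"] assms
    unfolding seq_upper_def by auto
  then show ?thesis by (auto elim: eventually_mono)
qed

end

lemma seq_upper_add:
  assumes f: "\<And>m. \<bar>f m\<bar> \<le> C" and g: "\<And>m. \<bar>g m\<bar> \<le> D"
  shows "seq_upper (\<lambda>m. f m + g m) \<le> seq_upper f + seq_upper g"
proof (rule field_le_epsilon)
  fix e :: real assume e: "0 < e"
  show "seq_upper (\<lambda>m. f m + g m) \<le> seq_upper f + seq_upper g + e"
  proof (rule seq_upper_le)
    show "\<bar>f m + g m\<bar> \<le> C + D" for m using f[of m] g[of m] by linarith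
    show "\<forall>\<^sub>F m in sequentially. f m + g m \<le> seq_upper f + seq_upper g + e"
      using eventually_le_seq_upper[of f, OF f half_gt_zero[OF e]]
        eventually_le_seq_upper[of g, OF g half_gt_zero[OF e]]
      by eventually_elim simp
  qed
qed

lemma seq_upper_scale:
  assumes f: "\<And>m. \<bar>f m\<bar> \<le> C" and c: "0 \<le> c"
  shows "seq_upper (\<lambda>m. c * f m) = c * seq_upper f"
proof -
  have le: "seq_upper (\<lambda>m. b * g m) \<le> b * seq_upper g"
    if g: "\<And>m. \<bar>g m\<bar> \<le> D" and b: "0 < b" for b D and g :: "nat \<Rightarrow> real"
  proof (rule field_le_epsilon)
    fix e :: real assume e: "0 < e"
    show "seq_upper (\<lambda>m. b * g m) \<le> b * seq_upper g + e"
    proof (rule seq_upper_le)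
      show "\<bar>b * g m\<bar> \<le> b * D" for m using g[of m] b by (simp add: abs_mult)
      show "\<forall>\<^sub>F m in sequentially. b * g m \<le> b * seq_upper g + e"
        using eventually_le_seq_upper[of g, OF g divide_pos_pos[OF e b]]
        by eventually_elim (use b in \<open>simp add: field_simps\<close>)
    qed
  qed
  show ?thesis
  proof (cases "c = 0")
    case True
    have "seq_upper (\<lambda>m. 0) \<le> 0" by (rule seq_upper_le[of _ 0]) auto
    moreover have "0 \<le> seq_upper (\<lambda>m. 0)"
    proof (rule field_le_epsilon)
      fix e :: real assume "0 < e"
      then show "0 \<le> seq_upper (\<lambda>m. 0) + e"
        using eventually_le_seq_upper[of "\<lambda>m. 0" 0 e] by simp
    qed
    ultimately show ?thesis using True by simp
  next
    case False
    then have c: "0 < c" using c by simp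
    have cf: "\<bar>c * f m\<bar> \<le> c * C" for m using f[of m] c by (simp add: abs_mult)
    \<comment> \<open>The opposite inequality is \<open>le\<close> for the factor 1 / c, applied to
      the scaled sequence.\<close>
    have "seq_upper (\<lambda>m. inverse c * (c * f m)) \<le> inverse c * seq_upper (\<lambda>m. c * f m)"
      by (rule le[OF cf]) (use c in simp)
    then have "c * seq_upper f \<le> seq_upper (\<lambda>m. c * f m)"
      using c by (simp add: field_simps)
    moreover have "seq_upper (\<lambda>m. c * f m) \<le> c * seq_upper f" by (rule le[OF f c])
    ultimately show ?thesis by simp
  qed
qed

text \<open>Phase and amplitude make the family closed under Lie derivatives: the derivative along v
  shifts the phase by pi / 2 and scales the amplitude by t v_i.\<close>

definition wave :: "'n \<Rightarrow> real \<Rightarrow> real \<Rightarrow> ('n::finite) multivec \<Rightarrow> 'n form" where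
  "wave i t s a = (\<lambda>p. cos (t * (p $ i) + s) *\<^sub>R a)"

lemma has_derivative_wave:
  "(wave i t s a has_derivative (\<lambda>v. wave i t (s + pi / 2) ((t * (v $ i)) *\<^sub>R a) p)) (at p)"
proof -
  have shift: "cos (t * (p $ i) + (s + pi / 2)) = - sin (t * (p $ i) + s)"
    by (simp add: minus_sin_cos_eq add.assoc)
  show ?thesis
    unfolding wave_def shift
    by (auto intro!: derivative_eq_intros bounded_linear.has_derivative[OF bounded_linear_vec_nth]
        simp: algebra_simps)
qed

lemma lie_wave: "lie v (wave i t s a) = wave i t (s + pi / 2) ((t * (v $ i)) *\<^sub>R a)"
  by (intro ext lie_eq[OF has_derivative_wave])

lemma C_class_wave: "C_class r (wave i t s a)"
proof (induction r arbitrary: s a)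
  case 0
  show ?case
    using has_derivative_continuous[OF has_derivative_wave]
    by (auto simp: continuous_on_eq_continuous_at)
next
  case (Suc r)
  then show ?case by (simp add: lie_wave differentiableI[OF has_derivative_wave])
qed

text \<open>Each derivative multiplies the amplitude by t v_i, where |t| <= 1 and |v_i| <= |v| = 1,
  so all orders share one bound.\<close>

lemma foldr_lie_wave:
  assumes "\<bar>t\<bar> \<le> 1" "\<forall>v\<in>set vs. norm v = 1"
  shows "\<exists>s' c. \<bar>c\<bar> \<le> 1 \<and> foldr lie vs (wave i t s a) = wave i t s' (c *\<^sub>R a)"
  using assms(2)
proof (induction vs)
  case Nil
  show ?case by (intro exI[of _ s] exI[of _ 1]) simp
next
  case (Cons v vs)
  then obtain s' c where c: "\<bar>c\<bar> \<le> 1" "foldr lie vs (wave i t s a) = wave i t s' (c *\<^sub>R a)" by auto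
  have "\<bar>v $ i\<bar> \<le> 1" using component_le_norm_cart[of v i] Cons.prems by simp
  then have "\<bar>t * (v $ i) * c\<bar> \<le> 1"
    using assms(1) c(1) by (simp add: abs_mult mult_le_one)
  with c show ?case
    by (intro exI[of _ "s' + pi / 2"] exI[of _ "t * (v $ i) * c"]) (simp add: lie_wave)
qed

lemma wave_mem:
  assumes "a \<in> Lam k" "\<bar>t\<bar> \<le> 1"
  shows "wave i t s a \<in> B_forms_r k r" "C_norm r (wave i t s a) \<le> norm a"
proof -
  have *: "norm (foldr lie vs (wave i t s a) p) \<le> norm a" if "\<forall>v\<in>set vs. norm v = 1" for vs p
  proof -
    obtain s' c where c: "\<bar>c\<bar> \<le> 1" "foldr lie vs (wave i t s a) = wave i t s' (c *\<^sub>R a)"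
      using foldr_lie_wave[OF assms(2) \<open>\<forall>v\<in>set vs. norm v = 1\<close>] by blast
    have "norm (foldr lie vs (wave i t s a) p) = \<bar>cos (t * (p $ i) + s')\<bar> * \<bar>c\<bar> * norm a"
      unfolding c(2) by (simp add: wave_def abs_mult)
    also have "\<dots> \<le> 1 * norm a"
      using c(1) by (intro mult_right_mono mult_le_one) auto
    finally show ?thesis by simp
  qed
  show "wave i t s a \<in> B_forms_r k r"
    using assms(1) * by (intro B_forms_rI C_class_wave) (auto simp: wave_def intro: Lam_scaleR)
  show "C_norm r (wave i t s a) \<le> norm a" using * by (intro C_norm_leI)
qed

text \<open>The argument is pi / 2 times 3^(m - j), and a power of 3 is odd.\<close>

lemma cos_odd_multiple: "j \<le> m \<Longrightarrow> cos (1 / 3 ^ j * (pi / 2 * 3 ^ m)) = 0"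
proof -
  assume jm: "j \<le> m"
  obtain q :: nat where q: "(3::nat) ^ (m - j) = 2 * q + 1"
    using oddE[of "(3::nat) ^ (m - j)"] by auto
  have "(3::real) ^ m = 3 ^ j * 3 ^ (m - j)" using jm by (simp flip: power_add)
  moreover have "(3::real) ^ (m - j) = 2 * real q + 1"
    using arg_cong[OF q, of real] by simp
  ultimately have "1 / 3 ^ j * (pi / 2 * 3 ^ m) = of_int (int q) * pi + pi / 2"
    by (simp add: field_simps)
  then show ?thesis unfolding cos_zero_iff_int2 by blast
qed

context degree
begin

text \<open>The functional is an extended limit along the points \<open>(pi / 2) 3\<^sup>m e\<^sub>i\<close>. It vanishes on the forms
  \<open>cos (x\<^sub>i / 3\<^sup>j) e\<^sub>I\<close> but not on \<open>e\<^sub>I\<close>, although the former are bounded in every norm and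
  converge pointwise to the latter.\<close>

lemma eval_map_not_surj:
  "\<exists>L\<in>vcarrier (cont_dual (B_forms k :: 'n form lcs)). L \<notin> eval_map k ` vcarrier (diff_chains k)"
proof -
  obtain I :: "'n set" where I: "card I = k" by (rule index_exists)
  \<comment> \<open>Any coordinate will do; one exists because types are nonempty, which is n >=
    1.\<close>
  define i :: 'n where "i = undefined"
  define a :: "'n multivec" where "a = axis I 1"
  have a: "a \<in> Lam k" using axis_mem_Lam[OF I] by (simp add: a_def)
  have aI: "a $ I = 1" by (simp add: a_def)
  define x :: "nat \<Rightarrow> real ^ 'n" where "x m = axis i (pi / 2 * 3 ^ m)" for m
  \<comment> \<open>Linear functionals below this limit superior lie above the corresponding limit
    inferior, so they see only the behaviour of the form far out along the points
    \<open>x m\<close>.\<close>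
  define p :: "'n form \<Rightarrow> real" where "p \<omega> = seq_upper (\<lambda>m. \<omega> (x m) $ I)" for \<omega>
  have bnd: "\<bar>\<omega> (x m) $ I\<bar> \<le> C_norm 0 \<omega>" if "\<omega> \<in> vcarrier (B_forms k)" for \<omega> :: "'n form" and m
    using that component_le_norm_cart[of "\<omega> (x m)" I] norm_le_C_norm[of \<omega> k 0 "x m"]
    by (auto simp: B_forms_simps intro: order_trans)
  have p_le: "p \<omega> \<le> c" if "\<omega> \<in> vcarrier (B_forms k)" "\<forall>\<^sub>F m in sequentially. \<omega> (x m) $ I \<le> c" for \<omega> c
    unfolding p_def using seq_upper_le[OF bnd[OF that(1)] that(2)] .
  have "vspace_on.sublinear (B_forms k) p"
    unfolding vspace_on.sublinear_def[OF vspace_B_forms]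
  proof (intro conjI ballI allI impI)
    fix \<omega> :: "'n form" assume w: "\<omega> \<in> vcarrier (B_forms k)"
    show "p (vscale (B_forms k) c \<omega>) = c * p \<omega>" if "0 \<le> c" for c
      using seq_upper_scale[OF bnd[OF w] that] by (simp add: p_def B_forms_simps)
    fix \<eta> :: "'n form" assume e: "\<eta> \<in> vcarrier (B_forms k)"
    show "p (vadd (B_forms k) \<omega> \<eta>) \<le> p \<omega> + p \<eta>"
      using seq_upper_add[OF bnd[OF w] bnd[OF e]] by (simp add: p_def B_forms_simps)
  qed
  \<comment> \<open>Only domination by p is wanted from Hahn--Banach, so it is anchored at the zero
    form.\<close>
  then obtain L where L: "vlinear (B_forms k) real_vspace L" "\<forall>\<omega>\<in>vcarrier (B_forms k). L \<omega> \<le> p \<omega>"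
    using vspace_on.Hahn_Banach[OF vspace_B_forms _ vspace_on.zero_closed[OF vspace_B_forms]] by blast
  have neg: "(\<lambda>q. (-1) *\<^sub>R \<omega> q) \<in> vcarrier (B_forms k)" "L (\<lambda>q. (-1) *\<^sub>R \<omega> q) = - L \<omega>"
    if "\<omega> \<in> vcarrier (B_forms k)" for \<omega>
  proof -
    have eq: "(\<lambda>q. (-1) *\<^sub>R \<omega> q) = vscale (B_forms k) (-1) \<omega>" by (simp add: B_forms_simps)
    show "(\<lambda>q. (-1) *\<^sub>R \<omega> q) \<in> vcarrier (B_forms k)"
      unfolding eq using vspace_on.scale_closed[OF vspace_B_forms that] .
    have "L (vscale (B_forms k) (-1) \<omega>) = (-1) * L \<omega>"
      using L(1) that by (simp add: vlinear_def real_vspace_def)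
    then show "L (\<lambda>q. (-1) *\<^sub>R \<omega> q) = - L \<omega>" unfolding eq by simp
  qed
  have upper: "L \<omega> \<le> c" if "\<omega> \<in> vcarrier (B_forms k)" "\<forall>\<^sub>F m in sequentially. \<omega> (x m) $ I \<le> c" for \<omega> c
    using L(2) p_le[OF that] that(1) by (meson order_trans)
  have lower: "c \<le> L \<omega>" if w: "\<omega> \<in> vcarrier (B_forms k)" and c: "\<forall>\<^sub>F m in sequentially. c \<le> \<omega> (x m) $ I" for \<omega> c
    using upper[OF neg(1)[OF w], of "- c"] c neg(2)[OF w] by simp
  have Labs: "\<bar>L \<omega>\<bar> \<le> 1 * C_norm 0 \<omega>" if w: "\<omega> \<in> vcarrier (B_forms k)" for \<omega>
  proof -
    have "\<omega> (x m) $ I \<le> C_norm 0 \<omega>" "- C_norm 0 \<omega> \<le> \<omega> (x m) $ I" for m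
      using bnd[OF w, of m] by (simp_all add: abs_le_iff)
    then show ?thesis using upper[OF w] lower[OF w, of "- C_norm 0 \<omega>"] by (simp add: abs_le_iff)
  qed
  define L' where "L' = restrict L (vcarrier (B_forms k))"
  have L'lin: "vlinear (B_forms k) real_vspace L'"
    using L(1)
    by (simp add: vlinear_def real_vspace_def L'_def vspace_on.add_closed[OF vspace_B_forms]
        vspace_on.scale_closed[OF vspace_B_forms])
  have "lcs_on.lipschitz (B_forms k) L'"
    by (rule lcs_on.lipschitz_linearI[OF lcs_B_forms L'lin, of "C_norm 0" 1])
      (use Labs in \<open>simp_all add: B_forms_simps(5) L'_def\<close>)
  then have L'mem: "L' \<in> vcarrier (cont_dual (B_forms k))"
    using L'lin lcs_on.continuous_map_lipschitz[OF lcs_B_forms]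
    by (simp add: cont_dual_def L'_def)
  have "L' \<noteq> eval_map k J" if "J \<in> vcarrier (diff_chains k)" for J
  proof
    assume eq: "L' = eval_map k J"
    have J: "lc_cauchy (hat_B k) J" using that by (simp add: chains_carrier min_cauchy_def)
    define w where "w j = wave i (1 / 3 ^ j) 0 a" for j :: nat
    define w' where "w' = wave i 0 0 a"
    have small: "\<bar>1 / 3 ^ j :: real\<bar> \<le> 1" for j :: nat by simp
    have w: "w j \<in> vcarrier (B_forms k)" for j
      unfolding w_def B_forms_simps using wave_mem(1)[OF a small] by blast
    have w': "w' \<in> vcarrier (B_forms k)"
      unfolding w'_def B_forms_simps using wave_mem(1)[OF a, of 0] by simp
    let ?S = "insert w' (range w)"
    have "\<forall>\<omega>\<in>?S. C_norm r \<omega> \<le> norm a" for r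
      using wave_mem(2)[OF a small] wave_mem(2)[OF a, of 0] by (auto simp: w_def w'_def)
    then have "bounded_forms ?S"
      using w w' unfolding bounded_forms_def by blast
    \<comment> \<open>The errors on both sides must add up to less than 1, the gap between L = 0 on
      the waves and L >= 1 on the constant form.\<close>
    then obtain A where A: "A \<in> dirac_chains k" "\<And>\<omega>. \<omega> \<in> ?S \<Longrightarrow> \<bar>chain_eval \<omega> J - dirac_integral \<omega> A\<bar> \<le> 1 / 4"
      using chain_eval_uniform_approx[OF J, of ?S "1 / 4"] by auto
    have ev: "chain_eval \<omega> J = L \<omega>" if "\<omega> \<in> vcarrier (B_forms k)" for \<omega>
      using fun_cong[OF eq, of \<omega>] that by (simp add: L'_def eval_map_def)
    have "L (w j) = 0" for j
    proof -
      have z: "\<forall>\<^sub>F m in sequentially. w j (x m) $ I = 0"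
        unfolding eventually_sequentially
      proof (intro exI[of _ j] allI impI)
        fix m assume "j \<le> m"
        have "w j (x m) = cos (1 / 3 ^ j * (pi / 2 * 3 ^ m)) *\<^sub>R a"
          by (simp add: w_def wave_def x_def mult.commute)
        then show "w j (x m) $ I = 0" unfolding cos_odd_multiple[OF \<open>j \<le> m\<close>] by simp
      qed
      show ?thesis
        using upper[OF w[of j], of 0] lower[OF w[of j], of 0] z by (simp add: eventually_mono)
    qed
    then have wA: "dirac_integral (w j) A \<le> 1 / 4" for j
      using A(2)[of "w j"] ev[OF w[of j]] by (simp add: abs_le_iff)
    have "1 \<le> L w'"
      by (rule lower[OF w']) (simp add: w'_def wave_def aI)
    then have w'A: "3 / 4 \<le> dirac_integral w' A"
      using order_trans[OF abs_ge_self A(2)[of w']] ev[OF w'] by simp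
    \<comment> \<open>A fixed Dirac chain has finite support, so pointwise convergence of the forms
      suffices.\<close>
    have "(\<lambda>j. dirac_integral (w j) A) \<longlonglongrightarrow> dirac_integral w' A"
      unfolding dirac_integral_def w_def w'_def wave_def
    proof (intro tendsto_intros)
      have "(\<lambda>j. (1 / 3) ^ j :: real) \<longlonglongrightarrow> 0" by (rule LIMSEQ_power_zero) simp
      then show "(\<lambda>j. 1 / 3 ^ j :: real) \<longlonglongrightarrow> 0" by (simp add: power_one_over)
    qed
    then have "dirac_integral w' A \<le> 1 / 4"
      by (rule LIMSEQ_le_const2) (use wA in auto)
    with w'A show False by simp
  qed
  then show ?thesis using L'mem by blast
qed

end

theorem theorem3p0p4:
  fixes k :: nat
    and u :: "(nat \<times> ('n::finite) dirac filter) set filter \<Rightarrow> ('n form \<Rightarrow> real)"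
  assumes "k \<le> CARD('n)"
  defines "u \<equiv> eval_map k"
  shows "vlinear (diff_chains k) (cont_dual (B_forms k)) u
    \<and> inj_on u (vcarrier (diff_chains k))
    \<and> u ` vcarrier (diff_chains k) \<subset> vcarrier (cont_dual (B_forms k))"
proof -
  interpret degree k "TYPE('n)" by unfold_locales (rule assms(1))
  \<comment> \<open>The inclusion of the image is part of linearity; that it is proper comes from
    the extended limit.\<close>
  show ?thesis
    using vlinear_eval_map inj_on_eval_map eval_map_not_surj
    unfolding u_def vlinear_def by blast
qed

end
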